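(* There exist a computable function $g$ and an algorithm solving Minimum Move in time $g(\gamma,\alpha)\cdot(\tau+\delta)^{O(1)}\cdot\log(\mathbf s)$ for every society $\mathbf s$, every winning condition $\Psi(\mathbf s)\in\mathcal P_{0,(\tau),\delta,\gamma,\alpha,\beta}$ (i.e. quantifier-free), and every linear objective function $f(\mathbf m)=\mathbf c^{\intercal}\mathbf m$.
   Context: Let $\tau\in\mathbb N$ be the number of types of people. **Societies and moves.** A society is a non-negative integer vector $\mathbf s=(s_1,\dots,s_\tau)$. A move is a vector $\mathbf m=(m_{1,1},\dots,m_{\tau,\tau})\in\mathbb Z^{\tau^2}$; intuitively, $m_{i,j}$ is the number of people of type $i$ turning type $j$. The change associated with $\mathbf m$ is $\Delta(\mathbf m)=(\Delta_1,\dots,\Delta_\tau)$ with $\Delta_i=\sum_{j=1}^\tau (m_{j,i}-m_{i,j})$ (its entries sum to $0$). The change $\Delta(\mathbf m)$ is feasible with respect to $\mathbf s$ if $\mathbf s+\Delta(\mathbf m)\ge\mathbf 0$. **Winning conditions.** A winning condition of width $\tau$ is a predicate with $\tau$ free (integer) variables. $\hat{\mathcal P}_{0,(\tau),\delta,\gamma,\alpha,\beta}$ is the set of quantifier-free Presburger Arithmetic formulas in $\tau$ free integer variables $\mathbf x$ that are a disjunction of at most $\delta$ conjunctions, each consisting of at most $\gamma$ linear inequalities $\mathbf a^{\intercal}\mathbf x\le b$ with integer data, $\|\mathbf a\|_\infty\le\alpha$ and $|b|\le\beta$; $\mathcal P_{0,(\tau),\delta,\gamma,\alpha,\beta}$ is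 the set of Presburger Arithmetic formulas equivalent to some formula of $\hat{\mathcal P}_{0,(\tau),\delta,\gamma,\alpha,\beta}$. **Minimum Move.** Input: a society $\mathbf s$, an objective function $f:\mathbb Z^{\tau^2}\to\mathbb Z$, a winning condition $\Psi$. Task: find a move $\mathbf m$ minimizing $f(\mathbf m)$ subject to $\Psi(\mathbf s+\Delta(\mathbf m))$ holding and $\Delta(\mathbf m)$ being feasible with respect to $\mathbf s$. Here $\log(\mathbf s)$ refers to the binary encoding length of $\mathbf s$.
   Formalization: The algorithm is given the winning condition as an equivalent disjunction of conjunctions within the bounds δ, γ, α, β, since no bound independent of the length of an arbitrary equivalent Presburger formula can hold; time counts additions, subtractions, comparisons and array accesses. *)

theory Defs
  imports Complex_Main "HOL-Library.Log_Nat"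
begin

section \<open>Societies and moves\<close>

text \<open>
  The number \<open>\<tau>\<close> of types varies inside the statement, so vectors of length \<open>\<tau>\<close> are functions on
  \<open>nat\<close> of which only the entries below \<open>\<tau>\<close> are ever used; types are numbered from 0.
  Moves are arbitrary integer vectors: negative entries are allowed.
\<close>

definition society :: "nat \<Rightarrow> (nat \<Rightarrow> int) \<Rightarrow> bool" where
  "society \<tau> s \<longleftrightarrow> (\<forall>i<\<tau>. 0 \<le> s i)"

definition change :: "nat \<Rightarrow> (nat \<Rightarrow> nat \<Rightarrow> int) \<Rightarrow> nat \<Rightarrow> int" where
  "change \<tau> m i = (\<Sum>j<\<tau>. m j i - m i j)"

definition feasible :: "nat \<Rightarrow> (nat \<Rightarrow> int) \<Rightarrow> (nat \<Rightarrow> int) \<Rightarrow> bool" where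
  "feasible \<tau> s d \<longleftrightarrow> (\<forall>i<\<tau>. 0 \<le> s i + d i)"

definition linear_objective :: "nat \<Rightarrow> (nat \<Rightarrow> nat \<Rightarrow> int) \<Rightarrow> (nat \<Rightarrow> nat \<Rightarrow> int) \<Rightarrow> int" where
  "linear_objective \<tau> c m = (\<Sum>i<\<tau>. \<Sum>j<\<tau>. c i j * m i j)"

text \<open>Binary encoding length of a society; the number 0 is written with one digit.\<close>

definition encoding_length :: "nat \<Rightarrow> (nat \<Rightarrow> int) \<Rightarrow> nat" where
  "encoding_length \<tau> s = (\<Sum>i<\<tau>. max 1 (floorlog 2 (nat (s i))))"


section \<open>Presburger Arithmetic\<close>

datatype pa_term = Var nat | Const int | Add pa_term pa_term | Scale int pa_term

datatype pa =
    TT | FF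
  | Le pa_term pa_term
  | Neg pa
  | Conj pa pa
  | Disj pa pa
  | Ex nat pa
  | All nat pa

fun term_val :: "pa_term \<Rightarrow> (nat \<Rightarrow> int) \<Rightarrow> int" where
  "term_val (Var i) x = x i"
| "term_val (Const k) x = k"
| "term_val (Add u v) x = term_val u x + term_val v x"
| "term_val (Scale k u) x = k * term_val u x"

fun holds :: "pa \<Rightarrow> (nat \<Rightarrow> int) \<Rightarrow> bool" where
  "holds TT x \<longleftrightarrow> True"
| "holds FF x \<longleftrightarrow> False"
| "holds (Le u v) x \<longleftrightarrow> term_val u x \<le> term_val v x"
| "holds (Neg p) x \<longleftrightarrow> \<not> holds p x"
| "holds (Conj p q) x \<longleftrightarrow> holds p x \<and> holds q x"
| "holds (Disj p q) x \<longleftrightarrow> holds p x \<or> holds q x"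
| "holds (Ex i p) x \<longleftrightarrow> (\<exists>z. holds p (x(i := z)))"
| "holds (All i p) x \<longleftrightarrow> (\<forall>z. holds p (x(i := z)))"

fun term_vars :: "pa_term \<Rightarrow> nat set" where
  "term_vars (Var i) = {i}"
| "term_vars (Const k) = {}"
| "term_vars (Add u v) = term_vars u \<union> term_vars v"
| "term_vars (Scale k u) = term_vars u"

fun free_vars :: "pa \<Rightarrow> nat set" where
  "free_vars TT = {}"
| "free_vars FF = {}"
| "free_vars (Le u v) = term_vars u \<union> term_vars v"
| "free_vars (Neg p) = free_vars p"
| "free_vars (Conj p q) = free_vars p \<union> free_vars q"
| "free_vars (Disj p q) = free_vars p \<union> free_vars q"
| "free_vars (Ex i p) = free_vars p - {i}"
| "free_vars (All i p) = free_vars p - {i}"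

definition pa_equiv :: "pa \<Rightarrow> pa \<Rightarrow> bool" where
  "pa_equiv p q \<longleftrightarrow> (\<forall>x. holds p x \<longleftrightarrow> holds q x)"

text \<open>
  A list of lists of pairs \<open>(a, b)\<close> is the data of a disjunction of conjunctions of inequalities
  \<open>a\<^sub>0 x\<^sub>0 + \<dots> + a\<^sub>\<tau>\<^sub>-\<^sub>1 x\<^sub>\<tau>\<^sub>-\<^sub>1 \<le> b\<close>.
\<close>

type_synonym dnf = "(int list \<times> int) list list"

definition ineq_formula :: "int list \<times> int \<Rightarrow> pa" where
  "ineq_formula ab =
     (case ab of (a, b) \<Rightarrow>
       Le (foldr (\<lambda>i u. Add (Scale (a ! i) (Var i)) u) [0..<length a] (Const 0)) (Const b))"

definition dnf_formula :: "dnf \<Rightarrow> pa" where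
  "dnf_formula D = foldr (\<lambda>C p. Disj (foldr (\<lambda>ab q. Conj (ineq_formula ab) q) C TT) p) D FF"

definition dnf_bounds :: "nat \<Rightarrow> nat \<Rightarrow> nat \<Rightarrow> nat \<Rightarrow> nat \<Rightarrow> dnf \<Rightarrow> bool" where
  "dnf_bounds \<tau> \<delta> \<gamma> \<alpha> \<beta> D \<longleftrightarrow>
     length D \<le> \<delta> \<and>
     (\<forall>C\<in>set D. length C \<le> \<gamma> \<and>
       (\<forall>(a, b)\<in>set C. length a = \<tau> \<and> (\<forall>k\<in>set a. \<bar>k\<bar> \<le> int \<alpha>) \<and> \<bar>b\<bar> \<le> int \<beta>))"

definition P0_hat :: "nat \<Rightarrow> nat \<Rightarrow> nat \<Rightarrow> nat \<Rightarrow> nat \<Rightarrow> pa set" where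
  "P0_hat \<tau> \<delta> \<gamma> \<alpha> \<beta> = dnf_formula ` {D. dnf_bounds \<tau> \<delta> \<gamma> \<alpha> \<beta> D}"

definition P0 :: "nat \<Rightarrow> nat \<Rightarrow> nat \<Rightarrow> nat \<Rightarrow> nat \<Rightarrow> pa set" where
  "P0 \<tau> \<delta> \<gamma> \<alpha> \<beta> =
     {\<Psi>. free_vars \<Psi> \<subseteq> {..<\<tau>} \<and> (\<exists>\<phi>\<in>P0_hat \<tau> \<delta> \<gamma> \<alpha> \<beta>. pa_equiv \<Psi> \<phi>)}"


section \<open>Minimum Move\<close>

definition admissible_move :: "nat \<Rightarrow> (nat \<Rightarrow> int) \<Rightarrow> pa \<Rightarrow> (nat \<Rightarrow> nat \<Rightarrow> int) \<Rightarrow> bool" where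
  "admissible_move \<tau> s \<Psi> m \<longleftrightarrow>
     holds \<Psi> (\<lambda>i. s i + change \<tau> m i) \<and> feasible \<tau> s (change \<tau> m)"

definition minimum_move ::
  "nat \<Rightarrow> ((nat \<Rightarrow> nat \<Rightarrow> int) \<Rightarrow> int) \<Rightarrow> (nat \<Rightarrow> int) \<Rightarrow> pa \<Rightarrow> (nat \<Rightarrow> nat \<Rightarrow> int) \<Rightarrow> bool" where
  "minimum_move \<tau> f s \<Psi> m \<longleftrightarrow>
     admissible_move \<tau> s \<Psi> m \<and> (\<forall>m'. admissible_move \<tau> s \<Psi> m' \<longrightarrow> f m \<le> f m')"


section \<open>Algorithms and running time\<close>

text \<open>
  A uniform-cost random access machine over the integers, as a while language in which every
  variable is an array indexed by the integers (a scalar is the cell with index 0). Each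
  operation costs one step. Addition and subtraction are the only arithmetic
  operations, so within \<open>t\<close> steps the bit length of the numbers grows by at most \<open>O(t)\<close>; unit-cost
  multiplication, which would make the uniform cost measure unrealistic, is excluded.
\<close>

datatype aexp = N int | V nat aexp | Plus aexp aexp | Minus aexp aexp

datatype bexp = Less aexp aexp | Not bexp | And bexp bexp

datatype com =
    SKIP
  | Assign nat aexp aexp
  | Seq com com
  | If bexp com com
  | While bexp com

type_synonym state = "nat \<Rightarrow> int \<Rightarrow> int"

fun aval :: "aexp \<Rightarrow> state \<Rightarrow> int" where
  "aval (N k) \<sigma> = k"
| "aval (V x e) \<sigma> = \<sigma> x (aval e \<sigma>)"
| "aval (Plus e1 e2) \<sigma> = aval e1 \<sigma> + aval e2 \<sigma>"
| "aval (Minus e1 e2) \<sigma> = aval e1 \<sigma> - aval e2 \<sigma>"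

fun acost :: "aexp \<Rightarrow> nat" where
  "acost (N k) = 1"
| "acost (V x e) = 1 + acost e"
| "acost (Plus e1 e2) = 1 + acost e1 + acost e2"
| "acost (Minus e1 e2) = 1 + acost e1 + acost e2"

fun bval :: "bexp \<Rightarrow> state \<Rightarrow> bool" where
  "bval (Less e1 e2) \<sigma> \<longleftrightarrow> aval e1 \<sigma> < aval e2 \<sigma>"
| "bval (Not b) \<sigma> \<longleftrightarrow> \<not> bval b \<sigma>"
| "bval (And b1 b2) \<sigma> \<longleftrightarrow> bval b1 \<sigma> \<and> bval b2 \<sigma>"

fun bcost :: "bexp \<Rightarrow> nat" where
  "bcost (Less e1 e2) = 1 + acost e1 + acost e2"
| "bcost (Not b) = 1 + bcost b"
| "bcost (And b1 b2) = 1 + bcost b1 + bcost b2"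

text \<open>\<open>Assign x e1 e2\<close> is the assignment \<open>x[e1] := e2\<close>; \<open>exec p \<sigma> t \<sigma>'\<close> says that \<open>p\<close>, started in
  \<open>\<sigma>\<close>, halts after exactly \<open>t\<close> steps in \<open>\<sigma>'\<close>.\<close>

inductive exec :: "com \<Rightarrow> state \<Rightarrow> nat \<Rightarrow> state \<Rightarrow> bool" where
  Skip: "exec SKIP \<sigma> 1 \<sigma>"
| Assign: "exec (Assign x e1 e2) \<sigma> (1 + acost e1 + acost e2)
             (\<sigma>(x := (\<sigma> x)(aval e1 \<sigma> := aval e2 \<sigma>)))"
| Seq: "exec p \<sigma> t \<sigma>' \<Longrightarrow> exec q \<sigma>' u \<sigma>'' \<Longrightarrow> exec (Seq p q) \<sigma> (t + u) \<sigma>''"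
| IfTrue: "bval b \<sigma> \<Longrightarrow> exec p \<sigma> t \<sigma>' \<Longrightarrow> exec (If b p q) \<sigma> (1 + bcost b + t) \<sigma>'"
| IfFalse: "\<not> bval b \<sigma> \<Longrightarrow> exec q \<sigma> t \<sigma>' \<Longrightarrow> exec (If b p q) \<sigma> (1 + bcost b + t) \<sigma>'"
| WhileFalse: "\<not> bval b \<sigma> \<Longrightarrow> exec (While b p) \<sigma> (1 + bcost b) \<sigma>"
| WhileTrue: "bval b \<sigma> \<Longrightarrow> exec p \<sigma> t \<sigma>' \<Longrightarrow> exec (While b p) \<sigma>' u \<sigma>''
               \<Longrightarrow> exec (While b p) \<sigma> (1 + bcost b + t + u) \<sigma>''"

inductive_cases exec_SkipE: "exec SKIP \<sigma> t \<sigma>'"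
inductive_cases exec_AssignE: "exec (Assign x e1 e2) \<sigma> t \<sigma>'"
inductive_cases exec_SeqE: "exec (Seq p q) \<sigma> t \<sigma>'"
inductive_cases exec_IfE: "exec (If b p q) \<sigma> t \<sigma>'"
inductive_cases exec_WhileE: "exec (While b p) \<sigma> t \<sigma>'"

lemma exec_deterministic:
  "exec p \<sigma> t \<sigma>' \<Longrightarrow> exec p \<sigma> u \<sigma>'' \<Longrightarrow> u = t \<and> \<sigma>'' = \<sigma>'"
proof (induction arbitrary: u \<sigma>'' rule: exec.induct)
  case (Skip \<sigma>)
  from Skip.prems show ?case by (rule exec_SkipE) simp
next
  case (Assign x e1 e2 \<sigma>)
  from Assign.prems show ?case by (rule exec_AssignE) simp
next
  case (Seq p \<sigma> t \<sigma>1 q v \<sigma>2)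
  from Seq.prems show ?case by (rule exec_SeqE) (auto dest!: Seq.IH)
next
  case (IfTrue b \<sigma> p t \<sigma>1 q)
  from IfTrue.prems show ?case by (rule exec_IfE) (auto simp: IfTrue.hyps dest!: IfTrue.IH)
next
  case (IfFalse b \<sigma> q t \<sigma>1 p)
  from IfFalse.prems show ?case by (rule exec_IfE) (auto simp: IfFalse.hyps dest!: IfFalse.IH)
next
  case (WhileFalse b \<sigma> p)
  from WhileFalse.prems show ?case by (rule exec_WhileE) (auto simp: WhileFalse.hyps)
next
  case (WhileTrue b \<sigma> p t \<sigma>1 v \<sigma>2)
  from WhileTrue.prems show ?case by (rule exec_WhileE) (auto simp: WhileTrue.hyps dest!: WhileTrue.IH)
qed

text \<open>
  Input is read from array 0, all other cells being 0 initially; output is left in array 1.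
  Inputs and outputs below are self-delimiting, so cells of array 1 beyond the output are ignored.
\<close>

definition input_state :: "int list \<Rightarrow> state" where
  "input_state xs = (\<lambda>x i. if x = 0 \<and> 0 \<le> i \<and> i < int (length xs) then xs ! nat i else 0)"

definition computes :: "com \<Rightarrow> int list \<Rightarrow> int list \<Rightarrow> nat \<Rightarrow> bool" where
  "computes p xs ys t \<longleftrightarrow>
     (\<exists>\<sigma>. exec p (input_state xs) t \<sigma> \<and> (\<forall>i<length ys. \<sigma> 1 (int i) = ys ! i))"

definition computable :: "(nat \<Rightarrow> nat \<Rightarrow> nat) \<Rightarrow> bool" where
  "computable g \<longleftrightarrow> (\<exists>p. \<forall>x y. \<exists>t. computes p [int x, int y] [int (g x y)] t)"

definition row_major :: "nat \<Rightarrow> (nat \<Rightarrow> nat \<Rightarrow> int) \<Rightarrow> int list" where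
  "row_major \<tau> m = concat (map (\<lambda>i. map (m i) [0..<\<tau>]) [0..<\<tau>])"

definition encode_dnf :: "dnf \<Rightarrow> int list" where
  "encode_dnf D =
     int (length D) #
     concat (map (\<lambda>C. int (length C) # concat (map (\<lambda>(a, b). a @ [b]) C)) D)"

definition encode_instance ::
  "nat \<Rightarrow> (nat \<Rightarrow> int) \<Rightarrow> (nat \<Rightarrow> nat \<Rightarrow> int) \<Rightarrow> dnf \<Rightarrow> int list" where
  "encode_instance \<tau> s c D = int \<tau> # map s [0..<\<tau>] @ row_major \<tau> c @ encode_dnf D"

text \<open>
  A correct answer is 1 followed by the entries of some minimizing move, or 0 if no move attains
  the minimum (no admissible move exists, or the objective is unbounded below).
\<close>

definition correct_answer ::
  "nat \<Rightarrow> ((nat \<Rightarrow> nat \<Rightarrow> int) \<Rightarrow> int) \<Rightarrow> (nat \<Rightarrow> int) \<Rightarrow> pa \<Rightarrow> int list \<Rightarrow> bool" where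
  "correct_answer \<tau> f s \<Psi> ys \<longleftrightarrow>
     (if \<exists>m. minimum_move \<tau> f s \<Psi> m
      then \<exists>m. minimum_move \<tau> f s \<Psi> m \<and> ys = 1 # row_major \<tau> m
      else ys = [0])"

end

theory Submission
  imports Defs "HOL-Library.FuncSet"
begin

text \<open>
  A minimum can only exist if the cost vector vanishes on circulations, that is, if
  \<open>c\<^sub>i\<^sub>j = p\<^sub>j - p\<^sub>i\<close> for \<open>p\<^sub>j = c\<^sub>0\<^sub>j\<close>. Then the cost of a move depends only on the society \<open>x\<close> it leads to,
  and each disjunct asks for the minimum of \<open>p \<cdot> x\<close> over \<open>x \<ge> 0\<close> with \<open>\<Sum>x = S\<close> and \<open>A x \<le> b\<close>. Among
  the types with the same column of \<open>A\<close> only the cheapest one is needed, so the number of relevant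
  variables is bounded in terms of \<open>\<gamma>\<close> and \<open>\<alpha>\<close>. The binary digits of \<open>x\<close> are chosen from the most
  significant one downwards; after the digits of weight \<open>2\<^sup>i\<close>, the residual \<open>b - A x\<close> only matters if its
  entries are \<open>O(2\<^sup>i)\<close>: smaller entries can no longer be repaired, larger ones no longer be violated and
  may be cut off. As the entries are multiples of \<open>2\<^sup>i\<close> up to a fixed shift, the number of different
  residuals is bounded in terms of \<open>\<gamma>\<close> and \<open>\<alpha>\<close> as well, and for each of them it suffices to keep one
  cheapest partial solution. Only the number \<open>O(log S)\<close> of digits depends on \<open>s\<close>, and neither \<open>b\<close> nor \<open>c\<close>
  is ever decomposed into digits, so that \<open>\<beta>\<close> and the size of \<open>c\<close> do not enter the running time.
\<close>

section \<open>Weakest preconditions with running time\<close>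

text \<open>The time may contain \<open>log s\<close> only linearly and must not grow with \<beta>
  or with the size of \<open>c\<close>, on a machine that cannot multiply or divide. The unknown
  \<open>x\<close> is therefore built up from items \<open>2 ^ i * column j\<close>, obtained by
  repeated doubling, while the entries of \<open>b\<close> and \<open>c\<close> only take part in
  additions, subtractions and comparisons. The cutoff at weight \<open>2 ^ i\<close> is
  \<open>2 ^ i * 2 * norm\<close>, where \<open>norm\<close> sums the l1 norms of the needed
  columns, each extended by the two rows for the total: all digits of weight at most
  \<open>2 ^ i\<close> together change a residual by at most
  \<open>(2 ^ (i + 1) - 1) * norm\<close>. The cutoff is itself a multiple of \<open>2 ^ i\<close>,
  so a residual that was cut lies in the class 0 and any other one in the class of its right-hand
  side. This leaves at most \<open>2 * (4 * norm + 1)\<close> values per row, however large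
  \<open>b\<close> is. An optimal society is turned back into a move by routing every exchange
  through type 0, possibly with negative entries. The factor depending on \<gamma> and \<alpha> is
  finally rounded up to a double power of two, which two doubling loops can compute.\<close>

definition wp :: "com \<Rightarrow> (nat \<Rightarrow> state \<Rightarrow> bool) \<Rightarrow> state \<Rightarrow> bool" where
  "wp c Q \<sigma> \<longleftrightarrow> (\<exists>t \<sigma>'. exec c \<sigma> t \<sigma>' \<and> Q t \<sigma>')"

fun mods :: "com \<Rightarrow> nat set" where
  "mods SKIP = {}"
| "mods (Assign x e1 e2) = {x}"
| "mods (Seq p q) = mods p \<union> mods q"
| "mods (If b p q) = mods p \<union> mods q"
| "mods (While b p) = mods p"

lemma exec_mods: "exec c \<sigma> t \<sigma>' \<Longrightarrow> x \<notin> mods c \<Longrightarrow> \<sigma>' x = \<sigma> x"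
  by (induction rule: exec.induct) auto

lemma wp_mono: "wp c Q \<sigma> \<Longrightarrow> (\<And>t \<sigma>'. Q t \<sigma>' \<Longrightarrow> Q' t \<sigma>') \<Longrightarrow> wp c Q' \<sigma>"
  unfolding wp_def by blast

lemma wp_frame:
  assumes "wp c Q \<sigma>" "\<And>t \<sigma>'. Q t \<sigma>' \<Longrightarrow> \<forall>x. x \<notin> mods c \<longrightarrow> \<sigma>' x = \<sigma> x \<Longrightarrow> Q' t \<sigma>'"
  shows "wp c Q' \<sigma>"
  using assms exec_mods unfolding wp_def by blast

text \<open>Since \<open>exec\<close> is deterministic, the existential in \<open>wp\<close> says as
  much as a statement about all runs. This makes the rules equivalences, so that they can serve as
  rewrite rules.\<close>

lemma wp_SKIP [simp]: "wp SKIP Q \<sigma> \<longleftrightarrow> Q 1 \<sigma>"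
  unfolding wp_def using exec.Skip exec_deterministic by blast

lemma wp_Assign [simp]:
  "wp (Assign x e1 e2) Q \<sigma> \<longleftrightarrow>
     Q (1 + acost e1 + acost e2) (\<sigma>(x := (\<sigma> x)(aval e1 \<sigma> := aval e2 \<sigma>)))"
  unfolding wp_def using exec.Assign exec_deterministic by blast

lemma wp_Seq [simp]: "wp (Seq p q) Q \<sigma> \<longleftrightarrow> wp p (\<lambda>t. wp q (\<lambda>u. Q (t + u))) \<sigma>"
  unfolding wp_def by (auto elim!: exec_SeqE intro: exec.Seq)

lemma wp_If [simp]:
  "wp (If b p q) Q \<sigma> \<longleftrightarrow>
     (if bval b \<sigma> then wp p (\<lambda>t. Q (1 + bcost b + t)) \<sigma> else wp q (\<lambda>t. Q (1 + bcost b + t)) \<sigma>)"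
  unfolding wp_def 
  by (cases "bval b \<sigma>") (auto elim!: exec_IfE, (metis exec.IfTrue exec.IfFalse plus_1_eq_Suc add_Suc)+)

text \<open>The number \<open>n\<close> of rounds is fixed in advance and the invariant is indexed
  by the completed rounds, so termination and the time bound need no separate variant. The frame
  condition is supplied to each premise, which spares the invariants from repeating it.\<close>

lemma wp_While:
  assumes "I 0 \<sigma>"
    and step: "\<And>k \<rho>. k < n \<Longrightarrow> \<forall>x. x \<notin> mods c \<longrightarrow> \<rho> x = \<sigma> x \<Longrightarrow> I k \<rho> \<Longrightarrow>
                 bval b \<rho> \<and> wp c (\<lambda>t \<rho>'. t \<le> T \<and> I (Suc k) \<rho>') \<rho>"
    and stop: "\<And>\<rho>. \<forall>x. x \<notin> mods c \<longrightarrow> \<rho> x = \<sigma> x \<Longrightarrow> I n \<rho> \<Longrightarrow> \<not> bval b \<rho>"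
    and fin: "\<And>t \<rho>. t \<le> n * (T + 1 + bcost b) + 1 + bcost b \<Longrightarrow>
                \<forall>x. x \<notin> mods c \<longrightarrow> \<rho> x = \<sigma> x \<Longrightarrow> I n \<rho> \<Longrightarrow> Q t \<rho>"
  shows "wp (While b c) Q \<sigma>"
proof -
  have loop: "\<exists>t \<rho>'. exec (While b c) \<rho> t \<rho>' \<and> t \<le> m * (T + 1 + bcost b) + 1 + bcost b \<and> I n \<rho>'"
    if "m \<le> n" "\<forall>x. x \<notin> mods c \<longrightarrow> \<rho> x = \<sigma> x" "I (n - m) \<rho>" for m \<rho>
    using that
  proof (induction m arbitrary: \<rho>)
    case 0
    then show ?case
      using exec.WhileFalse[of b \<rho> c] stop[of \<rho>] by auto
  next
    case (Suc m)
    have k: "n - Suc m < n" "Suc (n - Suc m) = n - m"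
      using Suc.prems by auto
    from step[OF k(1) Suc.prems(2,3)] obtain t \<rho>1 where
      b: "bval b \<rho>" and ex: "exec c \<rho> t \<rho>1" and t: "t \<le> T" and I: "I (n - m) \<rho>1"
      by (auto simp: wp_def k)
    have "\<forall>x. x \<notin> mods c \<longrightarrow> \<rho>1 x = \<sigma> x"
      using exec_mods[OF ex] Suc.prems(2) by auto
    from Suc.IH[OF _ this I] Suc.prems(1) obtain u \<rho>' where
      "exec (While b c) \<rho>1 u \<rho>'" "u \<le> m * (T + 1 + bcost b) + 1 + bcost b" "I n \<rho>'"
      by auto
    with exec.WhileTrue[OF b ex this(1)] t show ?case
      by (intro exI[of _ "1 + bcost b + t + u"] exI[of _ \<rho>']) auto
  qed
  from loop[of n \<sigma>] assms(1) obtain t \<rho> where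
    ex: "exec (While b c) \<sigma> t \<rho>" and t: "t \<le> n * (T + 1 + bcost b) + 1 + bcost b" and "I n \<rho>"
    by auto
  moreover have "\<forall>x. x \<notin> mods c \<longrightarrow> \<rho> x = \<sigma> x"
    using exec_mods[OF ex] by auto
  ultimately show ?thesis
    unfolding wp_def using fin by blast
qed

section \<open>Notation and counting loops\<close>

abbreviation cell :: "nat \<Rightarrow> aexp" where "cell x \<equiv> V x (N 0)"
abbreviation set_cell :: "nat \<Rightarrow> aexp \<Rightarrow> com" (infix "::=" 61) where "x ::= e \<equiv> Assign x (N 0) e"
abbreviation seq_com :: "com \<Rightarrow> com \<Rightarrow> com" (infixr ";;" 60) where "p ;; q \<equiv> Seq p q"
abbreviation Eq :: "aexp \<Rightarrow> aexp \<Rightarrow> bexp" where "Eq e f \<equiv> And (Not (Less e f)) (Not (Less f e))"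
abbreviation Or :: "bexp \<Rightarrow> bexp \<Rightarrow> bexp" where "Or p q \<equiv> Not (And (Not p) (Not q))"
abbreviation inc :: "nat \<Rightarrow> aexp \<Rightarrow> com" where "inc x e \<equiv> x ::= Plus (cell x) e"

definition For :: "nat \<Rightarrow> nat \<Rightarrow> com \<Rightarrow> com" where
  "For i l c = (i ::= N 0 ;; While (Less (cell i) (cell l)) (c ;; inc i (N 1)))"

lemma mods_For [simp]: "mods (For i l c) = insert i (mods c)"
  by (auto simp: For_def)

text \<open>Each round adds 6 steps for the increment and 6 for the test to the body; the final 9
  are 3 for initialising the counter and 6 for the failing test.\<close>

lemma wp_For:
  assumes l: "\<sigma> l 0 = int n" "l \<noteq> i" "l \<notin> mods c" "i \<notin> mods c"
    and init: "I 0 (\<sigma>(i := (\<sigma> i)(0 := 0)))"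
    and step: "\<And>k \<rho>. k < n \<Longrightarrow> \<rho> i 0 = int k \<Longrightarrow> \<forall>x. x \<notin> insert i (mods c) \<longrightarrow> \<rho> x = \<sigma> x \<Longrightarrow>
                 I k \<rho> \<Longrightarrow> wp c (\<lambda>t \<rho>'. t \<le> T \<and> I (Suc k) (\<rho>'(i := (\<rho>' i)(0 := 1 + int k)))) \<rho>"
    and fin: "\<And>t \<rho>. t \<le> n * (T + 12) + 9 \<Longrightarrow>
                \<forall>x. x \<notin> insert i (mods c) \<longrightarrow> \<rho> x = \<sigma> x \<Longrightarrow> I n \<rho> \<Longrightarrow> Q t \<rho>"
  shows "wp (For i l c) Q \<sigma>"
  unfolding For_def wp_Seq[of "Assign _ _ _"] wp_Assign
proof (rule wp_While[where I = "\<lambda>k \<rho>. \<rho> i 0 = int k \<and> I k \<rho>" and n = n and T = "T + 6"], goal_cases)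
  case 1
  then show ?case using init by simp
next
  case (2 k \<rho>)
  have fr: "\<forall>x. x \<notin> insert i (mods c) \<longrightarrow> \<rho> x = \<sigma> x"
    using 2(2) by auto
  have lr: "\<rho> l 0 = int n"
    using fr l by auto
  have "wp c (\<lambda>t \<rho>'. t \<le> T \<and> I (Suc k) (\<rho>'(i := (\<rho>' i)(0 := 1 + int k)))) \<rho>"
    using 2 fr by (intro step) auto
  then have "wp c (\<lambda>t. wp (inc i (N 1)) (\<lambda>u \<rho>'. t + u \<le> T + 6 \<and> \<rho>' i 0 = int (Suc k) \<and> I (Suc k) \<rho>')) \<rho>"
    by (rule wp_frame) (use 2 l in \<open>auto simp: add.commute\<close>)
  then show ?case
    using 2 lr by simp
next
  case (3 \<rho>)
  have "\<rho> l 0 = int n"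
    using 3(1) l by auto
  with 3 show ?case by simp
next
  case (4 t \<rho>)
  have "\<forall>x. x \<notin> insert i (mods c) \<longrightarrow> \<rho> x = \<sigma> x"
    using 4(2) by auto
  with 4 show ?case
    by (intro fin) (auto simp: algebra_simps)
qed

section \<open>The program\<close>

text \<open>
  With \<open>G\<close> rows in the current disjunct, partial solutions are vectors of length \<open>G + \<tau> + 4\<close>, stored one
  after the other: the residuals of the \<open>G\<close> rows and of \<open>\<Sum>x \<le> S\<close> and \<open>- \<Sum>x \<le> - S\<close> (these \<open>G + 2\<close>
  entries are the key), the cost, the \<open>\<tau>\<close> entries of \<open>x\<close>, and one unused entry. The vector \<open>i\<tau> + j\<close> in
  \<open>ITEM\<close> is what setting the digit \<open>i\<close> of \<open>x\<^sub>j\<close> adds to a partial solution; its last entry holds the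
  cutoff for the residuals at this level instead.
\<close>

abbreviation (input) "IN \<equiv> 0::nat"
abbreviation (input) "OUT \<equiv> 1::nat"
abbreviation (input) "TAU \<equiv> 2::nat"
abbreviation (input) "TOTAL \<equiv> 3::nat"
abbreviation (input) "POT \<equiv> 4::nat"
abbreviation (input) "PTR \<equiv> 5::nat"
abbreviation (input) "LEV \<equiv> 6::nat"
abbreviation (input) "PW \<equiv> 7::nat"
abbreviation (input) "ND \<equiv> 8::nat"
abbreviation (input) "FOUND \<equiv> 9::nat"
abbreviation (input) "BEST \<equiv> 10::nat"
abbreviation (input) "SOL \<equiv> 11::nat"
abbreviation (input) "ROWS \<equiv> 12::nat"
abbreviation (input) "KEYS \<equiv> 13::nat"
abbreviation (input) "WIDTH \<equiv> 14::nat"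
abbreviation (input) "ITEM \<equiv> 15::nat"
abbreviation (input) "NORM \<equiv> 16::nat"
abbreviation (input) "IB \<equiv> 17::nat"
abbreviation (input) "KEPT \<equiv> 18::nat"
abbreviation (input) "EQ \<equiv> 19::nat"
abbreviation (input) "RP \<equiv> 20::nat"
abbreviation (input) "SRC \<equiv> 21::nat"
abbreviation (input) "NITEMS \<equiv> 22::nat"
abbreviation (input) "BLOCK \<equiv> 23::nat"
abbreviation (input) "CUR \<equiv> 24::nat"
abbreviation (input) "CCNT \<equiv> 25::nat"
abbreviation (input) "NEW \<equiv> 26::nat"
abbreviation (input) "NCNT \<equiv> 27::nat"
abbreviation (input) "NEND \<equiv> 28::nat"
abbreviation (input) "VEC \<equiv> 29::nat"
abbreviation (input) "CAP \<equiv> 30::nat"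
abbreviation (input) "CB \<equiv> 31::nat"
abbreviation (input) "SB \<equiv> 32::nat"
abbreviation (input) "POS \<equiv> 33::nat"
abbreviation (input) "VALID \<equiv> 34::nat"
abbreviation (input) "WR \<equiv> 35::nat"
abbreviation (input) "vI \<equiv> 36::nat"
abbreviation (input) "vJ \<equiv> 37::nat"
abbreviation (input) "vK \<equiv> 38::nat"
abbreviation (input) "vL \<equiv> 39::nat"
abbreviation (input) "vQ \<equiv> 40::nat"
abbreviation (input) "vR \<equiv> 41::nat"
abbreviation (input) "vA \<equiv> 42::nat"
abbreviation (input) "vD \<equiv> 43::nat"

definition Normalise :: com where
  "Normalise =
     (VALID ::= N 1 ;;
      For vR KEYS
        (If (Less (Plus (V VEC (cell vR)) (cell CAP)) (N 0)) (VALID ::= N 0)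
        (If (Less (cell CAP) (V VEC (cell vR))) (Assign VEC (cell vR) (cell CAP)) SKIP)))"

definition Find :: com where
  "Find =
     (POS ::= cell NEND ;; SB ::= N 0 ;;
      For vQ NCNT
        (EQ ::= N 1 ;;
         For vR KEYS
           (If (Eq (V NEW (Plus (cell SB) (cell vR))) (V VEC (cell vR))) SKIP (EQ ::= N 0)) ;;
         If (Eq (cell EQ) (N 1)) (POS ::= cell SB) SKIP ;;
         inc SB (cell WIDTH)))"

definition Write :: com where
  "Write =
     (If (Eq (cell POS) (cell NEND))
        (WR ::= N 1 ;; inc NCNT (N 1) ;; inc NEND (cell WIDTH))
        (If (Less (V VEC (cell KEYS)) (V NEW (Plus (cell POS) (cell KEYS)))) (WR ::= N 1) (WR ::= N 0)) ;;
      If (Eq (cell WR) (N 1))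
        (For vR WIDTH (Assign NEW (Plus (cell POS) (cell vR)) (V VEC (cell vR)))) SKIP)"

definition Insert :: com where
  "Insert = (Normalise ;; If (Eq (cell VALID) (N 1)) (Find ;; Write) SKIP)"

definition Step :: com where
  "Step =
     (CAP ::= V ITEM (Plus (cell SRC) (Minus (cell WIDTH) (N 1))) ;;
      NCNT ::= N 0 ;; NEND ::= N 0 ;; CB ::= N 0 ;;
      For vK CCNT
        (For vR WIDTH (Assign VEC (cell vR) (V CUR (Plus (cell CB) (cell vR)))) ;;
         Insert ;;
         For vR WIDTH (Assign VEC (cell vR)
           (Plus (V CUR (Plus (cell CB) (cell vR))) (V ITEM (Plus (cell SRC) (cell vR))))) ;;
         Insert ;;
         inc CB (cell WIDTH)) ;;
      For vA NEND (Assign CUR (cell vA) (V NEW (cell vA))) ;;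
      CCNT ::= cell NCNT)"

text \<open>\<open>Double_Items\<close> leaves \<open>SRC\<close> just behind the last item.
  Counting down from there visits the larger weights first, as the cutoff argument requires.\<close>

definition Process :: com where
  "Process = For vL NITEMS (SRC ::= Minus (cell SRC) (cell WIDTH) ;; Step)"

definition Start :: com where
  "Start =
     (For vR WIDTH (Assign CUR (cell vR) (N 0)) ;;
      RP ::= cell PTR ;;
      For vK ROWS
        (Assign CUR (cell vK) (V IN (Plus (cell RP) (cell TAU))) ;;
         inc RP (Plus (cell TAU) (N 1))) ;;
      Assign CUR (cell ROWS) (cell TOTAL) ;;
      Assign CUR (Plus (cell ROWS) (N 1)) (Minus (N 0) (cell TOTAL)) ;;
      CCNT ::= N 1)"

definition Extract :: com where
  "Extract =
     (CB ::= N 0 ;;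
      For vK CCNT
        (VALID ::= N 1 ;;
         For vR KEYS
           (If (Less (V CUR (Plus (cell CB) (cell vR))) (N 0)) (VALID ::= N 0) SKIP) ;;
         If (And (Eq (cell VALID) (N 1))
               (Or (Eq (cell FOUND) (N 0)) (Less (V CUR (Plus (cell CB) (cell KEYS))) (cell BEST))))
           (FOUND ::= N 1 ;;
            BEST ::= V CUR (Plus (cell CB) (cell KEYS)) ;;
            For vJ TAU
              (Assign SOL (cell vJ)
                (V CUR (Plus (cell CB) (Plus (cell KEYS) (Plus (N 1) (cell vJ)))))))
           SKIP ;;
         inc CB (cell WIDTH)))"

text \<open>The cost matrix starts at cell \<open>1 + \<tau>\<close> and its first row serves as the
  price vector, hence the addresses \<open>1 + \<tau> + k\<close>.\<close>

definition Check_Kept :: com where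
  "Check_Kept =
     (KEPT ::= N 1 ;;
      For vK TAU
        (EQ ::= N 1 ;; RP ::= cell PTR ;;
         For vR ROWS
           (If (Eq (V IN (Plus (cell RP) (cell vJ))) (V IN (Plus (cell RP) (cell vK)))) SKIP (EQ ::= N 0) ;;
            inc RP (Plus (cell TAU) (N 1))) ;;
         If (And (Eq (cell EQ) (N 1))
               (Or (Less (V IN (Plus (N 1) (Plus (cell TAU) (cell vK))))
                         (V IN (Plus (N 1) (Plus (cell TAU) (cell vJ)))))
                   (And (Eq (V IN (Plus (N 1) (Plus (cell TAU) (cell vK))))
                            (V IN (Plus (N 1) (Plus (cell TAU) (cell vJ)))))
                        (Less (cell vK) (cell vJ)))))
           (KEPT ::= N 0) SKIP))"

definition Write_Item :: com where
  "Write_Item =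
     (For vR WIDTH (Assign ITEM (Plus (cell IB) (cell vR)) (N 0)) ;;
      If (Eq (cell KEPT) (N 1))
        (RP ::= cell PTR ;;
         For vR ROWS
           (Assign ITEM (Plus (cell IB) (cell vR)) (Minus (N 0) (V IN (Plus (cell RP) (cell vJ)))) ;;
            If (Less (V IN (Plus (cell RP) (cell vJ))) (N 0))
              (NORM ::= Minus (cell NORM) (V IN (Plus (cell RP) (cell vJ))))
              (inc NORM (V IN (Plus (cell RP) (cell vJ)))) ;;
            inc RP (Plus (cell TAU) (N 1))) ;;
         Assign ITEM (Plus (cell IB) (cell ROWS)) (N (-1)) ;;
         Assign ITEM (Plus (cell IB) (Plus (cell ROWS) (N 1))) (N 1) ;;
         inc NORM (N 2) ;;
         Assign ITEM (Plus (cell IB) (cell KEYS)) (V IN (Plus (N 1) (Plus (cell TAU) (cell vJ)))) ;;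
         Assign ITEM (Plus (cell IB) (Plus (cell KEYS) (Plus (N 1) (cell vJ)))) (N 1))
        SKIP)"

definition Base_Items :: com where
  "Base_Items =
     (NORM ::= N 0 ;; IB ::= N 0 ;;
      For vJ TAU (Check_Kept ;; Write_Item ;; inc IB (cell WIDTH)) ;;
      BLOCK ::= cell IB ;;
      IB ::= N 0 ;;
      For vJ TAU
        (inc IB (cell WIDTH) ;;
         Assign ITEM (Minus (cell IB) (N 1)) (Plus (cell NORM) (cell NORM))))"

text \<open>Every block of \<tau> items is the double of the preceding one. The cutoff in the last
  entry of an item is doubled along with the rest and so always fits the weight.\<close>

definition Double_Items :: com where
  "Double_Items =
     (SRC ::= N 0 ;; NITEMS ::= N 0 ;;
      For vI LEV
        (For vA BLOCK
           (Assign ITEM (Plus (cell BLOCK) (Plus (cell SRC) (cell vA)))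
             (Plus (V ITEM (Plus (cell SRC) (cell vA))) (V ITEM (Plus (cell SRC) (cell vA))))) ;;
         inc SRC (cell BLOCK) ;;
         inc NITEMS (cell TAU)))"

definition Disjunct :: com where
  "Disjunct =
     (ROWS ::= V IN (cell PTR) ;;
      inc PTR (N 1) ;;
      KEYS ::= Plus (cell ROWS) (N 2) ;;
      WIDTH ::= Plus (cell KEYS) (Plus (cell TAU) (N 2)) ;;
      Base_Items ;;
      Double_Items ;;
      Start ;;
      Process ;;
      Extract ;;
      For vK ROWS (inc PTR (Plus (cell TAU) (N 1))))"

definition Check_Potential :: com where
  "Check_Potential =
     (PTR ::= Plus (N 1) (cell TAU) ;;
      POT ::= N 1 ;;
      For vI TAU
        (For vJ TAU
           (If (Eq (V IN (Plus (cell PTR) (cell vJ)))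
                   (Minus (V IN (Plus (N 1) (Plus (cell TAU) (cell vJ))))
                          (V IN (Plus (N 1) (Plus (cell TAU) (cell vI))))))
              SKIP (POT ::= N 0)) ;;
         inc PTR (cell TAU)))"

definition Levels :: com where
  "Levels =
     (TOTAL ::= N 0 ;;
      For vI TAU (inc TOTAL (V IN (Plus (N 1) (cell vI)))) ;;
      PW ::= N 1 ;; LEV ::= N 0 ;;
      While (Not (Less (cell TOTAL) (cell PW))) (inc PW (cell PW) ;; inc LEV (N 1)))"

text \<open>The differences \<open>x j - s j\<close> form row 0 of the move. The other rows are 0
  because array \<open>OUT\<close> is still in its initial state, and the entry at (0, 0) is reset
  at the end.\<close>

definition Output :: com where
  "Output =
     (If (Eq (cell FOUND) (N 1))
        (OUT ::= N 1 ;;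
         For vJ TAU
           (Assign OUT (Plus (N 1) (cell vJ)) (Minus (V SOL (cell vJ)) (V IN (Plus (N 1) (cell vJ))))) ;;
         Assign OUT (N 1) (N 0))
        SKIP)"

definition Solver :: com where
  "Solver =
     (TAU ::= cell IN ;; Levels ;; Check_Potential ;;
      If (Eq (cell POT) (N 1))
        (ND ::= V IN (cell PTR) ;; inc PTR (N 1) ;; FOUND ::= N 0 ;;
         For vD ND Disjunct)
        SKIP ;;
      Output)"

section \<open>Inserting a partial solution\<close>

text \<open>The padding with 0, here and in \<open>key\<close>, turns agreement on the relevant
  entries into equality of functions, so stored vectors and their keys can be handled as elements of
  sets.\<close>

definition row :: "state \<Rightarrow> nat \<Rightarrow> nat \<Rightarrow> nat \<Rightarrow> nat \<Rightarrow> int" where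
  "row \<sigma> x w q = (\<lambda>r. if r < w then \<sigma> x (int (q * w + r)) else 0)"

definition key :: "nat \<Rightarrow> (nat \<Rightarrow> int) \<Rightarrow> nat \<Rightarrow> int" where
  "key g v = (\<lambda>r. if r < g then v r else 0)"

definition capped :: "nat \<Rightarrow> int \<Rightarrow> (nat \<Rightarrow> int) \<Rightarrow> nat \<Rightarrow> int" where
  "capped g h v = (\<lambda>r. if r < g then min (v r) h else v r)"

definition valid :: "nat \<Rightarrow> int \<Rightarrow> (nat \<Rightarrow> int) \<Rightarrow> bool" where
  "valid g h v \<longleftrightarrow> (\<forall>r<g. - h \<le> v r)"

lemma mods_Normalise [simp]: "mods Normalise = {VALID, vR, VEC}"
  by (auto simp: Normalise_def)

text \<open>As \<open>0 \<le> h\<close>, an entry below \<open>- h\<close> also lies below the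
  cutoff, so the branch that leaves it untouched agrees with \<open>capped\<close>.\<close>

lemma Normalise_spec:
  assumes [simp]: "\<sigma> KEYS 0 = int g" "\<sigma> CAP 0 = h" and h: "0 \<le> h" and gw: "g \<le> w"
  shows "wp Normalise (\<lambda>t \<rho>. t \<le> 60 * (g + 1) \<and>
      \<rho> VALID 0 = (if valid g h (row \<sigma> VEC w 0) then 1 else 0) \<and>
      row \<rho> VEC w 0 = capped g h (row \<sigma> VEC w 0) \<and>
      (\<forall>x. x \<notin> {VALID, vR, VEC} \<longrightarrow> \<rho> x = \<sigma> x)) \<sigma>"
  unfolding Normalise_def wp_Seq[of "Assign _ _ _"] wp_Assign
  apply (rule wp_For[where n = g and T = 40 and I = "\<lambda>k \<rho>.
     \<rho> VALID 0 = (if \<forall>r<k. - h \<le> \<sigma> VEC (int r) then 1 else 0) \<and>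
     (\<forall>r. \<rho> VEC (int r) = (if r < k then min (\<sigma> VEC (int r)) h else \<sigma> VEC (int r)))"])
        apply (auto simp: less_Suc_eq h) [6]
    defer
  using h gw apply (auto simp: valid_def row_def capped_def fun_eq_iff)
  done


lemma mods_Find [simp]: "mods Find = {POS, SB, vQ, EQ, vR}"
  by (auto simp: Find_def)

lemma key_eq_iff: "key g u = key g v \<longleftrightarrow> (\<forall>r<g. u r = v r)"
  by (auto simp: key_def fun_eq_iff)

lemma Find_spec:
  assumes [simp]: "\<sigma> KEYS 0 = int g" "\<sigma> WIDTH 0 = int w" "\<sigma> NCNT 0 = int n" "\<sigma> NEND 0 = int (n * w)"
    and gw: "g \<le> w"
  shows "wp Find (\<lambda>t \<rho>. t \<le> n * (100 * (g + 1)) + 20 \<and>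
      (\<exists>p\<le>n. \<rho> POS 0 = int (p * w) \<and>
         (if p = n then \<forall>q<n. key g (row \<sigma> NEW w q) \<noteq> key g (row \<sigma> VEC w 0)
          else key g (row \<sigma> NEW w p) = key g (row \<sigma> VEC w 0))) \<and>
      (\<forall>x. x \<notin> {POS, SB, vQ, EQ, vR} \<longrightarrow> \<rho> x = \<sigma> x)) \<sigma>"
proof -
  define same where "same q r \<longleftrightarrow> \<sigma> NEW (int (q * w + r)) = \<sigma> VEC (int r)" for q r
  have same: "key g (row \<sigma> NEW w q) = key g (row \<sigma> VEC w 0) \<longleftrightarrow> (\<forall>r<g. same q r)" for q
    using gw by (auto simp: key_eq_iff row_def same_def)
  show ?thesis
    unfolding Find_def wp_Seq[of "Assign _ _ _"] wp_Assign same
    apply (rule wp_For[where n = n and T = "g * 52 + 60" and I = "\<lambda>k \<rho>.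
       \<rho> SB 0 = int (k * w) \<and>
       ((\<rho> POS 0 = int (n * w) \<and> (\<forall>q<k. \<not> (\<forall>r<g. same q r))) \<or>
        (\<exists>p<n. \<rho> POS 0 = int (p * w) \<and> (\<forall>r<g. same p r)))"])
          apply simp_all [5]
    subgoal for k \<rho>
      unfolding wp_Seq[of "Assign _ _ _"] wp_Seq[of "For _ _ _"] wp_Assign
      apply (rule wp_For[where n = g and T = 40 and I = "\<lambda>j \<rho>. \<rho> EQ 0 = (if \<forall>r<j. same k r then 1 else 0)"])
            apply (simp_all add: less_Suc_eq) [5]
       apply (auto simp: less_Suc_eq same_def algebra_simps) [1]
      apply (auto simp: less_Suc_eq algebra_simps)
      done
    apply (auto simp: algebra_simps)
    done
qed


lemma block_index_cong:
  fixes p q r u w :: nat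
  assumes "r < w" "u < w"
  shows "p * w + r = q * w + u \<longleftrightarrow> p = q \<and> r = u"
proof
  assume e: "p * w + r = q * w + u"
  have "(p * w + r) div w = p" "(q * w + u) div w = q" using assms by auto
  with e show "p = q \<and> r = u" by auto
qed simp

lemma row_cong: "\<rho> x = \<sigma> x \<Longrightarrow> row \<rho> x w q = row \<sigma> x w q"
  by (auto simp: row_def fun_eq_iff)

lemma row_upd [simp]: "x \<noteq> y \<Longrightarrow> row (\<sigma>(y := f)) x w q = row \<sigma> x w q"
  by (rule row_cong) simp

lemma mods_Write [simp]: "mods Write = {WR, NCNT, NEND, vR, NEW}"
  by (auto simp: Write_def)

text \<open>This is what bounds the memory: with pairwise distinct keys there are no more stored
  vectors than possible keys.\<close>

definition distinct_keys :: "state \<Rightarrow> nat \<Rightarrow> nat \<Rightarrow> nat \<Rightarrow> nat \<Rightarrow> bool" where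
  "distinct_keys \<sigma> x g w n \<longleftrightarrow> inj_on (\<lambda>q. key g (row \<sigma> x w q)) {..<n}"

lemma Write_spec:
  assumes [simp]: "\<sigma> KEYS 0 = int g" "\<sigma> WIDTH 0 = int w" "\<sigma> NCNT 0 = int n" "\<sigma> NEND 0 = int (n * w)"
    and gw: "g < w" and p: "p \<le> n" "\<sigma> POS 0 = int (p * w)"
  shows "wp Write (\<lambda>t \<rho>. t \<le> 120 * (w + 1) \<and>
      \<rho> NCNT 0 = int (if p = n then n + 1 else n) \<and> \<rho> NEND 0 = int ((if p = n then n + 1 else n) * w) \<and>
      (\<forall>q. q \<noteq> p \<longrightarrow> row \<rho> NEW w q = row \<sigma> NEW w q) \<and>
      row \<rho> NEW w p =
        (if p = n \<or> row \<sigma> VEC w 0 g < row \<sigma> NEW w p g then row \<sigma> VEC w 0 else row \<sigma> NEW w p) \<and>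
      (\<forall>x. x \<notin> {WR, NCNT, NEND, vR, NEW} \<longrightarrow> \<rho> x = \<sigma> x)) \<sigma>"
proof -
  have w: "0 < w" using gw by simp
  \<comment> \<open>Rows are addressed by multiples of \<open>w\<close>; because \<open>w\<close> is
    positive, comparing addresses compares row numbers.\<close>
  have pn: "int p * int w < int n * int w \<longleftrightarrow> p \<noteq> n" "\<not> int n * int w < int p * int w"
    using p(1) w by (auto simp: mult_less_cancel_right)
  define b where "b \<longleftrightarrow> p = n \<or> row \<sigma> VEC w 0 g < row \<sigma> NEW w p g"
  have b: "b \<longleftrightarrow> p = n \<or> \<sigma> VEC (int g) < \<sigma> NEW (int p * int w + int g)"
    using gw by (simp add: b_def row_def)
  have copy: "wp (For vR WIDTH (Assign NEW (Plus (cell POS) (cell vR)) (V VEC (cell vR))))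
     (\<lambda>t \<rho>'. t \<le> 60 * (w + 1) \<and> row \<rho>' NEW w p = row \<rho> VEC w 0 \<and>
       (\<forall>q. q \<noteq> p \<longrightarrow> row \<rho>' NEW w q = row \<rho> NEW w q) \<and>
       (\<forall>x. x \<notin> {vR, NEW} \<longrightarrow> \<rho>' x = \<rho> x)) \<rho>"
    if [simp]: "\<rho> WIDTH 0 = int w" "\<rho> POS 0 = int (p * w)" for \<rho>
    apply (rule wp_For[where n = w and T = 40 and I = "\<lambda>k \<rho>'.
       (\<forall>r<k. \<rho>' NEW (int (p * w + r)) = \<rho> VEC (int r)) \<and>
       (\<forall>q r. r < w \<longrightarrow> q \<noteq> p \<longrightarrow> \<rho>' NEW (int (q * w + r)) = \<rho> NEW (int (q * w + r)))"])
          apply simp_all [5]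
    subgoal for k \<rho>'
      using block_index_cong[of _ w k _ p]
      by (auto simp: less_Suc_eq simp flip: of_nat_mult of_nat_add)
    apply (auto simp: row_def fun_eq_iff)
    done
  show ?thesis
  proof (cases b)
    case True
    have w1: "wp (If (Eq (cell POS) (cell NEND))
        (WR ::= N 1 ;; inc NCNT (N 1) ;; inc NEND (cell WIDTH))
        (If (Less (V VEC (cell KEYS)) (V NEW (Plus (cell POS) (cell KEYS)))) (WR ::= N 1) (WR ::= N 0)))
      (\<lambda>t \<rho>. t \<le> 40 \<and> \<rho> WR 0 = 1 \<and> 
      \<rho> NCNT 0 = int (if p = n then n + 1 else n) \<and> \<rho> NEND 0 = int ((if p = n then n + 1 else n) * w) \<and>
      (\<forall>x. x \<notin> {WR, NCNT, NEND} \<longrightarrow> \<rho> x = \<sigma> x)) \<sigma>"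
      using True by (auto simp: b p pn algebra_simps)
    show ?thesis
      unfolding Write_def wp_Seq[of "com.If _ _ _"]
    proof (rule wp_mono[OF w1], goal_cases)
      case (1 t \<rho>)
      then have bv: "bval (Eq (cell WR) (N 1)) \<rho>" by simp
      show ?case
        unfolding wp_If if_P[OF bv]
      proof (rule wp_mono[OF copy], goal_cases)
        case (3 u \<rho>')
        have "row \<rho> VEC w 0 = row \<sigma> VEC w 0" "\<And>q. row \<rho> NEW w q = row \<sigma> NEW w q"
          using 1 by (auto intro!: row_cong)
        with 1 3 True show ?case
          by (auto simp: b_def)
      qed (use 1 p in auto)
    qed
  next
    case False
    then have "p \<noteq> n" "\<not> row \<sigma> VEC w 0 g < row \<sigma> NEW w p g"
      by (auto simp: b_def)
    moreover have "\<not> \<sigma> VEC (int g) < \<sigma> NEW (int p * int w + int g)"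
      using False unfolding b by simp
    ultimately show ?thesis
      unfolding Write_def using p w by (simp add: pn)
  qed
qed


lemma mods_Insert [simp]: "mods Insert = {VALID, vR, VEC, POS, SB, vQ, EQ, WR, NCNT, NEND, NEW}"
  by (auto simp: Insert_def)

definition rows :: "state \<Rightarrow> nat \<Rightarrow> nat \<Rightarrow> nat \<Rightarrow> (nat \<Rightarrow> int) set" where
  "rows \<sigma> x w n = row \<sigma> x w ` {..<n}"

text \<open>Dominance: entry \<open>g\<close> is the cost, and equal residuals admit the same
  completions, so the cheaper of two vectors with the same key can replace the other.\<close>

definition covers :: "nat \<Rightarrow> (nat \<Rightarrow> int) set \<Rightarrow> (nat \<Rightarrow> int) \<Rightarrow> bool" where
  "covers g E v \<longleftrightarrow> (\<exists>e\<in>E. key g e = key g v \<and> e g \<le> v g)"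

text \<open>A row is only ever overwritten by a cheaper one with the same key; hence keys stay
  distinct and whatever was dominated remains dominated. The bound \<open>n' \<le> n + 1\<close>
  keeps the time of the following insertion under control.\<close>

lemma Insert_spec:
  assumes st [simp]: "\<sigma> KEYS 0 = int g" "\<sigma> WIDTH 0 = int w" "\<sigma> NCNT 0 = int n" "\<sigma> NEND 0 = int (n * w)"
      "\<sigma> CAP 0 = h"
    and gw: "g < w" and h: "0 \<le> h" and dk: "distinct_keys \<sigma> NEW g w n"
    and v: "v = row \<sigma> VEC w 0"
  shows "wp Insert (\<lambda>t \<rho>. t \<le> 200 * (n + 2) * (w + 1) \<and>
      (\<exists>n'. \<rho> NCNT 0 = int n' \<and> \<rho> NEND 0 = int (n' * w) \<and> distinct_keys \<rho> NEW g w n' \<and>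
        n' \<le> n + 1 \<and> rows \<rho> NEW w n' \<subseteq> rows \<sigma> NEW w n \<union> (if valid g h v then {capped g h v} else {}) \<and>
        (\<forall>u. covers g (rows \<sigma> NEW w n) u \<longrightarrow> covers g (rows \<rho> NEW w n') u) \<and>
        (valid g h v \<longrightarrow> covers g (rows \<rho> NEW w n') (capped g h v))) \<and>
      (\<forall>x. x \<notin> {VALID, vR, VEC, POS, SB, vQ, EQ, WR, NCNT, NEND, NEW} \<longrightarrow> \<rho> x = \<sigma> x)) \<sigma>"
  unfolding Insert_def wp_Seq[of Normalise]
proof (rule wp_mono[OF Normalise_spec[where g = g and h = h and w = w]], goal_cases)
  case (5 t1 \<sigma>1)
  have new1: "row \<sigma>1 NEW w q = row \<sigma> NEW w q" for q
    using 5 by (auto intro!: row_cong)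
  have t1: "t1 \<le> 60 * (w + 1)"
    using 5 gw by auto
  show ?case
  proof (cases "valid g h v")
    case False
    have "rows \<sigma>1 NEW w n = rows \<sigma> NEW w n" "distinct_keys \<sigma>1 NEW g w n"
      using dk by (simp_all add: new1 rows_def distinct_keys_def)
    with 5 False v t1 show ?thesis
      by (auto intro!: exI[of _ n] simp: algebra_simps)
  next
    case True
    have bv: "bval (Eq (cell VALID) (N 1)) \<sigma>1"
      using 5 True v by simp
    have s1: "\<sigma>1 x = \<sigma> x" if "x \<notin> {VALID, vR, VEC}" for x
      using 5 that by auto
    show ?thesis
      unfolding wp_If if_P[OF bv] wp_Seq[of Find]
    proof (rule wp_mono[OF Find_spec[where g = g and w = w and n = n]], goal_cases)
      case (6 t2 \<sigma>2)
      then obtain p where p: "p \<le> n" "\<sigma>2 POS 0 = int (p * w)"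
        and fnd: "if p = n then \<forall>q<n. key g (row \<sigma>1 NEW w q) \<noteq> key g (row \<sigma>1 VEC w 0)
              else key g (row \<sigma>1 NEW w p) = key g (row \<sigma>1 VEC w 0)"
        by blast
      have s2: "\<sigma>2 x = \<sigma>1 x" if "x \<notin> {POS, SB, vQ, EQ, vR}" for x
        using 6 that by auto
      have v2: "row \<sigma>2 VEC w 0 = capped g h v" "row \<sigma>1 VEC w 0 = capped g h v"
        using 5 v row_cong[of \<sigma>2 VEC \<sigma>1 w 0] s2 by auto
      have new2: "row \<sigma>2 NEW w q = row \<sigma> NEW w q" for q
        using s1 s2 by (auto intro!: row_cong)
      show ?case
      proof (rule wp_mono[OF Write_spec[where g = g and w = w and n = n and p = p]], goal_cases)
        case (8 t3 \<sigma>3)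
        define c where "c = capped g h v"
        define R where "R = row \<sigma> NEW w"
        define R' where "R' = row \<sigma>3 NEW w"
        define n' where "n' = (if p = n then n + 1 else n)"
        have same: "R' q = R q" if "q \<noteq> p" for q
          using 8 that new2 by (auto simp: R_def R'_def)
        have at_p: "R' p = (if p = n \<or> c g < R p g then c else R p)"
          using 8 by (auto simp: R_def R'_def new2 v2 c_def)
        have f: "if p = n then \<forall>q<n. key g (R q) \<noteq> key g c else key g (R p) = key g c"
          using fnd unfolding new1 v2 R_def c_def .
        have keep: "key g (R' q) = key g (R q)" if "q < n" for q
          using that f at_p same[of q] by (cases "q = p") (auto split: if_splits)
        have key_p: "key g (R' p) = key g c"
          using f at_p by (auto split: if_splits)
        have le_p: "R' p g \<le> c g"
          using at_p by auto
        have pn': "p < n'"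
          using p by (auto simp: n'_def)
        have dk': "distinct_keys \<sigma>3 NEW g w n'"
        proof -
          have "inj_on (\<lambda>q. key g (R' q)) {..<n}"
            using dk keep unfolding distinct_keys_def R_def[symmetric]
            by (auto simp: inj_on_def)
          moreover have "p = n \<Longrightarrow> q < n \<Longrightarrow> key g (R' q) \<noteq> key g (R' n)" for q
            using f keep key_p by auto
          ultimately have "inj_on (\<lambda>q. key g (R' q)) {..<n'}"
            unfolding n'_def inj_on_def by (auto simp: less_Suc_eq) metis+
          then show ?thesis
            by (simp add: distinct_keys_def R'_def)
        qed
        have sub: "R' ` {..<n'} \<subseteq> R ` {..<n} \<union> {c}"
        proof
          fix e assume "e \<in> R' ` {..<n'}"
          then obtain q where q: "q < n'" "e = R' q" by auto
          show "e \<in> R ` {..<n} \<union> {c}"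
          proof (cases "q = p")
            case True
            then show ?thesis using q at_p p by (auto simp: n'_def split: if_splits)
          next
            case False
            then show ?thesis using q same p by (auto simp: n'_def split: if_splits)
          qed
        qed
        have cov: "covers g (R' ` {..<n'}) u" if "covers g (R ` {..<n}) u" for u
        proof -
          from that obtain q where q: "q < n" "key g (R q) = key g u" "R q g \<le> u g"
            by (auto simp: covers_def)
          have "R' q g \<le> R q g"
            using same at_p q(1) by (cases "q = p") auto
          with q keep[of q] show ?thesis
            by (auto simp: covers_def n'_def intro!: bexI[of _ q])
        qed
        have "covers g (R' ` {..<n'}) c"
          using key_p le_p pn' by (auto simp: covers_def)
        with cov sub dk' have main: "distinct_keys \<sigma>3 NEW g w n' \<and>
            n' \<le> n + 1 \<and> rows \<sigma>3 NEW w n' \<subseteq> rows \<sigma> NEW w n \<union> (if valid g h v then {capped g h v} else {}) \<and>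
            (\<forall>u. covers g (rows \<sigma> NEW w n) u \<longrightarrow> covers g (rows \<sigma>3 NEW w n') u) \<and>
            (valid g h v \<longrightarrow> covers g (rows \<sigma>3 NEW w n') (capped g h v))"
          using True by (simp add: rows_def R_def R'_def c_def n'_def)
        have t2: "t2 \<le> n * (100 * (w + 1)) + 20"
        proof -
          have "n * (100 * (g + 1)) \<le> n * (100 * (w + 1))"
            using gw by (intro mult_le_mono) auto
          then show ?thesis using 6 by linarith
        qed
        have t3: "t3 \<le> 120 * (w + 1)"
          using 8 by auto
        have "t1 + (1 + bcost (Eq (cell VALID) (N 1)) + (t2 + t3)) \<le> 200 * (n + 2) * (w + 1)"
          using t1 t2 t3 by (simp add: algebra_simps)
        moreover have "\<sigma>3 x = \<sigma> x"
          if "x \<notin> {VALID, vR, VEC, POS, SB, vQ, EQ, WR, NCNT, NEND, NEW}" for x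
          using that 8 s1 s2 by auto
        moreover have "\<sigma>3 NCNT 0 = int n'" "\<sigma>3 NEND 0 = int (n' * w)"
          using 8 by (auto simp: n'_def)
        ultimately show ?case
          using main by blast
      qed (use s1 s2 gw p in auto)
    qed (use s1 gw in auto)
  qed
qed (use h gw in auto)

section \<open>Processing the digits\<close>

text \<open>The premise on the expressions still knows the array \<open>x\<close> outside the
  segment being written. Thus the source may lie in the array that is filled, as happens when a
  block of items is doubled into the next one.\<close>

lemma wp_fill:
  assumes l: "\<sigma> l 0 = int n" "l \<noteq> i" "l \<noteq> x" "i \<noteq> x"
    and e: "\<And>k \<rho>. k < n \<Longrightarrow> \<rho> i 0 = int k \<Longrightarrow> \<forall>y. y \<notin> {i, x} \<longrightarrow> \<rho> y = \<sigma> y \<Longrightarrow>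
              \<forall>z. \<not> (base \<le> z \<and> z < base + int n) \<longrightarrow> \<rho> x z = \<sigma> x z \<Longrightarrow>
              aval e1 \<rho> = base + int k \<and> aval e2 \<rho> = f k"
  shows "wp (For i l (Assign x e1 e2)) (\<lambda>t \<rho>. t \<le> n * (acost e1 + acost e2 + 13) + 9 \<and>
      (\<forall>z. \<rho> x z = (if base \<le> z \<and> z < base + int n then f (nat (z - base)) else \<sigma> x z)) \<and>
      (\<forall>y. y \<notin> {i, x} \<longrightarrow> \<rho> y = \<sigma> y)) \<sigma>"
proof (rule wp_For[where n = n and T = "acost e1 + acost e2 + 1" and I = "\<lambda>k \<rho>.
    \<forall>z. \<rho> x z = (if base \<le> z \<and> z < base + int k then f (nat (z - base)) else \<sigma> x z)"], goal_cases)
  case (6 k \<rho>)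
  have "aval e1 \<rho> = base + int k \<and> aval e2 \<rho> = f k"
    using 6 by (intro e) auto
  with 6 l show ?case
    by auto
qed (use l in \<open>auto simp: algebra_simps\<close>)

lemma wp_fill_row:
  assumes "\<sigma> WIDTH 0 = int w"
    and e: "\<And>k \<rho>. k < w \<Longrightarrow> \<rho> vR 0 = int k \<Longrightarrow> \<forall>y. y \<notin> {vR, VEC} \<longrightarrow> \<rho> y = \<sigma> y \<Longrightarrow> aval e2 \<rho> = v k"
    and v: "\<And>k. k \<ge> w \<Longrightarrow> v k = 0"
  shows "wp (For vR WIDTH (Assign VEC (cell vR) e2)) (\<lambda>t \<rho>. t \<le> w * (acost e2 + 15) + 9 \<and>
      row \<rho> VEC w 0 = v \<and> (\<forall>y. y \<notin> {vR, VEC} \<longrightarrow> \<rho> y = \<sigma> y)) \<sigma>"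
  by (rule wp_mono[OF wp_fill[where n = w and base = 0 and f = v]])
    (use assms in \<open>auto simp: row_def fun_eq_iff algebra_simps\<close>)

lemma distinct_keys_card:
  assumes "distinct_keys \<sigma> x g w m" "key g ` rows \<sigma> x w m \<subseteq> KS" "finite KS"
  shows "m \<le> card KS"
proof -
  have "m = card ((\<lambda>q. key g (row \<sigma> x w q)) ` {..<m})"
    using assms(1) by (simp add: distinct_keys_def card_image)
  also have "\<dots> \<le> card KS"
    using assms(2,3) by (intro card_mono) (auto simp: rows_def)
  finally show ?thesis .
qed

definition vadd :: "(nat \<Rightarrow> int) \<Rightarrow> (nat \<Rightarrow> int) \<Rightarrow> nat \<Rightarrow> int" where
  "vadd u v = (\<lambda>r. u r + v r)"

text \<open>The transition of the dynamic program: one digit of one unknown is chosen to be 0 or 1,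
  hopeless outcomes are dropped, and the others are cut off.\<close>

definition succs :: "nat \<Rightarrow> int \<Rightarrow> (nat \<Rightarrow> int) \<Rightarrow> (nat \<Rightarrow> int) set \<Rightarrow> (nat \<Rightarrow> int) set" where
  "succs g h a E = {capped g h v | v e. e \<in> E \<and> (v = e \<or> v = vadd e a) \<and> valid g h v}"

definition Expand :: com where
  "Expand =
     (For vR WIDTH (Assign VEC (cell vR) (V CUR (Plus (cell CB) (cell vR)))) ;;
      Insert ;;
      For vR WIDTH (Assign VEC (cell vR)
           (Plus (V CUR (Plus (cell CB) (cell vR))) (V ITEM (Plus (cell SRC) (cell vR))))) ;;
      Insert ;;
      inc CB (cell WIDTH))"

lemma mods_Expand [simp]:
  "mods Expand = {VALID, vR, VEC, POS, SB, vQ, EQ, WR, NCNT, NEND, NEW, CB}"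
  by (auto simp: Expand_def)

lemma rows_cong: "\<rho> x = \<sigma> x \<Longrightarrow> rows \<rho> x w n = rows \<sigma> x w n"
  by (simp add: rows_def row_cong[of \<rho> x \<sigma>])

lemma distinct_keys_cong: "\<rho> x = \<sigma> x \<Longrightarrow> distinct_keys \<rho> x g w n = distinct_keys \<sigma> x g w n"
  by (simp add: distinct_keys_def row_cong[of \<rho> x \<sigma>])

lemma rows_upd [simp]: "x \<noteq> y \<Longrightarrow> rows (\<sigma>(y := f)) x w n = rows \<sigma> x w n"
  by (rule rows_cong) simp

lemma distinct_keys_upd [simp]:
  "x \<noteq> y \<Longrightarrow> distinct_keys (\<sigma>(y := f)) x g w n = distinct_keys \<sigma> x g w n"
  by (rule distinct_keys_cong) simp

lemma Expand_spec:
  assumes st [simp]: "\<sigma> KEYS 0 = int g" "\<sigma> WIDTH 0 = int w" "\<sigma> NCNT 0 = int m" "\<sigma> NEND 0 = int (m * w)"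
      "\<sigma> CAP 0 = h" "\<sigma> CB 0 = int (k * w)" "\<sigma> SRC 0 = int (t * w)"
    and gw: "g < w" and h: "0 \<le> h" and dk: "distinct_keys \<sigma> NEW g w m"
    and e: "e = row \<sigma> CUR w k" and a: "a = row \<sigma> ITEM w t"
  shows "wp Expand (\<lambda>t \<rho>. t \<le> 500 * (m + 3) * (w + 1) \<and> \<rho> CB 0 = int (Suc k * w) \<and>
      (\<exists>m'. \<rho> NCNT 0 = int m' \<and> \<rho> NEND 0 = int (m' * w) \<and> distinct_keys \<rho> NEW g w m' \<and>
        rows \<rho> NEW w m' \<subseteq> rows \<sigma> NEW w m \<union> succs g h a {e} \<and>
        (\<forall>u. covers g (rows \<sigma> NEW w m) u \<longrightarrow> covers g (rows \<rho> NEW w m') u) \<and>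
        (\<forall>u \<in> succs g h a {e}. covers g (rows \<rho> NEW w m') u)) \<and>
      (\<forall>x. x \<notin> {VALID, vR, VEC, POS, SB, vQ, EQ, WR, NCNT, NEND, NEW, CB} \<longrightarrow> \<rho> x = \<sigma> x)) \<sigma>"
  unfolding Expand_def wp_Seq[of "For _ _ _"]
proof (rule wp_mono[OF wp_fill_row[where w = w and v = e]], goal_cases)
  case (4 t1 \<sigma>1)
  then have s1: "\<sigma>1 x = \<sigma> x" if "x \<notin> {vR, VEC}" for x
    using that by auto
  have r1: "row \<sigma>1 VEC w 0 = e" and t1: "t1 \<le> w * 22 + 9"
    using 4 by auto
  show ?case
    unfolding wp_Seq[of Insert]
  proof (rule wp_mono[OF Insert_spec[where g = g and w = w and n = m and h = h and v = e]], goal_cases)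
    case (10 t2 \<sigma>2)
    then obtain m2 where m2: "\<sigma>2 NCNT 0 = int m2" "\<sigma>2 NEND 0 = int (m2 * w)" "distinct_keys \<sigma>2 NEW g w m2"
        and m2_le: "m2 \<le> m + 1" and m2':
        "rows \<sigma>2 NEW w m2 \<subseteq> rows \<sigma>1 NEW w m \<union> (if valid g h e then {capped g h e} else {})"
        "\<forall>u. covers g (rows \<sigma>1 NEW w m) u \<longrightarrow> covers g (rows \<sigma>2 NEW w m2) u"
        "valid g h e \<longrightarrow> covers g (rows \<sigma>2 NEW w m2) (capped g h e)"
      by blast
    have s2: "\<sigma>2 x = \<sigma>1 x" if "x \<notin> {VALID, vR, VEC, POS, SB, vQ, EQ, WR, NCNT, NEND, NEW}" for x
      using 10 that by auto
    have t2: "t2 \<le> 200 * (m + 2) * (w + 1)"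
      using 10 by blast
    show ?case
      unfolding wp_Seq[of "For _ _ _"]
    proof (rule wp_mono[OF wp_fill_row[where w = w and v = "vadd e a"]], goal_cases)
      case (4 t3 \<sigma>3)
      then have s3: "\<sigma>3 x = \<sigma>2 x" if "x \<notin> {vR, VEC}" for x
        using that by auto
      have r3: "row \<sigma>3 VEC w 0 = vadd e a" and t3: "t3 \<le> w * 30 + 9"
        using 4 by auto
      show ?case
        unfolding wp_Seq[of Insert]
      proof (rule wp_mono[OF Insert_spec[where g = g and w = w and n = m2 and h = h and v = "vadd e a"]], goal_cases)
        case (10 t4 \<sigma>4)
        then obtain m4 where m4: "\<sigma>4 NCNT 0 = int m4" "\<sigma>4 NEND 0 = int (m4 * w)" "distinct_keys \<sigma>4 NEW g w m4"
            "rows \<sigma>4 NEW w m4 \<subseteq> rows \<sigma>3 NEW w m2 \<union> (if valid g h (vadd e a) then {capped g h (vadd e a)} else {})"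
            "\<forall>u. covers g (rows \<sigma>3 NEW w m2) u \<longrightarrow> covers g (rows \<sigma>4 NEW w m4) u"
            "valid g h (vadd e a) \<longrightarrow> covers g (rows \<sigma>4 NEW w m4) (capped g h (vadd e a))"
          by blast
        have s4: "\<sigma>4 x = \<sigma>3 x" if "x \<notin> {VALID, vR, VEC, POS, SB, vQ, EQ, WR, NCNT, NEND, NEW}" for x
          using 10 that by auto
        have t4: "t4 \<le> 200 * (m2 + 2) * (w + 1)"
          using 10 by blast
        have rn: "rows \<sigma>3 NEW w m2 = rows \<sigma>2 NEW w m2" "rows \<sigma>1 NEW w m = rows \<sigma> NEW w m"
          using s1 s3 by (auto intro!: rows_cong)
        have sub: "rows \<sigma>4 NEW w m4 \<subseteq> rows \<sigma> NEW w m \<union> succs g h a {e}"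
          using m2'(1) m4(4) unfolding rn succs_def by (auto split: if_splits)
        have cov1: "covers g (rows \<sigma>4 NEW w m4) u" if "covers g (rows \<sigma> NEW w m) u" for u
          using m2'(2) m4(5) that unfolding rn by blast
        have cov2: "covers g (rows \<sigma>4 NEW w m4) u" if "u \<in> succs g h a {e}" for u
          using m2'(3) m4(5,6) that unfolding rn succs_def by auto
        have "200 * (m2 + 2) * (w + 1) \<le> 200 * (m + 3) * (w + 1)"
          using m2_le by (intro mult_le_mono) auto
        then have "t1 + (t2 + (t3 + (t4 + 10))) \<le> 500 * (m + 3) * (w + 1)"
          using t1 t2 t3 t4 by (simp add: algebra_simps)
        then show ?case
          using m4(1,2,3) sub cov1 cov2 s1 s2 s3 s4
          by (auto simp: algebra_simps intro!: exI[of _ m4]) 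
      qed (use s1 s2 s3 m2 gw h r3 distinct_keys_cong[of \<sigma>3 NEW \<sigma>2] in auto)
    qed (use s1 s2 e a in \<open>auto simp: row_def vadd_def\<close>)
  qed (use s1 dk gw h r1 distinct_keys_cong[of \<sigma>1 NEW \<sigma>] in auto)
qed (use e in \<open>auto simp: row_def\<close>)


lemma mods_Step [simp]:
  "mods Step = {CAP, NCNT, NEND, CB, vK, VALID, vR, VEC, POS, SB, vQ, EQ, WR, NEW, vA, CUR, CCNT}"
  by (auto simp: Step_def)

lemma Step_Expand:
  "Step =
     (CAP ::= V ITEM (Plus (cell SRC) (Minus (cell WIDTH) (N 1))) ;;
      NCNT ::= N 0 ;; NEND ::= N 0 ;; CB ::= N 0 ;;
      Seq (For vK CCNT Expand)
        (For vA NEND (Assign CUR (cell vA) (V NEW (cell vA))) ;;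
         CCNT ::= cell NCNT))"
  by (simp add: Step_def Expand_def)

text \<open>During the whole loop \<open>NEW\<close> contains only successors with distinct keys, so
  it never has more than \<open>M\<close> rows. Each of the at most \<open>M\<close> expansions
  searches these rows linearly, whence the square of \<open>M\<close>.\<close>

lemma Step_spec:
  assumes st [simp]: "\<sigma> KEYS 0 = int g" "\<sigma> WIDTH 0 = int w" "\<sigma> CCNT 0 = int n" "\<sigma> SRC 0 = int (t * w)"
    and gw: "g < w" and h: "0 \<le> h" "h = row \<sigma> ITEM w t (w - 1)"
    and E: "E = rows \<sigma> CUR w n" and a: "a = row \<sigma> ITEM w t"
    and KS: "finite KS" "key g ` succs g h a E \<subseteq> KS" "card KS \<le> M" and n: "n \<le> M"
  shows "wp Step (\<lambda>t \<rho>. t \<le> 700 * (M + 3) * (M + 3) * (w + 1) \<and>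
      (\<exists>n'\<le>M. \<rho> CCNT 0 = int n' \<and> rows \<rho> CUR w n' \<subseteq> succs g h a E \<and>
         (\<forall>u \<in> succs g h a E. covers g (rows \<rho> CUR w n') u)) \<and>
      (\<forall>x. x \<notin> {CAP, NCNT, NEND, CB, vK, VALID, vR, VEC, POS, SB, vQ, EQ, WR, NEW, vA, CUR, CCNT} \<longrightarrow>
         \<rho> x = \<sigma> x)) \<sigma>"
proof -
  have cap [simp]: "\<sigma> ITEM (int t * int w + (int w - 1)) = h"
    using gw h(2) by (simp add: row_def of_nat_diff algebra_simps)
  have bound: "m \<le> M" if "distinct_keys \<rho> NEW g w m" "rows \<rho> NEW w m \<subseteq> succs g h a E" for \<rho> m
    using distinct_keys_card[OF that(1) _ KS(1)] that(2) KS(2,3) by (meson image_mono order_trans)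
  have mono: "succs g h a {row \<sigma> CUR w k} \<subseteq> succs g h a E" if "k < n" for k
    using that by (auto simp: succs_def E rows_def)
  have split: "succs g h a E = (\<Union>k<n. succs g h a {row \<sigma> CUR w k})"
    by (auto simp: succs_def E rows_def)
  show ?thesis
    unfolding Step_Expand wp_Seq[of "Assign _ _ _"] wp_Seq[of "For _ _ _"] wp_Assign
  proof (rule wp_For[where n = n and T = "500 * (M + 3) * (w + 1)" and I = "\<lambda>k \<rho>.
      \<rho> CB 0 = int (k * w) \<and>
      (\<exists>m. \<rho> NCNT 0 = int m \<and> \<rho> NEND 0 = int (m * w) \<and> distinct_keys \<rho> NEW g w m \<and>
        rows \<rho> NEW w m \<subseteq> succs g h a E \<and>
        (\<forall>j<k. \<forall>u \<in> succs g h a {row \<sigma> CUR w j}. covers g (rows \<rho> NEW w m) u))"], goal_cases)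
    case 5
    then show ?case
      by (auto simp: distinct_keys_def rows_def)
  next
    case (6 k \<rho>)
    then obtain m where m: "\<rho> NCNT 0 = int m" "\<rho> NEND 0 = int (m * w)" "distinct_keys \<rho> NEW g w m"
        "rows \<rho> NEW w m \<subseteq> succs g h a E"
        "\<forall>j<k. \<forall>u \<in> succs g h a {row \<sigma> CUR w j}. covers g (rows \<rho> NEW w m) u"
      by blast
    have mM: "m \<le> M"
      using bound m by blast
    have r: "row \<rho> CUR w k = row \<sigma> CUR w k" "row \<rho> ITEM w t = a"
      using 6 a by (auto intro!: row_cong)
    show ?case
    proof (rule wp_mono[OF Expand_spec[where g = g and w = w and m = m and h = h and k = k and t = t
            and e = "row \<sigma> CUR w k" and a = a]], goal_cases)
      case (13 t2 \<rho>2)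
      then obtain m2 where m2: "\<rho>2 NCNT 0 = int m2" "\<rho>2 NEND 0 = int (m2 * w)" "distinct_keys \<rho>2 NEW g w m2"
        "rows \<rho>2 NEW w m2 \<subseteq> rows \<rho> NEW w m \<union> succs g h a {row \<sigma> CUR w k}"
        "\<forall>u. covers g (rows \<rho> NEW w m) u \<longrightarrow> covers g (rows \<rho>2 NEW w m2) u"
        "\<forall>u \<in> succs g h a {row \<sigma> CUR w k}. covers g (rows \<rho>2 NEW w m2) u" by blast
      have "t2 \<le> 500 * (m + 3) * (w + 1)" using 13 by blast
      also have "\<dots> \<le> 500 * (M + 3) * (w + 1)" using mM by (intro mult_le_mono) auto
      finally have t2: "t2 \<le> 500 * (M + 3) * (w + 1)" .
      have "rows \<rho>2 NEW w m2 \<subseteq> succs g h a E"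
        using m2(4) m(4) mono[OF 6(1)] by blast
      moreover have "covers g (rows \<rho>2 NEW w m2) u"
        if "j < Suc k" "u \<in> succs g h a {row \<sigma> CUR w j}" for j u
        using that m2(5,6) m(5) by (auto simp: less_Suc_eq)
      moreover have "\<rho>2 CB 0 = int (Suc k * w)"
        using 13 by blast
      ultimately show ?case
        using t2 m2(1-3) by (intro conjI exI[of _ m2]) simp_all
    qed (use 6 m gw h r in auto)
  next
    case (7 t1 \<rho>)
    then obtain m where m: "\<rho> NCNT 0 = int m" "\<rho> NEND 0 = int (m * w)" "distinct_keys \<rho> NEW g w m"
        "rows \<rho> NEW w m \<subseteq> succs g h a E"
        "\<forall>j<n. \<forall>u \<in> succs g h a {row \<sigma> CUR w j}. covers g (rows \<rho> NEW w m) u"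
      by blast
    have mM: "m \<le> M"
      using bound m by blast
    show ?case
    proof (rule wp_mono[OF wp_fill[where n = "m * w" and base = 0 and f = "\<lambda>z. \<rho> NEW (int z)"]], goal_cases)
      case (6 t2 \<rho>2)
      have "rows (\<rho>2(CCNT := (\<rho>2 CCNT)(0 := int m))) CUR w m = rows \<rho> NEW w m"
        unfolding rows_def row_def
      proof (intro image_cong refl ext)
        fix q r assume "q \<in> {..<m}"
        then have "q * w + w \<le> m * w"
          by (metis Suc_leI add.commute lessThan_iff mult_Suc mult_le_mono1)
        then have "r < w \<Longrightarrow> \<rho>2 CUR (int (q * w + r)) = \<rho> NEW (int (q * w + r))"
          using 6 by (auto simp flip: of_nat_mult of_nat_add)
        then show "(if r < w then (\<rho>2(CCNT := (\<rho>2 CCNT)(0 := int m))) CUR (int (q * w + r)) else 0) =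
            (if r < w then \<rho> NEW (int (q * w + r)) else 0)"
          by auto
      qed
      moreover have "t2 \<le> M * w * (3 + 5 + 13) + 9" 
      proof -
        have "t2 \<le> m * w * (3 + 5 + 13) + 9" using 6 by simp
        also have "\<dots> \<le> M * w * (3 + 5 + 13) + 9" using mM by (intro add_mono mult_le_mono) auto
        finally show ?thesis .
      qed
      moreover have "t1 \<le> M * (500 * (M + 3) * (w + 1) + 12) + 9"
        using 7(1) n by (elim order_trans) (intro add_mono mult_le_mono, auto)
      ultimately show ?case
        using mM 6 7 m by (auto simp: algebra_simps split intro!: exI[of _ m])
    qed (use m 7 in \<open>auto\<close>)
  qed auto
qed

lemma mods_Process [simp]:
  "mods Process = {vL, SRC, CAP, NCNT, NEND, CB, vK, VALID, vR, VEC, POS, SB, vQ, EQ, WR, NEW, vA, CUR, CCNT}"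
  by (auto simp: Process_def)

text \<open>This separates the program from the integer programming: \<open>I t E\<close> is any
  property of the set \<open>E\<close> of partial solutions once the items from \<open>t\<close> on
  have been decided. It only has to survive passing to a dominating subset of the successors, whose
  keys lie in a set of at most \<open>M\<close> elements.\<close>

lemma Process_spec:
  fixes I :: "nat \<Rightarrow> (nat \<Rightarrow> int) set \<Rightarrow> bool"
  assumes st [simp]: "\<sigma> KEYS 0 = int g" "\<sigma> WIDTH 0 = int w" "\<sigma> CCNT 0 = 1" "\<sigma> SRC 0 = int (n * w)"
      "\<sigma> NITEMS 0 = int n"
    and gw: "g < w" and h: "\<And>t. t < n \<Longrightarrow> 0 \<le> row \<sigma> ITEM w t (w - 1)"
    and init: "I n (rows \<sigma> CUR w 1)"
    and step: "\<And>t E E'. t < n \<Longrightarrow> I (Suc t) E \<Longrightarrow>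
       E' \<subseteq> succs g (row \<sigma> ITEM w t (w - 1)) (row \<sigma> ITEM w t) E \<Longrightarrow>
       \<forall>u \<in> succs g (row \<sigma> ITEM w t (w - 1)) (row \<sigma> ITEM w t) E. covers g E' u \<Longrightarrow> I t E'"
    and KS: "\<And>t E. t < n \<Longrightarrow> I (Suc t) E \<Longrightarrow>
       key g ` succs g (row \<sigma> ITEM w t (w - 1)) (row \<sigma> ITEM w t) E \<subseteq> KS t"
       "\<And>t. t < n \<Longrightarrow> finite (KS t) \<and> card (KS t) \<le> M"
    and M: "1 \<le> M"
  shows "wp Process (\<lambda>t \<rho>. t \<le> n * (700 * (M + 3) * (M + 3) * (w + 1) + 30) + 9 \<and>
      (\<exists>m\<le>M. \<rho> CCNT 0 = int m \<and> I 0 (rows \<rho> CUR w m)) \<and>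
      (\<forall>x. x \<notin> mods Process \<longrightarrow> \<rho> x = \<sigma> x)) \<sigma>"
  unfolding Process_def
proof (rule wp_For[where n = n and T = "700 * (M + 3) * (M + 3) * (w + 1) + 10" and I = "\<lambda>k \<rho>.
    \<rho> SRC 0 = int ((n - k) * w) \<and> (\<exists>m\<le>M. \<rho> CCNT 0 = int m \<and> I (n - k) (rows \<rho> CUR w m))"], goal_cases)
  case 5
  then show ?case
    using init M by (auto intro!: exI[of _ 1])
next
  case (6 k \<rho>)
  then obtain m where m: "m \<le> M" "\<rho> CCNT 0 = int m" "I (n - k) (rows \<rho> CUR w m)"
    by blast
  \<comment> \<open>Items are treated in descending order: round \<open>k\<close> handles item
    \<open>n - 1 - k\<close>.\<close>
  define t where "t = n - Suc k"
  have t: "t < n" "n - k = Suc t"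
    using 6(1) by (auto simp: t_def)
  define \<rho>1 where "\<rho>1 = \<rho>(SRC := (\<rho> SRC)(0 := int (t * w)))"
  have item: "row \<rho>1 ITEM w t = row \<sigma> ITEM w t"
    using 6 by (auto intro!: row_cong simp: \<rho>1_def)
  have cur: "rows \<rho>1 CUR w m = rows \<rho> CUR w m"
    by (simp add: \<rho>1_def)
  have r1: "\<rho>1 SRC 0 = int (t * w)" "\<And>x. x \<noteq> SRC \<Longrightarrow> \<rho>1 x = \<rho> x"
    by (simp_all add: \<rho>1_def)
  have sr: "wp (SRC ::= Minus (cell SRC) (cell WIDTH)) (\<lambda>t \<rho>'. t \<le> 10 \<and> \<rho>' = \<rho>1) \<rho>"
    using 6 t by (simp add: \<rho>1_def algebra_simps)
  show ?case
    unfolding wp_Seq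
  proof (rule wp_mono[OF sr], goal_cases)
    case (1 t0 \<rho>')
    have "wp Step (\<lambda>t' \<rho>'. t' \<le> 700 * (M + 3) * (M + 3) * (w + 1) \<and>
      (\<exists>n'\<le>M. \<rho>' CCNT 0 = int n' \<and> rows \<rho>' CUR w n' \<subseteq>
           succs g (row \<sigma> ITEM w t (w - 1)) (row \<sigma> ITEM w t) (rows \<rho> CUR w m) \<and>
         (\<forall>u \<in> succs g (row \<sigma> ITEM w t (w - 1)) (row \<sigma> ITEM w t) (rows \<rho> CUR w m).
            covers g (rows \<rho>' CUR w n') u)) \<and>
      (\<forall>x. x \<notin> {CAP, NCNT, NEND, CB, vK, VALID, vR, VEC, POS, SB, vQ, EQ, WR, NEW, vA, CUR, CCNT} \<longrightarrow>
         \<rho>' x = \<rho>1 x)) \<rho>1"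
      apply (rule Step_spec[where t = t and n = m and KS = "KS t"])
      using 6 t m h[OF t(1)] KS(1)[OF t(1)] KS(2)[OF t(1)] gw item cur r1 by simp_all
    then have "wp Step (\<lambda>u \<rho>'. t0 + u \<le> 700 * (M + 3) * (M + 3) * (w + 1) + 10 \<and>
        (\<rho>'(vL := (\<rho>' vL)(0 := 1 + int k))) SRC 0 = int ((n - Suc k) * w) \<and>
        (\<exists>m\<le>M. (\<rho>'(vL := (\<rho>' vL)(0 := 1 + int k))) CCNT 0 = int m \<and>
           I (n - Suc k) (rows (\<rho>'(vL := (\<rho>' vL)(0 := 1 + int k))) CUR w m))) \<rho>1"
    proof (rule wp_mono, goal_cases)
      case (1 u \<rho>')
      then obtain n' where n': "n' \<le> M" "\<rho>' CCNT 0 = int n'" "I t (rows \<rho>' CUR w n')"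
        using step[OF t(1) m(3)[unfolded t(2)]] by blast
      with 1 \<open>t0 \<le> 10 \<and> _\<close> r1(1) show ?case
        unfolding t_def[symmetric] by (intro conjI exI[of _ n']) auto
    qed
    then show ?case
      using 1 by simp
  qed
next
  case (7 t \<rho>)
  then show ?case by (auto simp: algebra_simps)
qed auto

section \<open>The initial partial solution and the extraction of the best final one\<close>

lemma rows_1: "rows \<sigma> x w (Suc 0) = {row \<sigma> x w 0}"
  by (auto simp: rows_def)

definition start_vec :: "state \<Rightarrow> int \<Rightarrow> nat \<Rightarrow> nat \<Rightarrow> nat \<Rightarrow> int" where
  "start_vec \<sigma> p \<tau> G = (\<lambda>r. if r < G then \<sigma> IN (p + int (r * (\<tau> + 1) + \<tau>)) else
     if r = G then \<sigma> TOTAL 0 else if r = Suc G then - \<sigma> TOTAL 0 else 0)"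

lemma mods_Start [simp]: "mods Start = {vR, CUR, RP, vK, CCNT}"
  by (auto simp: Start_def)

lemma Start_spec:
  assumes st [simp]: "\<sigma> WIDTH 0 = int w" "\<sigma> ROWS 0 = int G" "\<sigma> TAU 0 = int \<tau>" "\<sigma> PTR 0 = p"
    and w: "G + 2 < w"
  shows "wp Start (\<lambda>t \<rho>. t \<le> 80 * (w + 1) \<and> \<rho> CCNT 0 = 1 \<and> rows \<rho> CUR w 1 = {start_vec \<sigma> p \<tau> G} \<and>
      (\<forall>x. x \<notin> {vR, CUR, RP, vK, CCNT} \<longrightarrow> \<rho> x = \<sigma> x)) \<sigma>"
  unfolding Start_def wp_Seq[of "For _ _ _"]
proof (rule wp_mono[OF wp_fill[where n = w and base = 0 and f = "\<lambda>_. 0"]], goal_cases)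
  case (6 t1 \<sigma>1)
  then have s1: "\<sigma>1 x = \<sigma> x" if "x \<notin> {vR, CUR}" for x
    using that by auto
  show ?case
    unfolding wp_Seq[of "For _ _ _"] wp_Seq[of "Assign _ _ _"] wp_Assign
  proof (rule wp_For[where n = G and T = 30 and I = "\<lambda>k \<rho>. \<rho> RP 0 = p + int (k * (\<tau> + 1)) \<and>
      (\<forall>r<w. \<rho> CUR (int r) = (if r < k then \<sigma> IN (p + int (r * (\<tau> + 1) + \<tau>)) else 0))"], goal_cases)
    case (6 k \<rho>)
    then show ?case
      using s1
      by (auto simp: algebra_simps)
  next
    case (7 t2 \<rho>)
    have "t1 \<le> w * (3 + 1 + 13) + 9" 
      using 6 by auto
    with 7 6 w show ?case
      by (auto simp: rows_1 row_def start_vec_def fun_eq_iff algebra_simps)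
  qed (use 6 in auto)
qed auto

definition sols :: "nat \<Rightarrow> (nat \<Rightarrow> int) set \<Rightarrow> (int \<times> (nat \<Rightarrow> int)) set" where
  "sols g E = {(e g, \<lambda>j. e (g + 1 + j)) | e. e \<in> E \<and> (\<forall>r<g. 0 \<le> e r)}"

lemma sols_Un: "sols g (E \<union> F) = sols g E \<union> sols g F"
  by (auto simp: sols_def)

lemma rows_Suc: "rows \<sigma> x w (Suc n) = rows \<sigma> x w n \<union> {row \<sigma> x w n}"
  by (auto simp: rows_def lessThan_Suc)

text \<open>The set \<open>X\<close> exists only in the proof: it collects all candidates met so
  far, over all disjuncts. Treating a further disjunct then amounts to a union, and the empty set
  corresponds to the flag \<open>FOUND\<close> being 0.\<close>

definition is_best :: "state \<Rightarrow> nat \<Rightarrow> (int \<times> (nat \<Rightarrow> int)) set \<Rightarrow> bool" where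
  "is_best \<sigma> \<tau> X \<longleftrightarrow>
     (if X = {} then \<sigma> FOUND 0 = 0
      else \<sigma> FOUND 0 = 1 \<and> (\<exists>x. (\<sigma> BEST 0, x) \<in> X \<and> (\<forall>j<\<tau>. \<sigma> SOL (int j) = x j)) \<and>
        (\<forall>(b, x) \<in> X. \<sigma> BEST 0 \<le> b))"

lemma is_best_cong:
  "\<rho> FOUND = \<sigma> FOUND \<Longrightarrow> \<rho> BEST = \<sigma> BEST \<Longrightarrow> \<rho> SOL = \<sigma> SOL \<Longrightarrow> is_best \<rho> \<tau> X = is_best \<sigma> \<tau> X"
  by (simp add: is_best_def)

lemma mods_Extract [simp]: "mods Extract = {CB, vK, VALID, vR, FOUND, BEST, vJ, SOL}"
  by (auto simp: Extract_def)

lemma Extract_spec: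
  assumes st [simp]: "\<sigma> KEYS 0 = int g" "\<sigma> WIDTH 0 = int w" "\<sigma> CCNT 0 = int n" "\<sigma> TAU 0 = int \<tau>"
    and w: "g + \<tau> + 1 \<le> w" and best: "is_best \<sigma> \<tau> X"
  shows "wp Extract (\<lambda>t \<rho>. t \<le> 200 * (n + 1) * (w + 1) \<and> is_best \<rho> \<tau> (X \<union> sols g (rows \<sigma> CUR w n)) \<and>
      (\<forall>x. x \<notin> {CB, vK, VALID, vR, FOUND, BEST, vJ, SOL} \<longrightarrow> \<rho> x = \<sigma> x)) \<sigma>"
  unfolding Extract_def wp_Seq[of "Assign _ _ _"] wp_Assign
proof (rule wp_For[where n = n and T = "g * 42 + \<tau> * 42 + 150" and I = "\<lambda>k \<rho>. \<rho> CB 0 = int (k * w) \<and>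
    is_best \<rho> \<tau> (X \<union> sols g (rows \<sigma> CUR w k))"], goal_cases)
  case 5
  have "is_best (\<sigma>(CB := f, vK := f')) \<tau> X" for f f'
    using best by (subst is_best_cong[of _ \<sigma>]) auto
  then show ?case by (simp add: rows_def sols_def)
next
  case (6 k \<rho>)
  define e where "e = row \<sigma> CUR w k"
  have e: "e r = \<sigma> CUR (int (k * w) + int r)" if "r < w" for r
    using that by (simp add: e_def row_def)
  have \<rho>: "\<rho> x = \<sigma> x" if "x \<notin> {vK, CB, VALID, vR, FOUND, BEST, vJ, SOL}" for x
    using that 6(3) by auto
  have cb: "\<rho> CB 0 = int (k * w)"
    using 6 by auto
  have un: "X \<union> sols g (rows \<sigma> CUR w (Suc k)) = X \<union> sols g (rows \<sigma> CUR w k) \<union> sols g {e}"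
    unfolding rows_Suc sols_Un e_def by (rule Un_assoc[symmetric])
  define Y where "Y = X \<union> sols g (rows \<sigma> CUR w k)"
  have Y: "is_best \<rho> \<tau> Y"
    using 6 by (simp add: Y_def)
  show ?case
    unfolding wp_Seq[of "For _ _ _"] wp_Seq[of "Assign _ _ _"] wp_Assign un Y_def[symmetric]
  proof (rule wp_For[where n = g and T = 30 and I = "\<lambda>j \<rho>'. \<rho>' VALID 0 = (if \<forall>r<j. 0 \<le> e r then 1 else 0)"],
      goal_cases)
    case (6 j \<rho>')
    then show ?case
      using \<rho> cb w
      by (auto simp: less_Suc_eq e)
  next
    case (7 t1 \<rho>1)
    have \<rho>1: "\<rho>1 x = \<rho> x" if "x \<notin> {VALID, vR}" for x
      using 7 that by auto
    have cb: "\<rho>1 CB 0 = int (k * w)"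
      using cb \<rho>1 by auto
    have Y1: "is_best \<rho>1 \<tau> Y"
      using Y \<rho>1 is_best_cong[of \<rho>1 \<rho>] by auto
    have eg: "\<rho>1 CUR (int (k * w) + int g) = e g"
      using \<rho>1 \<rho> w e[of g] by auto
    define upd where "upd \<longleftrightarrow> (\<forall>r<g. 0 \<le> e r) \<and> (Y = {} \<or> e g < \<rho>1 BEST 0)"
    let ?b = "And (Eq (cell VALID) (N 1))
               (Or (Eq (cell FOUND) (N 0)) (Less (V CUR (Plus (cell CB) (cell KEYS))) (cell BEST)))"
    have bv: "bval ?b \<rho>1 \<longleftrightarrow> upd"
      using 7(3) cb eg \<rho>1[of KEYS] \<rho>[of KEYS] Y1 by (auto simp: upd_def is_best_def split: if_splits)
    show ?case
    proof (cases upd)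
      case True
      then have bv': "bval ?b \<rho>1" using bv by simp
      have b: "is_best (\<rho>2(CB := f, vK := f')) \<tau> (Y \<union> sols g {e})"
        if "\<rho>2 FOUND 0 = 1" "\<rho>2 BEST 0 = e g" "\<forall>j<\<tau>. \<rho>2 SOL (int j) = e (g + 1 + j)" for \<rho>2 f f'
        using True Y1 that unfolding upd_def is_best_def sols_def
        by (fastforce split: if_splits)
      show ?thesis
        unfolding wp_Seq[of "com.If _ _ _"] wp_If if_P[OF bv'] wp_Seq[of "Assign _ _ _"] wp_Assign
      proof (rule wp_mono[OF wp_fill[where n = \<tau> and base = 0 and f = "\<lambda>j. e (g + 1 + j)"]], goal_cases)
        case (5 j \<rho>2)
        then show ?case
          using \<rho>1 \<rho> cb w e[of "g + 1 + j"] by (auto simp: algebra_simps)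
      next
        case (6 t2 \<rho>2)
        then show ?case
          using 7(1) \<rho>1 \<rho> cb eg b[of \<rho>2] by (auto simp: algebra_simps)
      qed (use \<rho>1 \<rho> in auto)
    next
      case False
      then have bv': "\<not> bval ?b \<rho>1" using bv by simp
      have b: "is_best (\<rho>1(CB := f, vK := f')) \<tau> (Y \<union> sols g {e})" for f f'
        using False Y1 unfolding upd_def is_best_def sols_def
        by (fastforce split: if_splits)
      show ?thesis
        unfolding wp_Seq[of "com.If _ _ _"] wp_If if_not_P[OF bv'] 
        using 7(1) \<rho>1 \<rho> cb b by (auto simp: algebra_simps)
    qed
  qed (use 6 w in auto)
next
  case (7 t \<rho>)
  have "n * (g * 42 + \<tau> * 42 + 150 + 12) \<le> n * (42 * w + 162)"
    using w by (intro mult_le_mono) auto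
  with 7 show ?case
    by (auto simp: algebra_simps)
qed auto

section \<open>Setting up the items\<close>

text \<open>Minimality of the pair (price, index) in lexicographic order among the types with the
  same column. The tie break by index leaves exactly one type per column.\<close>

definition kept :: "(nat \<Rightarrow> nat \<Rightarrow> int) \<Rightarrow> (nat \<Rightarrow> int) \<Rightarrow> nat \<Rightarrow> nat \<Rightarrow> nat \<Rightarrow> bool" where
  "kept A c \<tau> G j \<longleftrightarrow> \<not> (\<exists>k<\<tau>. (\<forall>r<G. A r j = A r k) \<and> (c k < c j \<or> c k = c j \<and> k < j))"

text \<open>The signs are those of a change of the residual \<open>b - A x\<close> when
  \<open>x j\<close> grows by 1. Dropped types get the zero vector instead of being removed, so
  every level has exactly \<tau> items and addresses stay regular.\<close>

definition item_vec :: "(nat \<Rightarrow> nat \<Rightarrow> int) \<Rightarrow> (nat \<Rightarrow> int) \<Rightarrow> nat \<Rightarrow> nat \<Rightarrow> nat \<Rightarrow> nat \<Rightarrow> int" where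
  "item_vec A c \<tau> G j = (\<lambda>r. if \<not> kept A c \<tau> G j then 0 else if r < G then - A r j else if r = G then - 1
     else if r = G + 1 then 1 else if r = G + 2 then c j else if r = G + 3 + j then 1 else 0)"

text \<open>The l1 norm of the key part of an item; the summand 2 stems from the two rows that fix
  the total.\<close>

definition col_norm :: "(nat \<Rightarrow> nat \<Rightarrow> int) \<Rightarrow> (nat \<Rightarrow> int) \<Rightarrow> nat \<Rightarrow> nat \<Rightarrow> nat \<Rightarrow> int" where
  "col_norm A c \<tau> G j = (if kept A c \<tau> G j then 2 + (\<Sum>r<G. \<bar>A r j\<bar>) else 0)"

definition matrix_at :: "state \<Rightarrow> nat \<Rightarrow> int \<Rightarrow> nat \<Rightarrow> nat \<Rightarrow> int" where
  "matrix_at \<sigma> \<tau> p r j = \<sigma> IN (p + int (r * (\<tau> + 1) + j))"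

definition price_at :: "state \<Rightarrow> nat \<Rightarrow> nat \<Rightarrow> int" where
  "price_at \<sigma> \<tau> j = \<sigma> IN (1 + int \<tau> + int j)"

lemma mods_Check_Kept [simp]: "mods Check_Kept = {KEPT, vK, EQ, RP, vR}"
  by (auto simp: Check_Kept_def)

lemma Check_Kept_spec:
  assumes st [simp]: "\<sigma> TAU 0 = int \<tau>" "\<sigma> ROWS 0 = int G" "\<sigma> PTR 0 = p" "\<sigma> vJ 0 = int j"
    and A: "A = matrix_at \<sigma> \<tau> p" and c: "c = price_at \<sigma> \<tau>"
  shows "wp Check_Kept (\<lambda>t \<rho>. t \<le> \<tau> * (G * 70 + 200) + 20 \<and>
      \<rho> KEPT 0 = (if kept A c \<tau> G j then 1 else 0) \<and>
      (\<forall>x. x \<notin> {KEPT, vK, EQ, RP, vR} \<longrightarrow> \<rho> x = \<sigma> x)) \<sigma>"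
  unfolding Check_Kept_def wp_Seq[of "Assign _ _ _"] wp_Assign
proof (rule wp_For[where n = \<tau> and T = "G * 70 + 150" and I = "\<lambda>k \<rho>. \<rho> KEPT 0 =
    (if \<exists>k'<k. (\<forall>r<G. A r j = A r k') \<and> (c k' < c j \<or> c k' = c j \<and> k' < j) then 0 else 1)"], goal_cases)
  case (6 k \<rho>)
  then have \<rho>: "\<rho> x = \<sigma> x" if "x \<notin> {KEPT, vK, EQ, RP, vR}" for x
    using that by auto
  have cs: "\<sigma> IN (1 + (int \<tau> + int k)) = c k" "\<sigma> IN (1 + (int \<tau> + int j)) = c j"
    by (simp_all add: c price_at_def add.assoc)
  show ?case
    unfolding wp_Seq[of "For _ _ _"] wp_Seq[of "Assign _ _ _"] wp_Assign
  proof (rule wp_For[where n = G and T = 55 and I = "\<lambda>r \<rho>'. \<rho>' RP 0 = p + int (r * (\<tau> + 1)) \<and>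
      \<rho>' EQ 0 = (if \<forall>r'<r. A r' j = A r' k then 1 else 0)"], goal_cases)
    case (6 r \<rho>')
    have "A r j = \<sigma> IN (p + int (r * (\<tau> + 1)) + int j)" "A r k = \<sigma> IN (p + int (r * (\<tau> + 1)) + int k)"
      by (simp_all add: A matrix_at_def algebra_simps)
    with 6 show ?case
      using \<rho> \<open>\<rho> vK 0 = int k\<close> by (auto simp: less_Suc_eq algebra_simps)
  next
    case (7 t \<rho>')
    then show ?case
      using \<rho> 6(2,4) cs by (auto simp: less_Suc_eq)
  qed (use \<rho> 6 in auto)
next
  case (7 t \<rho>)
  then show ?case
    by (auto simp: kept_def algebra_simps)
qed auto

lemma mods_Write_Item [simp]: "mods Write_Item = {vR, ITEM, RP, NORM}"
  by (auto simp: Write_Item_def)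

lemma Write_Item_spec:
  assumes st [simp]: "\<sigma> TAU 0 = int \<tau>" "\<sigma> ROWS 0 = int G" "\<sigma> PTR 0 = p" "\<sigma> vJ 0 = int j"
      "\<sigma> KEYS 0 = int (G + 2)" "\<sigma> WIDTH 0 = int w" "\<sigma> IB 0 = int (j * w)"
      "\<sigma> KEPT 0 = (if kept A c \<tau> G j then 1 else 0)"
    and j: "j < \<tau>" and w: "w = G + \<tau> + 4" and A: "A = matrix_at \<sigma> \<tau> p" and c: "c = price_at \<sigma> \<tau>"
  shows "wp Write_Item (\<lambda>t \<rho>. t \<le> 300 * (w + 1) \<and> \<rho> NORM 0 = \<sigma> NORM 0 + col_norm A c \<tau> G j \<and>
      row \<rho> ITEM w j = item_vec A c \<tau> G j \<and>
      (\<forall>q. q \<noteq> j \<longrightarrow> row \<rho> ITEM w q = row \<sigma> ITEM w q) \<and>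
      (\<forall>x. x \<notin> {vR, ITEM, RP, NORM} \<longrightarrow> \<rho> x = \<sigma> x)) \<sigma>"
  unfolding Write_Item_def wp_Seq[of "For _ _ _"]
proof (rule wp_mono[OF wp_fill[where n = w and base = "int (j * w)" and f = "\<lambda>_. 0"]], goal_cases)
  case (6 t1 \<sigma>1)
  then have s1: "\<sigma>1 x = \<sigma> x" if "x \<notin> {vR, ITEM}" for x
    using that by auto
  have t1: "t1 \<le> w * 22 + 9"
    using 6 by auto
  have i1: "\<sigma>1 ITEM (int (j * w + r)) = 0" if "r < w" for r
    using 6 that by auto
  have i1': "\<sigma>1 ITEM (int (q * w + r)) = \<sigma> ITEM (int (q * w + r))" if "q \<noteq> j" "r < w" for q r
  proof -
    have "q * w + r < j * w \<or> j * w + w \<le> q * w + r"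
    proof (cases "q < j")
      case True
      then have "q * w + w \<le> j * w" by (metis Suc_leI add.commute mult_Suc mult_le_mono1)
      with that show ?thesis by simp
    next
      case False
      then have "j * w + w \<le> q * w" using that by (metis Suc_leI add.commute linorder_neqE_nat mult_Suc mult_le_mono1)
      then show ?thesis by simp
    qed
    then show ?thesis
      using 6 by (auto simp flip: of_nat_mult of_nat_add)
  qed
  show ?case
  proof (cases "kept A c \<tau> G j")
    case False
    then have "\<not> bval (Eq (cell KEPT) (N 1)) \<sigma>1"
      using s1 by simp
    then show ?thesis
      using s1 t1 i1 i1' False by (auto simp: row_def item_vec_def col_norm_def fun_eq_iff)
  next
    case True
    then have bv: "bval (Eq (cell KEPT) (N 1)) \<sigma>1"
      using s1 by simp
    have ix: "j * w + r = q * w + u \<longleftrightarrow> j = q \<and> r = u" if "r < w" "u < w" for q r u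
      using that block_index_cong[of r w u j q] by auto
    show ?thesis
      unfolding wp_If if_P[OF bv] wp_Seq[of "For _ _ _"] wp_Seq[of "Assign _ _ _"] wp_Assign
    proof (rule wp_For[where n = G and T = 100 and I = "\<lambda>k \<rho>. \<rho> RP 0 = p + int (k * (\<tau> + 1)) \<and>
        \<rho> NORM 0 = \<sigma> NORM 0 + (\<Sum>r<k. \<bar>A r j\<bar>) \<and>
        (\<forall>r<w. \<rho> ITEM (int (j * w + r)) = (if r < k then - A r j else 0)) \<and>
        (\<forall>q r. q \<noteq> j \<longrightarrow> r < w \<longrightarrow> \<rho> ITEM (int (q * w + r)) = \<sigma> ITEM (int (q * w + r)))"], goal_cases)
      case 5
      show ?case
        using s1 i1 i1' by simp
    next
      case (6 k \<rho>)
      have Ak: "\<sigma> IN (p + int (k * (\<tau> + 1)) + int j) = A k j"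
        by (simp add: A matrix_at_def algebra_simps)
      have kw: "k < w"
        using 6 w by simp
      have ix': "q * w + u = j * w + k \<longleftrightarrow> q = j \<and> u = k" if "u < w" for q u
        using block_index_cong[OF that kw] .
      show ?case
        using 6 s1 Ak ix' by (auto simp: less_Suc_eq algebra_simps simp flip: of_nat_mult of_nat_add)
    next
      case (7 t2 \<rho>)
      define f where "f = \<rho> ITEM"
      have f1: "f (int (j * w + r)) = (if r < G then - A r j else 0)" if "r < w" for r
        using 7 that by (simp add: f_def)
      have f2: "f (int (q * w + r)) = \<sigma> ITEM (int (q * w + r))" if "r < w" "q \<noteq> j" for q r
        using 7 that by (simp add: f_def)
      have cj: "c j = \<sigma> IN (1 + (int \<tau> + int j))"
        by (simp add: c price_at_def add.assoc)
      let ?f = "f(int (j * w + G) := - 1, int (j * w + (G + 1)) := 1, int (j * w + (G + 2)) := c j,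
          int (j * w + (G + 3 + j)) := 1)"
      have r1: "(if r < w then ?f (int (j * w + r)) else 0) = item_vec A c \<tau> G j r" for r
        using True f1[of r] ix w j by (auto simp: item_vec_def simp del: of_nat_add of_nat_mult)
      have r2: "?f (int (q * w + r)) = \<sigma> ITEM (int (q * w + r))" if "r < w" "q \<noteq> j" for q r
      proof -
        have "int (q * w + r) \<noteq> int (j * w + u)" if "u < w" for u
          using ix[OF that \<open>r < w\<close>, of q] \<open>q \<noteq> j\<close> by (metis of_nat_eq_iff)
        moreover have "G < w" "G + 1 < w" "G + 2 < w" "G + 3 + j < w"
          using w j by auto
        ultimately show ?thesis
          using f2[OF that] by (simp only: fun_upd_apply if_False)
      qed
      have \<rho>: "\<rho> x = \<sigma> x" if "x \<notin> {vR, ITEM, RP, NORM}" for x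
        using 7(2) s1 that by auto
      have fe: "?f = (\<rho> ITEM)(int j * int w + int G := - 1, int j * int w + (int G + 1) := 1, int j * int w + (2 + int G) := c j,
          int j * int w + (2 + int G + (1 + int j)) := 1)"
        unfolding f_def by (simp add: algebra_simps)
      have r1': "row \<rho>' ITEM w j = item_vec A c \<tau> G j" if "\<rho>' ITEM = ?f" for \<rho>'
        unfolding row_def that using r1 by auto
      have r2': "row \<rho>' ITEM w q = row \<sigma> ITEM w q" if "\<rho>' ITEM = ?f" "q \<noteq> j" for \<rho>' q
        unfolding row_def that(1) using r2[OF _ that(2)] by auto
      have "t1 + t2 + 200 \<le> 300 * (w + 1)"
        using 7(1) t1 w by (simp add: algebra_simps)
      then show ?case
        using 7(3) \<rho> True cj r1' r2' fe by (auto simp: col_norm_def algebra_simps)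
    qed (use s1 in auto)
  qed
qed auto

lemma mods_Base_Items [simp]:
  "mods Base_Items = {NORM, IB, vJ, KEPT, vK, EQ, RP, vR, ITEM, BLOCK}"
  by (auto simp: Base_Items_def)

text \<open>The cutoffs need a second pass over the items, because \<open>2 * M\<close> is known
  only after the norms of all columns have been added up.\<close>

lemma Base_Items_spec:
  assumes st [simp]: "\<sigma> TAU 0 = int \<tau>" "\<sigma> ROWS 0 = int G" "\<sigma> PTR 0 = p" 
      "\<sigma> KEYS 0 = int (G + 2)" "\<sigma> WIDTH 0 = int w"
    and w: "w = G + \<tau> + 4" and A: "A = matrix_at \<sigma> \<tau> p" and c: "c = price_at \<sigma> \<tau>"
    and M: "M = (\<Sum>j<\<tau>. col_norm A c \<tau> G j)"
  shows "wp Base_Items (\<lambda>t \<rho>. t \<le> 1000 * (w + 1) * (w + 1) * (w + 1) \<and> \<rho> BLOCK 0 = int (\<tau> * w) \<and>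
      (\<forall>j<\<tau>. row \<rho> ITEM w j = (item_vec A c \<tau> G j)(w - 1 := 2 * M)) \<and>
      (\<forall>x. x \<notin> {NORM, IB, vJ, KEPT, vK, EQ, RP, vR, ITEM, BLOCK} \<longrightarrow> \<rho> x = \<sigma> x)) \<sigma>"
  unfolding Base_Items_def wp_Seq[of "Assign _ _ _"] wp_Seq[of "For _ _ _"] wp_Assign
proof (rule wp_For[where n = \<tau> and T = "\<tau> * (G * 70 + 200) + 20 + 300 * (w + 1) + 20" and I = "\<lambda>k \<rho>.
    \<rho> IB 0 = int (k * w) \<and> \<rho> NORM 0 = (\<Sum>j<k. col_norm A c \<tau> G j) \<and>
    (\<forall>j<k. row \<rho> ITEM w j = item_vec A c \<tau> G j)"], goal_cases)
  case (6 k \<rho>)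
  then have \<rho>: "\<rho> x = \<sigma> x" if "x \<notin> {NORM, IB, vJ, KEPT, vK, EQ, RP, vR, ITEM, BLOCK}" for x
    using that by auto
  have A\<rho>: "A = matrix_at \<rho> \<tau> p" "c = price_at \<rho> \<tau>"
    using \<rho>[of IN] by (auto simp: A c matrix_at_def price_at_def fun_eq_iff)
  show ?case
    unfolding wp_Seq[of Check_Kept]
  proof (rule wp_mono[OF Check_Kept_spec[where \<tau> = \<tau> and G = G and j = k and p = p and A = A and c = c]], goal_cases)
    case (7 t1 \<rho>1)
    then have \<rho>1: "\<rho>1 x = \<rho> x" if "x \<notin> {KEPT, vK, EQ, RP, vR}" for x
      using that by auto
    have A\<rho>1: "A = matrix_at \<rho>1 \<tau> p" "c = price_at \<rho>1 \<tau>"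
      using \<rho>[of IN] \<rho>1[of IN] by (auto simp: A c matrix_at_def price_at_def fun_eq_iff)
    show ?case
      unfolding wp_Seq[of Write_Item]
    proof (rule wp_mono[OF Write_Item_spec[where \<tau> = \<tau> and G = G and j = k and p = p and A = A and c = c and w = w]],
        goal_cases)
      case (13 t2 \<rho>2)
      have "row \<rho>1 ITEM w q = row \<rho> ITEM w q" for q
        using \<rho>1 by (auto intro!: row_cong)
      then have "row \<rho>2 ITEM w j = item_vec A c \<tau> G j" if "j < Suc k" for j
        using that 13 6(4) by (cases "j = k") auto
      then show ?case
        using 6 7 13 \<rho> \<rho>1 by (auto simp: algebra_simps)
    qed (use 6 7 \<rho> \<rho>1 w A\<rho>1 in auto)
  qed (use 6 \<rho> A\<rho> in auto)
next
  case (7 t1 \<rho>1)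
  then have \<rho>1: "\<rho>1 x = \<sigma> x" if "x \<notin> {NORM, IB, vJ, KEPT, vK, EQ, RP, vR, ITEM, BLOCK}" for x
    using that by auto
  have norm1: "\<rho>1 NORM 0 = M"
    using 7 M by simp
  \<comment> \<open>The cubic term comes from comparing every pair of columns in every row.\<close>
  have "\<tau> * (\<tau> * (G * 70 + 200) + 20 + 300 * (w + 1) + 20 + 12) + 9 \<le> 900 * (w + 1) * (w + 1) * (w + 1)"
  proof -
    have "\<tau> * (G * 70 + 200) \<le> w * (w * 70 + 200)"
      using w by (intro mult_le_mono add_mono) auto
    then have "\<tau> * (\<tau> * (G * 70 + 200) + 20 + 300 * (w + 1) + 20 + 12) + 9 \<le>
        w * (w * (w * 70 + 200) + 20 + 300 * (w + 1) + 20 + 12) + 9"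
      using w by (intro mult_le_mono add_mono) auto
    also have "\<dots> \<le> 900 * (w + 1) * (w + 1) * (w + 1)"
      by (simp add: algebra_simps)
    finally show ?thesis .
  qed
  then have t1: "t1 \<le> 900 * (w + 1) * (w + 1) * (w + 1)"
    using 7(1) by linarith
  show ?case
  proof (rule wp_For[where n = \<tau> and T = 40 and I = "\<lambda>k \<rho>. \<rho> IB 0 = int (k * w) \<and>
      (\<forall>j<\<tau>. row \<rho> ITEM w j = (if j < k then (item_vec A c \<tau> G j)(w - 1 := 2 * M) else item_vec A c \<tau> G j))"],
      goal_cases)
    case (6 k \<rho>)
    define x where "x = int (k * w + (w - 1))"
    have x: "int (k * w) + int w - 1 = x"
      using w by (simp add: x_def of_nat_diff)
    have r: "row \<rho>' ITEM w j = (if j < Suc k then (item_vec A c \<tau> G j)(w - 1 := 2 * M) else item_vec A c \<tau> G j)"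
      if "j < \<tau>" "\<rho>' ITEM = (\<rho> ITEM)(x := M + M)" for j \<rho>'
    proof (cases "j = k")
      case True
      have "row \<rho>' ITEM w j = (row \<rho> ITEM w j)(w - 1 := 2 * M)"
        using w by (auto simp: row_def that(2) fun_eq_iff x_def True)
      then show ?thesis
        using 6(4) that(1) True by simp
    next
      case False
      have "int (j * w + r) \<noteq> x" if "r < w" for r
        using block_index_cong[OF that, of "w - 1" j k] w False that unfolding x_def of_nat_eq_iff by auto
      then have "row \<rho>' ITEM w j = row \<rho> ITEM w j"
        unfolding row_def \<open>\<rho>' ITEM = _\<close> by auto
      then show ?thesis
        using 6(4) that(1) False by (simp add: less_Suc_eq)
    qed
    have n: "\<rho> NORM 0 = M" "\<rho> WIDTH 0 = int w" "\<rho> IB 0 = int (k * w)"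
      using 6 \<rho>1 norm1 by auto
    have "wp (inc IB (cell WIDTH) ;; Assign ITEM (Minus (cell IB) (N 1)) (Plus (cell NORM) (cell NORM)))
        (\<lambda>t \<rho>'. t \<le> 40 \<and> \<rho>' IB 0 = int (k * w) + int w \<and> \<rho>' ITEM = (\<rho> ITEM)(x := M + M)) \<rho>"
      by (simp add: n x del: of_nat_mult)
    then show ?case
    proof (rule wp_mono, goal_cases)
      case (1 t \<rho>')
      then show ?case
        using r[of _ "\<rho>'(vJ := (\<rho>' vJ)(0 := 1 + int k))"] by simp
    qed
  next
    case (7 t2 \<rho>2)
    have "t2 + 100 \<le> 100 * (w + 1)"
      using 7(1) w by simp
    moreover have "w + 1 \<le> (w + 1) * (w + 1) * (w + 1)"
      by simp
    ultimately have "t1 + t2 + 100 \<le> 1000 * (w + 1) * (w + 1) * (w + 1)"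
    proof -
      assume a: "t2 + 100 \<le> 100 * (w + 1)" "w + 1 \<le> (w + 1) * (w + 1) * (w + 1)"
      then have "t2 + 100 \<le> 100 * ((w + 1) * (w + 1) * (w + 1))"
        by (meson mult_le_mono2 order_trans)
      then have "t1 + (t2 + 100) \<le> 900 * ((w + 1) * (w + 1) * (w + 1)) + 100 * ((w + 1) * (w + 1) * (w + 1))"
        using t1 unfolding mult.assoc by (rule add_mono[rotated])
      then show ?thesis
        by (simp only: mult.assoc[symmetric] distrib_right[symmetric] add.assoc) (simp add: algebra_simps)
    qed
    then show ?case
      using 7 \<rho>1 \<open>\<rho>1 IB 0 = _ \<and> _\<close> by auto
  qed (use \<rho>1 7 in auto)
qed auto

lemma mods_Double_Items [simp]: "mods Double_Items = {SRC, NITEMS, vI, vA, ITEM}"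
  by (auto simp: Double_Items_def)

lemma Double_Items_spec:
  assumes st [simp]: "\<sigma> BLOCK 0 = int b" "\<sigma> LEV 0 = int L" "\<sigma> TAU 0 = int \<tau>"
  shows "wp Double_Items (\<lambda>t \<rho>. t \<le> L * (b * 60 + 60) + 20 \<and> \<rho> SRC 0 = int (L * b) \<and>
      \<rho> NITEMS 0 = int (L * \<tau>) \<and>
      (\<forall>i\<le>L. \<forall>a<b. \<rho> ITEM (int (i * b + a)) = 2 ^ i * \<sigma> ITEM (int a)) \<and>
      (\<forall>x. x \<notin> {SRC, NITEMS, vI, vA, ITEM} \<longrightarrow> \<rho> x = \<sigma> x)) \<sigma>"
  unfolding Double_Items_def wp_Seq[of "Assign _ _ _"] wp_Assign
proof (rule wp_For[where n = L and T = "b * 60 + 40" and I = "\<lambda>k \<rho>. \<rho> SRC 0 = int (k * b) \<and>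
    \<rho> NITEMS 0 = int (k * \<tau>) \<and> (\<forall>i\<le>k. \<forall>a<b. \<rho> ITEM (int (i * b + a)) = 2 ^ i * \<sigma> ITEM (int a))"], goal_cases)
  case (6 k \<rho>)
  then have \<rho>: "\<rho> x = \<sigma> x" if "x \<notin> {SRC, NITEMS, vI, vA, ITEM}" for x
    using that by auto
  have it: "\<rho> ITEM (int (i * b + a)) = 2 ^ i * \<sigma> ITEM (int a)" if "i \<le> k" "a < b" for i a
    using 6(4) that by blast
  show ?case
    unfolding wp_Seq[of "For _ _ _"]
  proof (rule wp_mono[OF wp_fill[where n = b and base = "int (Suc k * b)" and f = "\<lambda>a. 2 ^ Suc k * \<sigma> ITEM (int a)"]],
      goal_cases)
    case (5 a \<rho>')
    have "\<rho>' ITEM (int (k * b + a)) = \<rho> ITEM (int (k * b + a))"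
      using 5 by auto
    then have "\<rho>' ITEM (int (k * b + a)) = 2 ^ k * \<sigma> ITEM (int a)"
      using it[of k a] 5(1) by simp
    then show ?case
      using 5 6 \<rho> by (auto simp: algebra_simps)
  next
    case (6 t \<rho>')
    have "\<rho>' ITEM (int (i * b + a)) = 2 ^ i * \<sigma> ITEM (int a)" if "i \<le> Suc k" "a < b" for i a
    proof (cases "i = Suc k")
      case True
      then show ?thesis using 6 that by auto
    next
      case False
      then have "i * b + b \<le> Suc k * b"
        using that by (metis Suc_leI add.commute le_neq_implies_less mult_Suc mult_le_mono1)
      then have "\<not> int (Suc k * b) \<le> int (i * b + a)"
        using that by linarith
      then show ?thesis
        using 6 it[of i a] False that by simp
    qed
    then show ?case
      using 6 \<open>\<rho> SRC 0 = _ \<and> _\<close> \<rho> by (auto simp: algebra_simps)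
  qed (use \<rho> in auto)
next
  case (7 t \<rho>)
  then show ?case by (auto simp: algebra_simps)
qed auto

section \<open>Correctness of the dynamic program\<close>

text \<open>The integer program of one disjunct. All unknowns are nonnegative with sum
  \<open>S\<close>, so by \<open>S_less\<close> each of them has at most \<open>L\<close> binary
  digits.\<close>

locale move_ip =
  fixes A :: "nat \<Rightarrow> nat \<Rightarrow> int" and c :: "nat \<Rightarrow> int" and \<tau> G L :: nat and b :: "nat \<Rightarrow> int" and S :: int
  assumes tau_pos: "0 < \<tau>" and S_less: "S < 2 ^ L"
begin

definition feas :: "(nat \<Rightarrow> int) \<Rightarrow> bool" where
  "feas x \<longleftrightarrow> (\<forall>j<\<tau>. 0 \<le> x j) \<and> (\<Sum>j<\<tau>. x j) = S \<and> (\<forall>r<G. (\<Sum>j<\<tau>. A r j * x j) \<le> b r)"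

definition cost :: "(nat \<Rightarrow> int) \<Rightarrow> int" where
  "cost x = (\<Sum>j<\<tau>. c j * x j)"

lemma kept_rep:
  assumes "j < \<tau>"
  shows "\<exists>k<\<tau>. kept A c \<tau> G k \<and> (\<forall>r<G. A r k = A r j) \<and> c k \<le> c j"
proof -
  define K where "K = {k. k < \<tau> \<and> (\<forall>r<G. A r k = A r j)}"
  have fin: "finite K" and jK: "j \<in> K"
    using assms by (auto simp: K_def)
  define m where "m = Min (c ` K)"
  \<comment> \<open>Among the cheapest types of the class the smallest index is taken, matching the
    tie break in \<open>kept\<close>.\<close>
  define k where "k = (LEAST k. k \<in> K \<and> c k = m)"
  have "\<exists>k. k \<in> K \<and> c k = m"
    using Min_in[of "c ` K"] fin jK unfolding m_def by (metis empty_iff finite_imageI imageE image_is_empty)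
  then have k: "k \<in> K" "c k = m"
    unfolding k_def by (metis (mono_tags, lifting) LeastI)+
  have least: "k \<le> k'" if "k' \<in> K" "c k' = m" for k'
    unfolding k_def using that by (intro Least_le) auto
  have min: "m \<le> c k'" if "k' \<in> K" for k'
    using fin that by (simp add: m_def)
  have "kept A c \<tau> G k"
    unfolding kept_def
  proof
    assume "\<exists>k'<\<tau>. (\<forall>r<G. A r k = A r k') \<and> (c k' < c k \<or> c k' = c k \<and> k' < k)"
    then obtain k' where k': "k' < \<tau>" "\<forall>r<G. A r k = A r k'" "c k' < c k \<or> c k' = c k \<and> k' < k"
      by blast
    then have "k' \<in> K" using k by (auto simp: K_def)
    with k' k least min show False by fastforce
  qed
  then show ?thesis
    using k min[OF jK] by (auto simp: K_def)
qed

definition target :: "(nat \<Rightarrow> int) \<Rightarrow> bool" where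
  "target y \<longleftrightarrow> feas y \<and> (\<forall>j<\<tau>. y j < 2 ^ L \<and> (\<not> kept A c \<tau> G j \<longrightarrow> y j = 0))"

text \<open>Moving everybody to the representative of the own column preserves the total and all row
  values and does not raise the cost. The entries stay below \<open>2 ^ L\<close> because each is at
  most the total.\<close>

lemma exists_target:
  assumes y: "feas y"
  shows "\<exists>y'. target y' \<and> cost y' \<le> cost y"
proof -
  obtain rep where rep: "\<And>j. j < \<tau> \<Longrightarrow> rep j < \<tau> \<and> kept A c \<tau> G (rep j) \<and> (\<forall>r<G. A r (rep j) = A r j) \<and> c (rep j) \<le> c j"
    using kept_rep by metis
  define y' where "y' k = (\<Sum>j\<in>{j\<in>{..<\<tau>}. rep j = k}. y j)" for k
  have y0: "0 \<le> y j" if "j < \<tau>" for j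
    using y that by (auto simp: feas_def)
  have sum: "(\<Sum>k<\<tau>. f k * y' k) = (\<Sum>j<\<tau>. f (rep j) * y j)" for f :: "nat \<Rightarrow> int"
  proof -
    have "(\<Sum>k<\<tau>. f k * y' k) = (\<Sum>k<\<tau>. \<Sum>j\<in>{j\<in>{..<\<tau>}. rep j = k}. f (rep j) * y j)"
      by (simp add: y'_def sum_distrib_left)
    also have "\<dots> = (\<Sum>j<\<tau>. f (rep j) * y j)"
      using rep by (intro sum.group) auto
    finally show ?thesis .
  qed
  have nonneg: "0 \<le> y' k" for k
    using y0 by (auto simp: y'_def intro!: sum_nonneg)
  have total: "(\<Sum>k<\<tau>. y' k) = S"
    using sum[of "\<lambda>_. 1"] y by (simp add: feas_def)
  have "y' k \<le> S" if "k < \<tau>" for k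
    unfolding total[symmetric] using that nonneg by (intro member_le_sum) auto
  then have "y' k < 2 ^ L" if "k < \<tau>" for k
    using that S_less by (meson le_less_trans)
  moreover have "y' k = 0" if "\<not> kept A c \<tau> G k" for k
    using that rep by (auto simp: y'_def intro!: sum.neutral)
  moreover have "(\<Sum>k<\<tau>. A r k * y' k) \<le> b r" if "r < G" for r
    using y that rep by (auto simp: sum feas_def)
  moreover have "cost y' \<le> cost y"
    unfolding cost_def sum using rep y0 by (intro sum_mono mult_right_mono) auto
  ultimately show ?thesis
    using nonneg total by (intro exI[of _ y']) (auto simp: target_def feas_def)
qed

section \<open>Items, their weights and the cutoffs\<close>

definition g :: nat where "g = G + 2"
definition w :: nat where "w = G + \<tau> + 4"
definition norm :: int where "norm = (\<Sum>j<\<tau>. col_norm A c \<tau> G j)"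

definition base :: "nat \<Rightarrow> nat \<Rightarrow> int" where
  "base j = (item_vec A c \<tau> G j)(w - 1 := 2 * norm)"

text \<open>The number \<open>t\<close> encodes a pair: \<open>t div \<tau>\<close> is the position
  of the digit and \<open>t mod \<tau>\<close> the type.\<close>

definition item :: "nat \<Rightarrow> nat \<Rightarrow> int" where
  "item t r = 2 ^ (t div \<tau>) * base (t mod \<tau>) r"

definition cap :: "nat \<Rightarrow> int" where "cap t = 2 ^ (t div \<tau>) * (2 * norm)"

definition v0 :: "nat \<Rightarrow> int" where
  "v0 r = (if r < G then b r else if r = G then S else if r = Suc G then - S else 0)"

lemma col_norm_nonneg: "0 \<le> col_norm A c \<tau> G j"
  by (auto simp: col_norm_def sum_nonneg)

lemma norm_nonneg: "0 \<le> norm"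
  by (auto simp: norm_def col_norm_nonneg sum_nonneg)

lemma cap_nonneg: "0 \<le> cap t"
  using norm_nonneg by (simp add: cap_def)

lemma item_cap: "item t (w - 1) = cap t"
  by (simp add: item_def cap_def base_def)

lemma abs_base: "r < g \<Longrightarrow> \<bar>base j r\<bar> \<le> col_norm A c \<tau> G j"
proof -
  assume r: "r < g"
  have "\<bar>A r j\<bar> \<le> (\<Sum>r<G. \<bar>A r j\<bar>)" if "r < G"
    using that by (intro member_le_sum) auto
  with r show ?thesis
    by (auto simp: base_def item_vec_def col_norm_def g_def w_def sum_nonneg)
qed

lemma sum_levels: "(\<Sum>t<i * \<tau>. f (t div \<tau>) (t mod \<tau>)) = (\<Sum>l<i. \<Sum>j<\<tau>. f l j)"
  for f :: "nat \<Rightarrow> nat \<Rightarrow> int"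
proof -
  have "(\<Sum>t<i * \<tau>. f (t div \<tau>) (t mod \<tau>)) = (\<Sum>l<i. \<Sum>t = l * \<tau>..<l * \<tau> + \<tau>. f (t div \<tau>) (t mod \<tau>))"
    by (rule sum.nat_group[symmetric])
  also have "\<dots> = (\<Sum>l<i. \<Sum>j<\<tau>. f l j)"
  proof (rule sum.cong[OF refl])
    fix l
    have "(\<Sum>t = l * \<tau>..<l * \<tau> + \<tau>. f (t div \<tau>) (t mod \<tau>)) =
        (\<Sum>t = 0 + l * \<tau>..<\<tau> + l * \<tau>. f (t div \<tau>) (t mod \<tau>))"
      by (simp add: add.commute)
    also have "\<dots> = (\<Sum>j = 0..<\<tau>. f ((j + l * \<tau>) div \<tau>) ((j + l * \<tau>) mod \<tau>))"
      by (rule sum.shift_bounds_nat_ivl)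
    also have "\<dots> = (\<Sum>j<\<tau>. f l j)"
      by (rule sum.cong) auto
    finally show "(\<Sum>t = l * \<tau>..<l * \<tau> + \<tau>. f (t div \<tau>) (t mod \<tau>)) = (\<Sum>j<\<tau>. f l j)" .
  qed
  finally show ?thesis .
qed

lemma sum_pow2: "(\<Sum>l<i. 2 ^ l) = (2 ^ i - 1 :: int)"
  by (induction i) auto

text \<open>The undecided items lie on levels up to \<open>t div \<tau>\<close>, and level
  \<open>l\<close> changes a residual by at most \<open>2 ^ l * norm\<close>. Summing the geometric
  series explains the factor 2 in \<open>cap\<close>.\<close>

lemma remaining_le_cap:
  assumes r: "r < g" and u: "\<And>t. u t = 0 \<or> u t = (1::int)"
  shows "\<bar>\<Sum>t'<t. u t' * item t' r\<bar> \<le> cap t"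
proof -
  have tt: "t \<le> Suc (t div \<tau>) * \<tau>"
    using tau_pos by (metis dividend_less_div_times less_imp_le mult_Suc add.commute)
  have "\<bar>\<Sum>t'<t. u t' * item t' r\<bar> \<le> (\<Sum>t'<t. \<bar>u t' * item t' r\<bar>)"
    by (rule sum_abs)
  also have "\<dots> \<le> (\<Sum>t'<t. 2 ^ (t' div \<tau>) * col_norm A c \<tau> G (t' mod \<tau>))"
  proof (rule sum_mono)
    fix t'
    have "\<bar>item t' r\<bar> \<le> 2 ^ (t' div \<tau>) * col_norm A c \<tau> G (t' mod \<tau>)"
      using abs_base[OF r] by (simp add: item_def abs_mult)
    then show "\<bar>u t' * item t' r\<bar> \<le> 2 ^ (t' div \<tau>) * col_norm A c \<tau> G (t' mod \<tau>)"
      using u[of t'] col_norm_nonneg by auto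
  qed
  \<comment> \<open>Filling up the current level makes the sum split into complete levels.\<close>
  also have "\<dots> \<le> (\<Sum>t'<Suc (t div \<tau>) * \<tau>. 2 ^ (t' div \<tau>) * col_norm A c \<tau> G (t' mod \<tau>))"
    using tt col_norm_nonneg by (intro sum_mono2) auto
  also have "\<dots> = (\<Sum>l<Suc (t div \<tau>). \<Sum>j<\<tau>. 2 ^ l * col_norm A c \<tau> G j)"
    by (rule sum_levels)
  also have "\<dots> = (2 ^ Suc (t div \<tau>) - 1) * norm"
    unfolding norm_def sum_pow2[symmetric] sum_product ..
  also have "\<dots> \<le> cap t"
    using norm_nonneg by (simp add: cap_def algebra_simps)
  finally show ?thesis .
qed

section \<open>Binary digits of a solution\<close>

lemma bits_sum:
  fixes y :: int
  assumes "0 \<le> y"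
  shows "(\<Sum>l<i. 2 ^ l * (y div 2 ^ l mod 2)) = y mod 2 ^ i"
proof (induction i)
  case (Suc i)
  have "y mod 2 ^ Suc i = 2 ^ i * (y div 2 ^ i mod 2) + y mod 2 ^ i"
    by (metis mult.commute power_Suc2 zmod_zmult2_eq zero_le_numeral zero_le_power)
  with Suc show ?case by simp
qed simp

definition bit :: "(nat \<Rightarrow> int) \<Rightarrow> nat \<Rightarrow> int" where
  "bit y t = y (t mod \<tau>) div 2 ^ (t div \<tau>) mod 2"

lemma bit_01: "bit y t = 0 \<or> bit y t = 1"
  by (auto simp: bit_def)

text \<open>Adding the items selected by the digits of \<open>y\<close> reassembles each
  \<open>y j\<close>, in every component simultaneously.\<close>

lemma bit_total:
  assumes "\<And>j. j < \<tau> \<Longrightarrow> 0 \<le> y j \<and> y j < 2 ^ L"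
  shows "(\<Sum>t<L * \<tau>. bit y t * item t r) = (\<Sum>j<\<tau>. y j * base j r)"
proof -
  have "(\<Sum>t<L * \<tau>. bit y t * item t r) = (\<Sum>l<L. \<Sum>j<\<tau>. y j div 2 ^ l mod 2 * (2 ^ l * base j r))"
    unfolding bit_def item_def by (rule sum_levels)
  also have "\<dots> = (\<Sum>j<\<tau>. \<Sum>l<L. 2 ^ l * (y j div 2 ^ l mod 2) * base j r)"
    by (subst sum.swap) (simp add: algebra_simps)
  also have "\<dots> = (\<Sum>j<\<tau>. y j * base j r)"
    using assms bits_sum by (intro sum.cong) (auto simp flip: sum_distrib_right)
  finally show ?thesis .
qed

text \<open>A residual that was cut off is a multiple of the weight; any other one differs from its initial
  value by a multiple.\<close>

definition resid :: "nat \<Rightarrow> nat \<Rightarrow> int set" where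
  "resid t r = {z. \<bar>z\<bar> \<le> cap t \<and> (2 ^ (t div \<tau>) dvd z \<or> 2 ^ (t div \<tau>) dvd z - v0 r)}"

text \<open>Per key entry there are two residue classes modulo the weight, each with at most
  \<open>4 * norm + 1\<close> members between \<open>- cap\<close> and \<open>cap\<close>.\<close>

definition max_states where "max_states = (2 * (4 * nat norm + 1)) ^ g"

text \<open>On a residue class modulo \<open>m\<close> the quotient \<open>z div m\<close>
  determines \<open>z\<close>, and it lies between \<open>- d\<close> and \<open>d\<close>.\<close>

lemma card_resid_aux:
  fixes m d :: int
  assumes "0 < m" "0 \<le> d"
  shows "finite {z. \<bar>z\<bar> \<le> m * d \<and> m dvd z - a} \<and> card {z. \<bar>z\<bar> \<le> m * d \<and> m dvd z - a} \<le> 2 * nat d + 1"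
proof -
  let ?Z = "{z. \<bar>z\<bar> \<le> m * d \<and> m dvd z - a}"
  have inj: "inj_on (\<lambda>z. z div m) ?Z"
  proof (rule inj_onI)
    fix z z' assume "z \<in> ?Z" "z' \<in> ?Z" and e: "z div m = z' div m"
    then have "m dvd z - a" "m dvd z' - a" by auto
    then have "m dvd (z - a) - (z' - a)" by (rule dvd_diff)
    then have "z mod m = z' mod m" by (simp add: mod_eq_dvd_iff)
    with e show "z = z'" by (metis div_mult_mod_eq)
  qed
  have "(\<lambda>z. z div m) ` ?Z \<subseteq> {- d..d}"
  proof safe
    fix z assume z: "\<bar>z\<bar> \<le> m * d"
    have "(- d * m) div m \<le> z div m" "z div m \<le> (d * m) div m"
      using z assms by (intro zdiv_mono1; auto simp: algebra_simps abs_le_iff)+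
    moreover have "(- d * m) div m = - d" "(d * m) div m = d"
      using assms by (simp_all only: nonzero_mult_div_cancel_right)
    ultimately show "z div m \<in> {- d..d}"
      by auto
  qed
  then show ?thesis
    using inj card_inj_on_le[OF inj, of "{- d..d}"] inj_on_finite[OF inj, of "{- d..d}"] assms by auto
qed

lemma card_resid: "finite (resid t r)" "card (resid t r) \<le> 2 * (4 * nat norm + 1)"
proof -
  let ?m = "2 ^ (t div \<tau>) :: int"
  let ?R = "\<lambda>a. {z. \<bar>z\<bar> \<le> ?m * (2 * norm) \<and> ?m dvd z - a}"
  have e: "resid t r = ?R 0 \<union> ?R (v0 r)"
    by (auto simp: resid_def cap_def)
  have f: "finite (?R a)" "card (?R a) \<le> 4 * nat norm + 1" for a
    using card_resid_aux[of ?m "2 * norm" a] norm_nonneg by (auto simp: nat_mult_distrib)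
  show "finite (resid t r)"
    unfolding e using f(1)[of 0] f(1)[of "v0 r"] by simp
  have "card (resid t r) \<le> card (?R 0) + card (?R (v0 r))"
    unfolding e by (rule card_Un_le)
  also have "\<dots> \<le> (4 * nat norm + 1) + (4 * nat norm + 1)"
    using f(2) by (intro add_mono)
  finally show "card (resid t r) \<le> 2 * (4 * nat norm + 1)"
    by simp
qed

definition keys :: "nat \<Rightarrow> (nat \<Rightarrow> int) set" where
  "keys t = {f. (\<forall>r<g. f r \<in> resid t r) \<and> (\<forall>r\<ge>g. f r = 0)}"

text \<open>Keys vanish from \<open>g\<close> on, so restricting them to the first \<open>g\<close>
  entries is injective and embeds them into a finite product.\<close>

lemma card_keys: "finite (keys t) \<and> card (keys t) \<le> max_states"
proof -
  let ?P = "PiE {..<g} (resid t)"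
  have inj: "inj_on (\<lambda>f. restrict f {..<g}) (keys t)"
  proof (rule inj_onI)
    fix f f' assume "f \<in> keys t" "f' \<in> keys t" and e: "restrict f {..<g} = restrict f' {..<g}"
    then show "f = f'"
      by (intro ext) (metis (mono_tags, lifting) keys_def lessThan_iff mem_Collect_eq not_less restrict_apply)
  qed
  have sub: "(\<lambda>f. restrict f {..<g}) ` keys t \<subseteq> ?P"
    by (auto simp: keys_def PiE_def extensional_def split: if_splits)
  have "finite ?P"
    using card_resid by (intro finite_PiE) auto
  moreover have "card ?P \<le> max_states"
  proof -
    have "card ?P = (\<Prod>r<g. card (resid t r))"
      by (simp add: card_PiE)
    also have "\<dots> \<le> (\<Prod>r<g. 2 * (4 * nat norm + 1))"
      using card_resid by (intro prod_mono) auto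
    finally show ?thesis by (simp add: max_states_def)
  qed
  ultimately show ?thesis
    using inj sub card_inj_on_le[OF inj sub] inj_on_finite[OF inj sub] by auto
qed

text \<open>Cutting off only decreases residuals, hence inequalities instead of equations.\<close>

definition sound :: "(nat \<Rightarrow> int) \<Rightarrow> bool" where
  "sound e \<longleftrightarrow> (\<forall>j<\<tau>. 0 \<le> e (g + 1 + j)) \<and> e g = (\<Sum>j<\<tau>. c j * e (g + 1 + j)) \<and>
     (\<forall>r<G. e r + (\<Sum>j<\<tau>. A r j * e (g + 1 + j)) \<le> b r) \<and>
     e G + (\<Sum>j<\<tau>. e (g + 1 + j)) \<le> S \<and> e (G + 1) - (\<Sum>j<\<tau>. e (g + 1 + j)) \<le> - S"

text \<open>The first half says that stored vectors describe genuine partial solutions with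
  residuals in the two admissible residue classes. The second half is completeness: for each target
  \<open>y\<close> some stored vector can be completed by the low digits of \<open>y\<close>, at no
  more than the cost of \<open>y\<close>. That vector need not contain the high digits of
  \<open>y\<close>; an equally good replacement is enough.\<close>

definition invar :: "nat \<Rightarrow> (nat \<Rightarrow> int) set \<Rightarrow> bool" where
  "invar t E \<longleftrightarrow> (\<forall>e\<in>E. sound e \<and> (\<forall>r<g. 2 ^ (t div \<tau>) dvd e r \<or> 2 ^ (t div \<tau>) dvd e r - v0 r)) \<and>
     (\<forall>y. target y \<longrightarrow> (\<exists>e\<in>E. e g + (\<Sum>t'<t. bit y t' * item t' g) \<le> cost y \<and>
        (\<forall>r<g. 0 \<le> e r + (\<Sum>t'<t. bit y t' * item t' r))))"

lemma base_simps:
  assumes "j < \<tau>"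
  shows "base j g = (if kept A c \<tau> G j then c j else 0)"
    and "k < \<tau> \<Longrightarrow> base j (g + 1 + k) = (if kept A c \<tau> G j \<and> k = j then 1 else 0)"
    and "r < G \<Longrightarrow> base j r = (if kept A c \<tau> G j then - A r j else 0)"
    and "base j G = (if kept A c \<tau> G j then - 1 else 0)"
    and "base j (G + 1) = (if kept A c \<tau> G j then 1 else 0)"
  using assms by (auto simp: base_def item_vec_def g_def w_def)

lemma sound_start: "sound v0"
  by (auto simp: sound_def v0_def g_def)

lemma sound_add:
  assumes "sound e" "j < \<tau>" "0 \<le> m"
  shows "sound (\<lambda>r. e r + m * base j r)"
proof -
  \<comment> \<open>The item of a dropped type adds nobody, so the effective increment of
    \<open>x j\<close> is \<open>m'\<close>.\<close>
  define m' where "m' = (if kept A c \<tau> G j then m else 0)"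
  have u: "e (g + 1 + k) + m * base j (g + 1 + k) = e (g + 1 + k) + (if k = j then m' else 0)" if "k < \<tau>" for k
    using base_simps(2)[OF assms(2) that] by (auto simp: m'_def)
  have s: "(\<Sum>k<\<tau>. f k * (e (g + 1 + k) + m * base j (g + 1 + k))) = (\<Sum>k<\<tau>. f k * e (g + 1 + k)) + f j * m'"
    for f :: "nat \<Rightarrow> int"
  proof -
    have "(\<Sum>k<\<tau>. f k * (e (g + 1 + k) + m * base j (g + 1 + k))) =
        (\<Sum>k<\<tau>. f k * e (g + 1 + k) + (if k = j then f k * m' else 0))"
      using u by (intro sum.cong) (auto simp: algebra_simps)
    then show ?thesis
      using assms(2) by (simp add: sum.distrib)
  qed
  have s1: "(\<Sum>k<\<tau>. (e (g + 1 + k) + m * base j (g + 1 + k))) = (\<Sum>k<\<tau>. e (g + 1 + k)) + m'"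
    using s[of "\<lambda>_. 1"] by simp
  show ?thesis
    unfolding sound_def s s1
    using assms(1,3) u base_simps(1,3,4,5)[OF assms(2)] by (auto simp: sound_def algebra_simps m'_def)
qed

lemma sound_capped: "sound e \<Longrightarrow> sound (capped g h e)"
  unfolding sound_def capped_def by (auto simp: g_def min_def)

text \<open>With all digits still open, adding the digits of \<open>y\<close> to \<open>v0\<close>
  gives the residual \<open>b - A y\<close> and the cost of \<open>y\<close> exactly; the two rows
  for the total end at 0.\<close>

lemma invar_start: "invar (L * \<tau>) {v0}"
proof -
  have "v0 g + (\<Sum>t'<L * \<tau>. bit y t' * item t' g) \<le> cost y \<and>
        (\<forall>r<g. 0 \<le> v0 r + (\<Sum>t'<L * \<tau>. bit y t' * item t' r))" if y: "target y" for y
  proof -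
    have y': "\<And>j. j < \<tau> \<Longrightarrow> 0 \<le> y j \<and> y j < 2 ^ L" "\<And>j. j < \<tau> \<Longrightarrow> \<not> kept A c \<tau> G j \<Longrightarrow> y j = 0"
      using y by (auto simp: target_def feas_def)
    have tot: "(\<Sum>t'<L * \<tau>. bit y t' * item t' r) = (\<Sum>j<\<tau>. y j * base j r)" for r
      using y'(1) by (rule bit_total)
    have "(\<Sum>j<\<tau>. y j * base j g) = cost y"
      unfolding cost_def using base_simps(1) y'(2) by (intro sum.cong) auto
    moreover have br: "(\<Sum>j<\<tau>. y j * base j r) = - (\<Sum>j<\<tau>. A r j * y j)" if "r < G" for r
      unfolding sum_negf[symmetric] using base_simps(3)[OF _ that] y'(2) by (intro sum.cong) auto
    moreover have "(\<Sum>j<\<tau>. y j * base j G) = - (\<Sum>j<\<tau>. y j)"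
      unfolding sum_negf[symmetric] using base_simps(4) y'(2) by (intro sum.cong) auto
    moreover have "(\<Sum>j<\<tau>. y j * base j (Suc G)) = (\<Sum>j<\<tau>. y j)"
      using base_simps(5) y'(2) by (intro sum.cong) auto
    moreover have "0 \<le> v0 r + (\<Sum>j<\<tau>. y j * base j r)" if "r < G" for r
      using y that br by (simp add: target_def feas_def v0_def)
    ultimately show ?thesis
      unfolding tot using y by (auto simp: target_def feas_def v0_def[of G] v0_def[of "Suc G"] v0_def[of "Suc (Suc G)"] g_def less_Suc_eq)
  qed
  then show ?thesis
    by (auto simp: invar_def sound_start)
qed

lemma succs_vec:
  assumes "u \<in> succs g (cap t) (item t) E"
  obtains v e where "u = capped g (cap t) v" "valid g (cap t) v" "e \<in> E" "v = e \<or> v = (\<lambda>r. e r + item t r)"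
  using assms by (auto simp: succs_def vadd_def)

text \<open>The weight of item \<open>t\<close> divides the weight at the previous stage, the item
  and the cutoff. So both residue classes are respected, whether the item is added or not; validity
  and the cutoff bound the entries on either side.\<close>

lemma succs_invar:
  assumes I: "invar (Suc t) E" and u: "u \<in> succs g (cap t) (item t) E"
  shows "sound u" "\<And>r. r < g \<Longrightarrow> u r \<in> resid t r"
proof -
  from succs_vec[OF u] obtain v e where v: "u = capped g (cap t) v" "valid g (cap t) v" "e \<in> E"
    "v = e \<or> v = (\<lambda>r. e r + item t r)" .
  have se: "sound e"
    using I v by (auto simp: invar_def)
  then have "sound v"
    using v(4) sound_add[of e "t mod \<tau>" "2 ^ (t div \<tau>)"] tau_pos by (auto simp: item_def)
  then show "sound u"
    unfolding v(1) by (rule sound_capped)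
  fix r assume r: "r < g"
  let ?m = "2 ^ (t div \<tau>) :: int"
  have "?m dvd 2 ^ (Suc t div \<tau>)"
    by (intro le_imp_power_dvd div_le_mono) simp
  moreover have "2 ^ (Suc t div \<tau>) dvd e r \<or> 2 ^ (Suc t div \<tau>) dvd e r - v0 r"
    using I v(3) r by (auto simp: invar_def)
  ultimately have e: "?m dvd e r \<or> ?m dvd e r - v0 r"
    using dvd_trans by blast
  have i: "?m dvd item t r"
    by (simp add: item_def)
  have "?m dvd v r \<or> ?m dvd v r - v0 r"
    using v(4)
  proof
    assume "v = (\<lambda>r. e r + item t r)"
    moreover have "e r + item t r - v0 r = (e r - v0 r) + item t r" by simp
    ultimately show ?thesis using e i by (metis dvd_add)
  qed (use e in simp)
  moreover have "?m dvd cap t"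
    by (simp add: cap_def)
  moreover have "- cap t \<le> v r"
    using v(2) r by (auto simp: valid_def)
  ultimately show "u r \<in> resid t r"
    using r cap_nonneg[of t] by (auto simp: v(1) capped_def resid_def min_def)
qed

lemma succs_keys:
  assumes "invar (Suc t) E"
  shows "key g ` succs g (cap t) (item t) E \<subseteq> keys t"
  using succs_invar(2)[OF assms] by (auto simp: keys_def key_def)

text \<open>Follow the digit \<open>t\<close> of a target \<open>y\<close>. The lower digits of
  \<open>y\<close> contribute at most \<open>cap t\<close> in absolute value, so a residual that
  they lead to a nonnegative value is at least \<open>- cap t\<close> and the vector is not
  discarded. The dominating vector that is kept instead has the same residuals and no larger
  cost.\<close>

lemma invar_step:
  assumes I: "invar (Suc t) E" and sub: "E' \<subseteq> succs g (cap t) (item t) E"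
    and cov: "\<forall>u \<in> succs g (cap t) (item t) E. covers g E' u"
  shows "invar t E'"
  unfolding invar_def
proof (intro conjI ballI allI impI)
  fix e assume "e \<in> E'"
  then have e: "e \<in> succs g (cap t) (item t) E" using sub by blast
  show "sound e" using succs_invar(1)[OF I e] .
  show "2 ^ (t div \<tau>) dvd e r \<or> 2 ^ (t div \<tau>) dvd e r - v0 r" if "r < g" for r
    using succs_invar(2)[OF I e that] by (auto simp: resid_def)
next
  fix y assume y: "target y"
  define R where "R r = (\<Sum>t'<t. bit y t' * item t' r)" for r
  from I y obtain e where e: "e \<in> E" "e g + (R g + bit y t * item t g) \<le> cost y"
      "\<And>r. r < g \<Longrightarrow> 0 \<le> e r + (R r + bit y t * item t r)"
    by (auto simp: invar_def R_def)
  define v where "v = (if bit y t = 0 then e else vadd e (item t))"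
  have v: "v r = e r + bit y t * item t r" for r
    using bit_01[of y t] by (auto simp: v_def vadd_def)
  have R: "\<bar>R r\<bar> \<le> cap t" if "r < g" for r
    unfolding R_def by (rule remaining_le_cap[OF that]) (rule bit_01)
  have val: "valid g (cap t) v"
    unfolding valid_def
  proof (intro allI impI)
    fix r assume "r < g"
    then show "- cap t \<le> v r" using e(3)[of r] R[of r] by (auto simp: v)
  qed
  then have "capped g (cap t) v \<in> succs g (cap t) (item t) E"
  proof -
    have "v = e \<or> v = vadd e (item t)" by (simp add: v_def)
    with e(1) val show ?thesis unfolding succs_def by blast
  qed
  with cov obtain e' where e': "e' \<in> E'" "key g e' = key g (capped g (cap t) v)" "e' g \<le> v g"
    by (auto simp: covers_def capped_def)
  \<comment> \<open>An entry that was cut equals the cutoff, which outweighs anything the lower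
    digits can subtract.\<close>
  have "0 \<le> e' r + R r" if "r < g" for r
    using e'(2) that e(3)[OF that] R[OF that] by (auto simp: key_eq_iff capped_def v)
  with e' e(2) show "\<exists>e\<in>E'. e g + (\<Sum>t'<t. bit y t' * item t' g) \<le> cost y \<and>
        (\<forall>r<g. 0 \<le> e r + (\<Sum>t'<t. bit y t' * item t' r))"
    by (intro bexI[of _ e']) (auto simp: R_def v)
qed

text \<open>When no digit is left, a nonnegative residual together with the inequalities of
  \<open>sound\<close> yields the constraints; the two rows for the total combine to the equation.
  Conversely \<open>exists_target\<close> reduces any feasible point to a target, which completeness
  covers.\<close>

lemma sols_final:
  assumes I: "invar 0 E"
  shows "(\<beta>, x) \<in> sols g E \<Longrightarrow> feas x \<and> \<beta> = cost x"
    and "feas y \<Longrightarrow> \<exists>(\<beta>, x) \<in> sols g E. \<beta> \<le> cost y"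
proof -
  assume "(\<beta>, x) \<in> sols g E"
  then obtain e where e: "e \<in> E" "\<forall>r<g. 0 \<le> e r" "\<beta> = e g" "x = (\<lambda>j. e (g + 1 + j))"
    by (auto simp: sols_def)
  have s: "sound e" using I e(1) by (auto simp: invar_def)
  have "0 \<le> e G" "0 \<le> e (G + 1)" "\<And>r. r < G \<Longrightarrow> 0 \<le> e r" using e(2) by (auto simp: g_def)
  then show "feas x \<and> \<beta> = cost x"
    using s unfolding sound_def feas_def cost_def e(3,4) by fastforce
next
  assume "feas y"
  then obtain y' where y': "target y'" "cost y' \<le> cost y" using exists_target by blast
  with I obtain e where "e \<in> E" "e g \<le> cost y'" "\<forall>r<g. 0 \<le> e r"
    by (auto simp: invar_def)
  with y'(2) show "\<exists>(\<beta>, x) \<in> sols g E. \<beta> \<le> cost y"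
    by (auto simp: sols_def)
qed

end

section \<open>One disjunct\<close>

lemma mods_Disjunct [simp]:
  "mods Disjunct = {ROWS, PTR, KEYS, WIDTH} \<union> mods Base_Items \<union> mods Double_Items \<union> mods Start \<union>
     mods Process \<union> mods Extract \<union> {vK}"
  by (auto simp: Disjunct_def)

text \<open>As an equation between predicates it also rewrites below an abstraction, which is needed
  to reassociate nested sequences.\<close>

lemma wp_Seq_fun: "wp (Seq p q) Q = wp p (\<lambda>t. wp q (\<lambda>u. Q (t + u)))"
  by (rule ext) (rule wp_Seq)

context move_ip
begin

text \<open>The cube comes from setting up the items and the square from the linear search in each
  of up to \<open>max_states\<close> expansions. The product dominates every phase.\<close>

definition disjunct_time :: nat where
  "disjunct_time = 10000 * (L + 1) * (w + 1) ^ 3 * (max_states + 3)\<^sup>2"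

lemma max_states_pos: "1 \<le> max_states"
  by (simp add: max_states_def)

lemma disjunct_time:
  assumes "t1 \<le> 1000 * (w + 1) * (w + 1) * (w + 1)" "t2 \<le> L * (\<tau> * w * 60 + 60) + 20" "t3 \<le> 80 * (w + 1)"
    "t4 \<le> L * \<tau> * (700 * (max_states + 3) * (max_states + 3) * (w + 1) + 30) + 9" "t5 \<le> 200 * (m + 1) * (w + 1)" "m \<le> max_states"
    "t6 \<le> G * 40 + 9"
  shows "50 + t1 + t2 + t3 + t4 + t5 + t6 \<le> disjunct_time"
proof -
  define a q :: nat where "a = (L + 1) * ((w + 1) * ((w + 1) * (w + 1)))" and "q = (max_states + 3) * (max_states + 3)"
  define W where "W = w + 1"
  have W: "1 \<le> W" "\<tau> \<le> W" "G \<le> W" "w \<le> W"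
    by (auto simp: W_def w_def)
  have WW: "1 \<le> W * W" "W \<le> W * W" "W * W \<le> W * (W * W)"
    using W(1) by (simp_all add: le_square)
  have WWW: "1 \<le> W * (W * W)" "W \<le> W * (W * W)"
    using WW by linarith+
  have LW: "W * (W * W) \<le> a" "L * (W * (W * W)) \<le> a"
    by (simp_all add: a_def W_def)
  have q: "9 \<le> q" "max_states + 3 \<le> q"
    by (simp_all add: q_def algebra_simps)
  have aq: "a * x \<le> a * q" if "x \<le> q" for x
    using that by simp
  have a1: "a \<le> a * q"
    using q by simp
  have t1: "t1 \<le> 1000 * (a * q)"
  proof -
    have "t1 \<le> 1000 * (W * (W * W))" using assms(1) unfolding W_def mult.assoc .
    also have "\<dots> \<le> 1000 * (a * q)" using LW a1 by (intro mult_le_mono2) linarith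
    finally show ?thesis .
  qed
  have t2: "t2 \<le> 140 * (a * q)"
  proof -
    have "\<tau> * w * 60 \<le> (W * W) * 60" using W by (intro mult_le_mono) auto
    then have "L * (\<tau> * w * 60 + 60) \<le> L * ((W * (W * W)) * 120)"
      using WW WWW by (intro mult_le_mono2) linarith
    also have "\<dots> \<le> 120 * a" using LW(2) by (simp add: mult.assoc[symmetric])
    finally have "t2 \<le> 120 * a + 20" using assms(2) by linarith
    moreover have "1 \<le> a" using LW WWW by linarith
    ultimately show ?thesis using a1 by linarith
  qed
  have t3: "t3 \<le> 80 * (a * q)"
    using assms(3) LW WWW a1 unfolding W_def[symmetric] by linarith
  have t4: "t4 \<le> 800 * (a * q)"
  proof -
    have "700 * (max_states + 3) * (max_states + 3) * (w + 1) + 30 \<le> 730 * (q * W)"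
    proof -
      have "1 * 1 \<le> q * W" using q W by (intro mult_le_mono) auto
      moreover have "700 * (max_states + 3) * (max_states + 3) * (w + 1) = 700 * (q * W)"
        by (simp only: q_def W_def mult.assoc)
      ultimately show ?thesis by linarith
    qed
    then have "L * \<tau> * (700 * (max_states + 3) * (max_states + 3) * (w + 1) + 30) \<le> L * (W * W) * (730 * (q * W))"
      using order_trans[OF W(2) WW(2)] by (intro mult_le_mono) auto
    also have "\<dots> = 730 * ((L * (W * (W * W))) * q)" by simp
    also have "\<dots> \<le> 730 * (a * q)" using LW by (intro mult_le_mono) auto
    finally have "t4 \<le> 730 * (a * q) + 9" using assms(4) by linarith
    moreover have "1 \<le> a * q" using LW WWW a1 by linarith
    ultimately show ?thesis by linarith
  qed
  have t5: "t5 \<le> 200 * (a * q)"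
  proof -
    have "(m + 1) * (w + 1) \<le> q * a"
      using assms(6) q LW WWW by (intro mult_le_mono) (auto simp: W_def)
    then have "200 * ((m + 1) * (w + 1)) \<le> 200 * (a * q)" by (simp add: mult.commute)
    with assms(5) show ?thesis unfolding mult.assoc by (rule order_trans)
  qed
  have t6: "t6 \<le> 60 * (a * q)"
    using assms(7) W LW WWW a1 by linarith
  have "50 \<le> 50 * (a * q)" using LW WWW a1 by linarith
  then have "50 + t1 + t2 + t3 + t4 + t5 + t6 \<le> 10000 * (a * q)"
    using t1 t2 t3 t4 t5 t6 by linarith
  also have "\<dots> = disjunct_time"
    by (simp only: disjunct_time_def a_def q_def power3_eq_cube power2_eq_square mult.assoc)
  finally show ?thesis .
qed

lemma Disjunct_spec:
  assumes st: "\<sigma> TAU 0 = int \<tau>" "\<sigma> PTR 0 = p" "\<sigma> LEV 0 = int L" "\<sigma> TOTAL 0 = S" "\<sigma> IN p = int G"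
    and A: "A = matrix_at \<sigma> \<tau> (p + 1)" and c: "c = price_at \<sigma> \<tau>"
    and b: "\<And>r. r < G \<Longrightarrow> b r = \<sigma> IN (p + 1 + int (r * (\<tau> + 1) + \<tau>))"
    and best: "is_best \<sigma> \<tau> X"
  shows "wp Disjunct (\<lambda>t \<rho>. t \<le> disjunct_time \<and> \<rho> PTR 0 = p + 1 + int (G * (\<tau> + 1)) \<and>
      (\<exists>X'. is_best \<rho> \<tau> (X \<union> X') \<and> (\<forall>(\<beta>, x) \<in> X'. feas x \<and> \<beta> = cost x) \<and>
        (\<forall>y. feas y \<longrightarrow> (\<exists>(\<beta>, x) \<in> X'. \<beta> \<le> cost y))) \<and>
      (\<forall>x. x \<notin> mods Disjunct \<longrightarrow> \<rho> x = \<sigma> x)) \<sigma>"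
proof -
  define \<sigma>0 where "\<sigma>0 = \<sigma>(ROWS := (\<sigma> ROWS)(0 := int G), PTR := (\<sigma> PTR)(0 := p + 1),
     KEYS := (\<sigma> KEYS)(0 := int G + 2), WIDTH := (\<sigma> WIDTH)(0 := int w))"
  have s0: "\<sigma>0 x = \<sigma> x" if "x \<notin> {ROWS, PTR, KEYS, WIDTH}" for x
    using that by (auto simp: \<sigma>0_def)
  have s0': "\<sigma>0 ROWS 0 = int G" "\<sigma>0 PTR 0 = p + 1" "\<sigma>0 KEYS 0 = int g" "\<sigma>0 WIDTH 0 = int w"
    by (auto simp: \<sigma>0_def g_def)
  have init: "wp (ROWS ::= V IN (cell PTR) ;; inc PTR (N 1) ;; KEYS ::= Plus (cell ROWS) (N 2) ;;
      WIDTH ::= Plus (cell KEYS) (Plus (cell TAU) (N 2))) (\<lambda>t \<rho>. t \<le> 40 \<and> \<rho> = \<sigma>0) \<sigma>"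
    using st by (simp add: \<sigma>0_def w_def algebra_simps)
  have As0: "A = matrix_at \<sigma>0 \<tau> (p + 1)" "c = price_at \<sigma>0 \<tau>"
    using s0[of IN] by (simp_all add: A c matrix_at_def price_at_def fun_eq_iff)
  have gw: "g < w" "g + \<tau> + 1 \<le> w" "G + 2 < w" "w = G + \<tau> + 4" using tau_pos by (auto simp: g_def w_def)
  \<comment> \<open>The reserved 50 steps pay for the initial assignments.\<close>
  have body: "wp (Seq Base_Items (Seq Double_Items (Seq Start (Seq Process (Seq Extract
      (For vK ROWS (inc PTR (Plus (cell TAU) (N 1)))))))))
      (\<lambda>t \<rho>. 50 + t \<le> disjunct_time \<and> \<rho> PTR 0 = p + 1 + int (G * (\<tau> + 1)) \<and>
      (\<exists>X'. is_best \<rho> \<tau> (X \<union> X') \<and> (\<forall>(\<beta>, x) \<in> X'. feas x \<and> \<beta> = cost x) \<and>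
        (\<forall>y. feas y \<longrightarrow> (\<exists>(\<beta>, x) \<in> X'. \<beta> \<le> cost y)))) \<sigma>0"
    unfolding wp_Seq[of Base_Items]
  proof (rule wp_mono[OF Base_Items_spec[where \<tau> = \<tau> and G = G and p = "p + 1" and w = w and A = A and c = c and M = norm]],
      goal_cases)
    case 9
    show ?case by (rule norm_def)
  next
    case (10 t1 \<sigma>1)
    then have s1: "\<sigma>1 x = \<sigma>0 x" if "x \<notin> {NORM, IB, vJ, KEPT, vK, EQ, RP, vR, ITEM, BLOCK}" for x
      using that by auto
    have base1: "row \<sigma>1 ITEM w j = base j" if "j < \<tau>" for j
      using 10 that by (simp add: base_def)
    show ?case
      unfolding wp_Seq[of Double_Items]
    proof (rule wp_mono[OF Double_Items_spec[where b = "\<tau> * w" and L = L and \<tau> = \<tau>]], goal_cases)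
      case (4 t2 \<sigma>2)
      then have s2: "\<sigma>2 x = \<sigma>1 x" if "x \<notin> {SRC, NITEMS, vI, vA, ITEM}" for x
        using that by auto
      \<comment> \<open>A block consists of \<tau> rows of width \<open>w\<close>, so item
        \<open>i * \<tau> + j\<close> is row \<open>j\<close> of block \<open>i\<close>, that is,
        \<open>2 ^ i\<close> times a base item.\<close>
      have item2: "row \<sigma>2 ITEM w t = item t" if t: "t < L * \<tau>" for t
      proof
        fix r
        define i j where "i = t div \<tau>" and "j = t mod \<tau>"
        have ij: "i < L" "j < \<tau>" "t = i * \<tau> + j"
          using t tau_pos by (auto simp: i_def j_def less_mult_imp_div_less)
        show "row \<sigma>2 ITEM w t r = item t r"
        proof (cases "r < w")
          case True
          have "j * w + r < \<tau> * w"
            using ij(2) True by (metis add_less_cancel_left less_le_trans mult.commute mult_Suc_right mult_le_mono1 Suc_leI add.commute)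
          then have "\<sigma>2 ITEM (int (i * (\<tau> * w) + (j * w + r))) = 2 ^ i * \<sigma>1 ITEM (int (j * w + r))"
            using 4 ij(1) by (meson less_imp_le)
          moreover have "\<sigma>1 ITEM (int (j * w + r)) = base j r"
            using base1[OF ij(2)] True by (auto simp: row_def fun_eq_iff split: if_splits)
          moreover have "t * w + r = i * (\<tau> * w) + (j * w + r)"
            by (simp add: ij(3) algebra_simps)
          ultimately show ?thesis
            using True by (simp add: row_def item_def i_def[symmetric] j_def[symmetric] add.assoc del: of_nat_add of_nat_mult)
        next
          case False
          have "row \<sigma>1 ITEM w j r = base j r" using base1[OF ij(2)] by simp
          then have "base j r = 0" using False by (simp add: row_def)
          then show ?thesis using False by (simp add: row_def item_def j_def)
        qed
      qed
      show ?case
        unfolding wp_Seq[of Start]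
      proof (rule wp_mono[OF Start_spec[where w = w and G = G and \<tau> = \<tau> and p = "p + 1"]], goal_cases)
        case (6 t3 \<sigma>3)
        then have s3: "\<sigma>3 x = \<sigma>2 x" if "x \<notin> {vR, CUR, RP, vK, CCNT}" for x
          using that by auto
        have "start_vec \<sigma>2 (p + 1) \<tau> G = v0"
          using s2 s1 s0 st b by (auto simp: start_vec_def v0_def fun_eq_iff algebra_simps)
        then have v03: "rows \<sigma>3 CUR w 1 = {v0}" using 6 by simp
        have item3: "row \<sigma>3 ITEM w t = item t" if "t < L * \<tau>" for t
          using item2[OF that] s3[of ITEM] row_cong[of \<sigma>3 ITEM \<sigma>2 w t] by simp
        show ?case
          unfolding wp_Seq[of Process]
        proof (rule wp_mono[OF Process_spec[where g = g and w = w and n = "L * \<tau>" and M = max_states and I = invar and KS = keys]],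
            goal_cases)
          case 8
          then show ?case using invar_start v03 by simp
        next
          case (9 t E E')
          then show ?case using invar_step[of t E E'] item3 by (simp add: item_cap[simplified])
        next
          case (10 t E)
          then show ?case using succs_keys[of t E] item3 by (simp add: item_cap[simplified])
        next
          case (11 t)
          then show ?case using card_keys by blast
        next
          case (13 t4 \<sigma>4)
          then have s4: "\<sigma>4 x = \<sigma>3 x" if "x \<notin> mods Process" for x
            using that by auto
          from 13 obtain m where m: "m \<le> max_states" "\<sigma>4 CCNT 0 = int m" "invar 0 (rows \<sigma>4 CUR w m)" by blast
          have best4: "is_best \<sigma>4 \<tau> X"
            using best s0 s1 s2 s3 s4 by (subst is_best_cong[of _ \<sigma>]) auto
          show ?case
            unfolding wp_Seq[of Extract]
          proof (rule wp_mono[OF Extract_spec[where g = g and w = w and n = m and \<tau> = \<tau> and X = X]], goal_cases)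
            case (7 t5 \<sigma>5)
            then have s5: "\<sigma>5 x = \<sigma>4 x" if "x \<notin> {CB, vK, VALID, vR, FOUND, BEST, vJ, SOL}" for x
              using that by auto
            define X' where "X' = sols g (rows \<sigma>4 CUR w m)"
            have best5: "is_best \<sigma>5 \<tau> (X \<union> X')"
              using 7 by (simp add: X'_def)
            have X': "\<forall>(\<beta>, x) \<in> X'. feas x \<and> \<beta> = cost x" "\<forall>y. feas y \<longrightarrow> (\<exists>(\<beta>, x) \<in> X'. \<beta> \<le> cost y)"
              using sols_final[OF m(3)] unfolding X'_def by blast+
            have eq5: "\<sigma>5 ROWS 0 = int G" "\<sigma>5 PTR 0 = p + 1" "\<sigma>5 TAU 0 = int \<tau>"
              using s0 s1 s2 s3 s4 s5 s0' st by auto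
            show ?case
            proof (rule wp_For[where n = G and T = 20 and I = "\<lambda>k \<rho>. \<rho> PTR 0 = p + 1 + int (k * (\<tau> + 1))"], goal_cases)
              case (6 k \<rho>)
              then show ?case using eq5 by (simp add: algebra_simps)
            next
              case (7 t6 \<rho>)
              have "50 + t1 + t2 + t3 + t4 + t5 + t6 \<le> disjunct_time"
                using 7(1) \<open>t5 \<le> _ \<and> _\<close> \<open>t4 \<le> _ \<and> _\<close> \<open>t3 \<le> _ \<and> _\<close> \<open>t2 \<le> _ \<and> _\<close> \<open>t1 \<le> _ \<and> _\<close> m(1)
                by (intro disjunct_time[where m = m]) auto
              moreover have "is_best \<rho> \<tau> (X \<union> X')"
                using best5 7 by (subst is_best_cong[of _ \<sigma>5]) auto
              ultimately show ?case
                using 7(3) X' by (intro conjI exI[of _ X']) (simp_all add: add.assoc)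
            qed (use eq5 in auto)
          qed (use s0 s1 s2 s3 s4 s0' st m best4 gw in auto)
        qed (use s0 s1 s2 s3 s0' st 6 4 gw(1-3) item3 max_states_pos in \<open>auto simp: item_cap[simplified] cap_nonneg\<close>)
      qed (use s0 s1 s2 s0' st gw in auto)
    qed (use s0 s1 s0' st 10 in auto)
  qed (use s0 s0' st gw(4) As0 in \<open>simp_all add: g_def\<close>)
  show ?thesis
  proof (rule wp_frame)
    show "wp Disjunct (\<lambda>t \<rho>. t \<le> disjunct_time \<and> \<rho> PTR 0 = p + 1 + int (G * (\<tau> + 1)) \<and>
      (\<exists>X'. is_best \<rho> \<tau> (X \<union> X') \<and> (\<forall>(\<beta>, x) \<in> X'. feas x \<and> \<beta> = cost x) \<and>
        (\<forall>y. feas y \<longrightarrow> (\<exists>(\<beta>, x) \<in> X'. \<beta> \<le> cost y)))) \<sigma>"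
    proof -
      have "wp (Seq (ROWS ::= V IN (cell PTR) ;; inc PTR (N 1) ;; KEYS ::= Plus (cell ROWS) (N 2) ;;
        WIDTH ::= Plus (cell KEYS) (Plus (cell TAU) (N 2))) (Seq Base_Items (Seq Double_Items (Seq Start (Seq Process (Seq Extract
        (For vK ROWS (inc PTR (Plus (cell TAU) (N 1)))))))))) (\<lambda>t \<rho>. t \<le> disjunct_time \<and> \<rho> PTR 0 = p + 1 + int (G * (\<tau> + 1)) \<and>
        (\<exists>X'. is_best \<rho> \<tau> (X \<union> X') \<and> (\<forall>(\<beta>, x) \<in> X'. feas x \<and> \<beta> = cost x) \<and>
          (\<forall>y. feas y \<longrightarrow> (\<exists>(\<beta>, x) \<in> X'. \<beta> \<le> cost y)))) \<sigma>"
        unfolding wp_Seq[of "Seq (Assign _ _ _) _"]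
      proof (rule wp_mono[OF init], goal_cases)
        case (1 t \<rho>)
        then show ?case
          using body by (auto elim!: wp_mono)
      qed
      then show ?thesis
        by (simp only: Disjunct_def wp_Seq_fun add.assoc)
    qed
  qed blast
qed

end

section \<open>Bounding the number of partial solutions\<close>

text \<open>Two kept types with the same column would exclude each other, so kept types inject into
  the columns with \<open>G\<close> entries between \<open>- \<alpha>\<close> and \<alpha>.\<close>

lemma (in move_ip) card_kept:
  assumes "\<And>r j. r < G \<Longrightarrow> j < \<tau> \<Longrightarrow> \<bar>A r j\<bar> \<le> int \<alpha>"
  shows "card {j. j < \<tau> \<and> kept A c \<tau> G j} \<le> (2 * \<alpha> + 1) ^ G"
proof -
  let ?K = "{j. j < \<tau> \<and> kept A c \<tau> G j}"
  let ?P = "PiE {..<G} (\<lambda>_. {- int \<alpha>..int \<alpha>})"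
  let ?f = "\<lambda>j. restrict (\<lambda>r. A r j) {..<G}"
  have inj: "inj_on ?f ?K"
  proof (rule inj_onI)
    fix j k assume jk: "j \<in> ?K" "k \<in> ?K" "?f j = ?f k"
    have "A r j = A r k" if "r < G" for r
      using fun_cong[OF jk(3), of r] that by simp
    then have col: "\<forall>r<G. A r j = A r k" "\<forall>r<G. A r k = A r j"
      by simp_all
    have "kept A c \<tau> G j" "kept A c \<tau> G k" "j < \<tau>" "k < \<tau>"
      using jk(1,2) by auto
    then have "\<not> (c k < c j \<or> c k = c j \<and> k < j)" "\<not> (c j < c k \<or> c j = c k \<and> j < k)"
      using col unfolding kept_def by blast+
    then show "j = k" by linarith
  qed
  have "?f ` ?K \<subseteq> ?P"
  proof (intro image_subsetI)
    fix j assume "j \<in> ?K"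
    then have "- int \<alpha> \<le> A r j \<and> A r j \<le> int \<alpha>" if "r < G" for r
      using assms[OF that, of j] by auto
    then show "?f j \<in> ?P" by (intro restrict_PiE_iff[THEN iffD2]) auto
  qed
  then have "card ?K \<le> card ?P"
    using inj by (intro card_inj_on_le) (simp_all add: finite_PiE)
  also have "card ?P = (2 * \<alpha> + 1) ^ G"
    by (simp add: card_PiE nat_add_distrib nat_mult_distrib)
  finally show ?thesis .
qed

lemma (in move_ip) norm_bound:
  assumes A: "\<And>r j. r < G \<Longrightarrow> j < \<tau> \<Longrightarrow> \<bar>A r j\<bar> \<le> int \<alpha>"
  shows "nat norm \<le> (2 * \<alpha> + 1) ^ G * (2 + G * \<alpha>)"
proof -
  have "norm \<le> (\<Sum>j<\<tau>. if kept A c \<tau> G j then 2 + int G * int \<alpha> else 0)"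
    unfolding norm_def
  proof (rule sum_mono)
    fix j assume "j \<in> {..<\<tau>}"
    then have "(\<Sum>r<G. \<bar>A r j\<bar>) \<le> (\<Sum>r<G. int \<alpha>)"
      using A by (intro sum_mono) auto
    then show "col_norm A c \<tau> G j \<le> (if kept A c \<tau> G j then 2 + int G * int \<alpha> else 0)"
      by (simp add: col_norm_def)
  qed
  also have "\<dots> = int (card {j. j < \<tau> \<and> kept A c \<tau> G j} * (2 + G * \<alpha>))"
    by (simp add: sum.If_cases lessThan_def Collect_conj_eq algebra_simps)
  finally have "nat norm \<le> card {j. j < \<tau> \<and> kept A c \<tau> G j} * (2 + G * \<alpha>)"
    by (simp only: nat_le_iff)
  also have "\<dots> \<le> (2 * \<alpha> + 1) ^ G * (2 + G * \<alpha>)"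
    using card_kept[OF A] by (intro mult_le_mono1)
  finally show ?thesis .
qed

text \<open>This is \<open>max_states\<close> with \<open>norm\<close> replaced by its bound from
  \<open>norm_bound\<close> and with \<gamma> in place of the number of rows; neither \<tau> nor the
  right-hand sides remain.\<close>

definition states_bound :: "nat \<Rightarrow> nat \<Rightarrow> nat" where
  "states_bound \<gamma> \<alpha> = (2 * (4 * ((2 * \<alpha> + 1) ^ \<gamma> * (2 + \<gamma> * \<alpha>)) + 1)) ^ (\<gamma> + 2)"

lemma (in move_ip) disjunct_time_bound:
  assumes A: "\<And>r j. r < G \<Longrightarrow> j < \<tau> \<Longrightarrow> \<bar>A r j\<bar> \<le> int \<alpha>" and G: "G \<le> \<gamma>"
  shows "disjunct_time \<le> 10000 * (L + 1) * (\<tau> + \<gamma> + 5) ^ 3 * (states_bound \<gamma> \<alpha> + 3)\<^sup>2"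
proof -
  have "(2 * \<alpha> + 1) ^ G * (2 + G * \<alpha>) \<le> (2 * \<alpha> + 1) ^ \<gamma> * (2 + \<gamma> * \<alpha>)"
    using G by (intro mult_le_mono power_increasing add_mono) auto
  then have n: "nat norm \<le> (2 * \<alpha> + 1) ^ \<gamma> * (2 + \<gamma> * \<alpha>)"
    using norm_bound[OF A] by (meson order_trans)
  have "max_states \<le> (2 * (4 * ((2 * \<alpha> + 1) ^ \<gamma> * (2 + \<gamma> * \<alpha>)) + 1)) ^ g"
    unfolding max_states_def by (rule power_mono, rule mult_le_mono2, rule add_mono, rule mult_le_mono2, rule n) simp_all
  also have "\<dots> \<le> states_bound \<gamma> \<alpha>"
    unfolding states_bound_def g_def using G by (rule power_increasing[OF add_mono]) simp_all
  finally have "max_states \<le> states_bound \<gamma> \<alpha>" .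
  then show ?thesis
    unfolding disjunct_time_def w_def using G
    by (intro mult_le_mono power_mono) auto
qed

section \<open>The whole program\<close>

lemma mods_Levels [simp]: "mods Levels = {TOTAL, vI, PW, LEV}"
  by (auto simp: Levels_def)

text \<open>Doubling stops at the least \<open>L\<close> with the total below \<open>2 ^ L\<close>.
  The free exponent \<open>e\<close>, later the encoding length of \<open>s\<close>, bounds this
  \<open>L\<close> without any reference to logarithms.\<close>

lemma Levels_spec:
  assumes [simp]: "\<sigma> TAU 0 = int \<tau>" and s: "\<And>i. i < \<tau> \<Longrightarrow> \<sigma> IN (1 + int i) = s i"
    and e: "(\<Sum>i<\<tau>. s i) < 2 ^ e"
  shows "wp Levels (\<lambda>t \<rho>. (\<exists>L\<le>e. \<rho> LEV 0 = int L \<and> (\<Sum>i<\<tau>. s i) < 2 ^ L \<and> t \<le> \<tau> * 30 + L * 40 + 60) \<and>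
      \<rho> TOTAL 0 = (\<Sum>i<\<tau>. s i) \<and> (\<forall>x. x \<notin> {TOTAL, vI, PW, LEV} \<longrightarrow> \<rho> x = \<sigma> x)) \<sigma>"
  unfolding Levels_def wp_Seq[of "Assign _ _ _"] wp_Seq[of "For _ _ _"] wp_Assign
proof (rule wp_For[where n = \<tau> and T = 18 and I = "\<lambda>k \<rho>. \<rho> TOTAL 0 = (\<Sum>i<k. s i)"], goal_cases)
  case (6 k \<rho>)
  then show ?case using s by simp
next
  case (7 t1 \<rho>1)
  define S where "S = (\<Sum>i<\<tau>. s i)"
  define L where "L = (LEAST L. S < 2 ^ L)"
  have L: "S < 2 ^ L" "L \<le> e" "\<And>k. k < L \<Longrightarrow> \<not> S < 2 ^ k"
    unfolding L_def using e[folded S_def] by (auto intro: LeastI Least_le dest: not_less_Least)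
  show ?case
  proof (rule wp_While[where n = L and T = 20 and I = "\<lambda>k \<rho>. \<rho> PW 0 = 2 ^ k \<and> \<rho> LEV 0 = int k"], goal_cases)
    case (2 k \<rho>)
    then show ?case using 7(3) L(3) by (simp add: S_def)
  next
    case (3 \<rho>)
    then show ?case using 7(3) L(1) by (simp add: S_def)
  next
    case (4 t \<rho>)
    have "\<rho> x = \<sigma> x" if "x \<notin> {TOTAL, vI, PW, LEV}" for x
      using 4 7 that by simp
    then show ?case
      using 4 7(1,3) L(1,2) by (auto simp: S_def intro!: exI[of _ L])
  qed simp
qed simp_all

lemma mods_Check_Potential [simp]: "mods Check_Potential = {PTR, POT, vI, vJ}"
  by (auto simp: Check_Potential_def)

text \<open>The potential can be normalised to row 0 of the matrix; the case \<open>i = j\<close>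
  includes that the diagonal vanishes.\<close>

definition potential :: "nat \<Rightarrow> (nat \<Rightarrow> nat \<Rightarrow> int) \<Rightarrow> bool" where
  "potential \<tau> m \<longleftrightarrow> (\<forall>i<\<tau>. \<forall>j<\<tau>. m i j = m 0 j - m 0 i)"

lemma Check_Potential_spec:
  assumes [simp]: "\<sigma> TAU 0 = int \<tau>"
    and m: "\<And>i j. i < \<tau> \<Longrightarrow> j < \<tau> \<Longrightarrow> \<sigma> IN (1 + int \<tau> + int (i * \<tau> + j)) = m i j"
  shows "wp Check_Potential (\<lambda>t \<rho>. t \<le> \<tau> * (\<tau> * 80 + 60) + 60 \<and> \<rho> PTR 0 = 1 + int \<tau> + int (\<tau> * \<tau>) \<and>
      \<rho> POT 0 = (if potential \<tau> m then 1 else 0) \<and> (\<forall>x. x \<notin> {PTR, POT, vI, vJ} \<longrightarrow> \<rho> x = \<sigma> x)) \<sigma>"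
proof -
  define ok where "ok i j \<longleftrightarrow> m i j = m 0 j - m 0 i" for i j
  show ?thesis
    unfolding Check_Potential_def wp_Seq[of "Assign _ _ _"] wp_Assign
  proof (rule wp_For[where n = \<tau> and T = "\<tau> * 72 + 30" and I = "\<lambda>k \<rho>. \<rho> PTR 0 = 1 + int \<tau> + int (k * \<tau>) \<and>
      \<rho> POT 0 = (if \<forall>i<k. \<forall>j<\<tau>. ok i j then 1 else 0)"], goal_cases)
    case (6 k \<rho>)
    then have \<rho>: "\<rho> x = \<sigma> x" if "x \<notin> {PTR, POT, vI, vJ}" for x
      using that by auto
    have m0: "\<sigma> IN (1 + (int \<tau> + int j)) = m 0 j" if "j < \<tau>" for j
      using m[of 0 j] that by (simp add: add.assoc)
    show ?case
      unfolding wp_Seq[of "For _ _ _"]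
    proof (rule wp_For[where n = \<tau> and T = 60 and I = "\<lambda>j \<rho>. \<rho> POT 0 =
        (if (\<forall>i<k. \<forall>j<\<tau>. ok i j) \<and> (\<forall>j'<j. ok k j') then 1 else 0)"], goal_cases)
      case (6 j \<rho>')
      have mk: "\<sigma> IN (\<rho> PTR 0 + int j) = m k j"
        using m[OF \<open>k < \<tau>\<close> 6(1)] \<open>\<rho> PTR 0 = _ \<and> _\<close> by (simp add: add.assoc)
      show ?case
        using 6 mk m0[OF 6(1)] m0[OF \<open>k < \<tau>\<close>] \<rho> \<open>\<rho> vI 0 = int k\<close> by (auto simp: less_Suc_eq ok_def[of k j])
    next
      case (7 t \<rho>')
      then show ?case
        using 6 \<rho> by (auto simp: less_Suc_eq)
    qed (use \<rho> 6 in auto)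
  next
    case (7 t \<rho>)
    moreover have "potential \<tau> m \<longleftrightarrow> (\<forall>i<\<tau>. \<forall>j<\<tau>. ok i j)"
      unfolding potential_def ok_def ..
    ultimately show ?case by (auto simp: algebra_simps)
  qed auto
qed

lemma mods_Output [simp]: "mods Output = {OUT, vJ}"
  by (auto simp: Output_def)

lemma Output_spec:
  assumes [simp]: "\<sigma> TAU 0 = int \<tau>" "\<sigma> FOUND 0 = 1" and out: "\<And>z. \<sigma> OUT z = 0"
    and s: "\<And>i. i < \<tau> \<Longrightarrow> \<sigma> IN (1 + int i) = s i" and tau: "0 < \<tau>"
  shows "wp Output (\<lambda>t \<rho>. t \<le> \<tau> * 60 + 60 \<and> \<rho> OUT 0 = 1 \<and>
      (\<forall>z. \<rho> OUT (1 + int z) = (if 0 < z \<and> z < \<tau> then \<sigma> SOL (int z) - s z else 0))) \<sigma>"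
proof -
  have bv: "bval (Eq (cell FOUND) (N 1)) \<sigma>" by simp
  show ?thesis
    unfolding Output_def wp_If if_P[OF bv] wp_Seq[of "Assign _ _ _"] wp_Seq[of "For _ _ _"] wp_Assign
  proof (rule wp_mono[OF wp_fill[where n = \<tau> and base = 1 and f = "\<lambda>z. \<sigma> SOL (int z) - s z"]], goal_cases)
    case (5 k \<rho>)
    then show ?case using s by simp
  next
    case (6 t \<rho>)
    then show ?case using out tau by auto
  qed simp_all
qed

section \<open>Positions of the entries in the encoded instance\<close>

lemma nth_concat_sum:
  "d < length xss \<Longrightarrow> k < length (xss ! d) \<Longrightarrow>
     (\<Sum>i<d. length (xss ! i)) + k < length (concat xss) \<and>
     concat xss ! ((\<Sum>i<d. length (xss ! i)) + k) = xss ! d ! k"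
proof (induction xss arbitrary: d)
  case (Cons xs xss)
  then show ?case
    by (cases d) (auto simp: nth_append sum.lessThan_Suc_shift add.assoc simp del: sum.lessThan_Suc)
qed simp

lemma nth_concat_uniform:
  assumes "\<And>xs. xs \<in> set xss \<Longrightarrow> length xs = n" "d < length xss" "k < n"
  shows "d * n + k < length (concat xss) \<and> concat xss ! (d * n + k) = xss ! d ! k"
proof -
  have "(\<Sum>i<d. length (xss ! i)) = d * n"
    using assms by simp
  then show ?thesis
    using nth_concat_sum[of d xss k] assms by simp
qed

definition encode_conj :: "(int list \<times> int) list \<Rightarrow> int list" where
  "encode_conj C = int (length C) # concat (map (\<lambda>(a, b). a @ [b]) C)"

lemma encode_dnf_conj: "encode_dnf D = int (length D) # concat (map encode_conj D)"
  unfolding encode_dnf_def encode_conj_def ..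

lemma encode_conj_nth:
  assumes C: "\<And>a b. (a, b) \<in> set C \<Longrightarrow> length a = \<tau>" and r: "r < length C" and j: "j \<le> \<tau>"
  shows "1 + (r * (\<tau> + 1) + j) < length (encode_conj C) \<and>
     encode_conj C ! (1 + (r * (\<tau> + 1) + j)) = (if j < \<tau> then fst (C ! r) ! j else snd (C ! r))"
proof -
  have "r * (\<tau> + 1) + j < length (concat (map (\<lambda>(a, b). a @ [b]) C)) \<and>
     concat (map (\<lambda>(a, b). a @ [b]) C) ! (r * (\<tau> + 1) + j) = map (\<lambda>(a, b). a @ [b]) C ! r ! j"
    using assms by (intro nth_concat_uniform) auto
  moreover have "length (fst (C ! r)) = \<tau>"
    using C[of "fst (C ! r)" "snd (C ! r)"] r by simp
  ultimately show ?thesis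
    using r j by (auto simp: encode_conj_def case_prod_unfold nth_append)
qed

lemma length_encode_conj:
  assumes "\<And>a b. (a, b) \<in> set C \<Longrightarrow> length a = \<tau>"
  shows "length (encode_conj C) = 1 + length C * (\<tau> + 1)"
proof -
  have "length (concat (map (\<lambda>(a, b). a @ [b]) C)) = sum_list (map (\<lambda>_. \<tau> + 1) C)"
    unfolding length_concat map_map by (rule arg_cong[where f = sum_list], rule map_cong) (use assms in auto)
  then show ?thesis
    by (simp add: encode_conj_def sum_list_triv)
qed

locale instance_data =
  fixes \<tau> \<delta> \<gamma> \<alpha> \<beta> :: nat and s :: "nat \<Rightarrow> int" and D :: dnf and c :: "nat \<Rightarrow> nat \<Rightarrow> int"
  assumes tau: "1 \<le> \<tau>" and soc: "society \<tau> s" and bounds: "dnf_bounds \<tau> \<delta> \<gamma> \<alpha> \<beta> D"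
begin

definition total :: int where "total = (\<Sum>i<\<tau>. s i)"

definition mem :: "nat \<Rightarrow> int" where
  "mem n = input_state (encode_instance \<tau> s c D) IN (int n)"

definition offset :: nat where "offset = 1 + \<tau> + \<tau> * \<tau>"

text \<open>The cell with the number of rows of disjunct \<open>d\<close>: each earlier disjunct
  occupies one cell for its length and \<open>\<tau> + 1\<close> cells per inequality.\<close>

definition conj_pos :: "nat \<Rightarrow> nat" where
  "conj_pos d = offset + 1 + (\<Sum>i<d. 1 + length (D ! i) * (\<tau> + 1))"

lemma D_bounds:
  assumes "d < length D"
  shows "length (D ! d) \<le> \<gamma>" "(a, b) \<in> set (D ! d) \<Longrightarrow> length a = \<tau>"
    "(a, b) \<in> set (D ! d) \<Longrightarrow> j < \<tau> \<Longrightarrow> \<bar>a ! j\<bar> \<le> int \<alpha>"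
  using bounds nth_mem[OF assms] unfolding dnf_bounds_def by fastforce+

lemma mem_nth: "n < length (encode_instance \<tau> s c D) \<Longrightarrow> mem n = encode_instance \<tau> s c D ! n"
  by (simp add: mem_def input_state_def)

lemma length_row_major: "length (row_major \<tau> m) = \<tau> * \<tau>"
  by (simp add: row_major_def length_concat comp_def sum_list_triv)

lemma row_major_nth: "i < \<tau> \<Longrightarrow> j < \<tau> \<Longrightarrow> row_major \<tau> m ! (i * \<tau> + j) = m i j"
  unfolding row_major_def
  by (subst nth_concat_uniform[THEN conjunct2]) auto

lemma mem_tau: "mem 0 = int \<tau>"
  by (subst mem_nth) (auto simp: encode_instance_def)

lemma mem_society: "i < \<tau> \<Longrightarrow> mem (1 + i) = s i"
  by (subst mem_nth) (auto simp: encode_instance_def nth_append)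

lemma index_less: "i < \<tau> \<Longrightarrow> j < \<tau> \<Longrightarrow> i * \<tau> + j < \<tau> * \<tau>"
  by (metis add.commute add_less_cancel_right less_le_trans mult_Suc mult_le_mono1 Suc_leI)

lemma mem_cost: "i < \<tau> \<Longrightarrow> j < \<tau> \<Longrightarrow> mem (1 + \<tau> + (i * \<tau> + j)) = c i j"
  using index_less[of i j]
  by (subst mem_nth) (auto simp: encode_instance_def nth_append length_row_major row_major_nth)

lemma mem_dnf: "k < length (encode_dnf D) \<Longrightarrow> mem (offset + k) = encode_dnf D ! k"
  by (subst mem_nth) (auto simp: encode_instance_def nth_append length_row_major offset_def)

lemma mem_length: "mem offset = int (length D)"
  using mem_dnf[of 0] by (simp add: encode_dnf_conj)

lemma mem_conj:
  assumes d: "d < length D" and k: "k < length (encode_conj (D ! d))"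
  shows "mem (conj_pos d + k) = encode_conj (D ! d) ! k"
proof -
  have len: "(\<Sum>i<d. length (map encode_conj D ! i)) = (\<Sum>i<d. 1 + length (D ! i) * (\<tau> + 1))"
    proof (intro sum.cong refl)
    fix i assume "i \<in> {..<d}"
    then have "i < length D" using d by simp
    then show "length (map encode_conj D ! i) = 1 + length (D ! i) * (\<tau> + 1)"
      using length_encode_conj[OF D_bounds(2)] by simp
  qed
  have "mem (offset + (1 + ((\<Sum>i<d. length (map encode_conj D ! i)) + k))) = encode_conj (D ! d) ! k"
    using nth_concat_sum[of d "map encode_conj D" k] d k by (subst mem_dnf) (auto simp: encode_dnf_conj)
  then show ?thesis
    by (simp add: conj_pos_def len add.assoc)
qed

lemma mem_conj_length: "d < length D \<Longrightarrow> mem (conj_pos d) = int (length (D ! d))"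
  using mem_conj[of d 0] by (simp add: encode_conj_def)

lemma mem_conj_entry:
  assumes "d < length D" "r < length (D ! d)" "j \<le> \<tau>"
  shows "mem (conj_pos d + 1 + (r * (\<tau> + 1) + j)) = (if j < \<tau> then fst (D ! d ! r) ! j else snd (D ! d ! r))"
proof -
  have *: "1 + (r * (\<tau> + 1) + j) < length (encode_conj (D ! d)) \<and>
     encode_conj (D ! d) ! (1 + (r * (\<tau> + 1) + j)) = (if j < \<tau> then fst (D ! d ! r) ! j else snd (D ! d ! r))"
    using assms D_bounds(2)[OF assms(1)] by (intro encode_conj_nth) auto
  then show ?thesis
    using mem_conj[OF assms(1) conjunct1[OF *]] by (simp add: add.assoc)
qed

definition sat :: "(int list \<times> int) list \<Rightarrow> (nat \<Rightarrow> int) \<Rightarrow> bool" where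
  "sat C y \<longleftrightarrow> (\<forall>j<\<tau>. 0 \<le> y j) \<and> (\<Sum>j<\<tau>. y j) = total \<and> (\<forall>(a, b) \<in> set C. (\<Sum>j<\<tau>. a ! j * y j) \<le> b)"

definition price :: "(nat \<Rightarrow> int) \<Rightarrow> int" where
  "price y = (\<Sum>j<\<tau>. c 0 j * y j)"

definition bound :: nat where
  "bound = states_bound \<gamma> \<alpha>"

definition unit_time :: "nat \<Rightarrow> nat" where
  "unit_time L = 10000 * (L + 1) * (\<tau> + \<gamma> + 5) ^ 3 * (bound + 3)\<^sup>2"

text \<open>The loop invariant after \<open>k\<close> disjuncts: every candidate solves one of them,
  and every solution of one of them is matched by a candidate that is no more expensive.\<close>

definition covered :: "state \<Rightarrow> nat \<Rightarrow> bool" where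
  "covered \<rho> k \<longleftrightarrow> (\<exists>X. is_best \<rho> \<tau> X \<and> (\<forall>(b, x) \<in> X. (\<exists>d<k. sat (D ! d) x) \<and> b = price x) \<and>
     (\<forall>d<k. \<forall>y. sat (D ! d) y \<longrightarrow> (\<exists>(b, x) \<in> X. b \<le> price y)))"

lemma Disjunct_instance:
  assumes d: "d < length D" and IN: "\<sigma> IN = input_state (encode_instance \<tau> s c D) IN"
    and st: "\<sigma> TAU 0 = int \<tau>" "\<sigma> PTR 0 = int (conj_pos d)" "\<sigma> LEV 0 = int L" "\<sigma> TOTAL 0 = total"
    and L: "total < 2 ^ L" and cov: "covered \<sigma> d"
  shows "wp Disjunct (\<lambda>t \<rho>. t \<le> unit_time L \<and> \<rho> PTR 0 = int (conj_pos (Suc d)) \<and> covered \<rho> (Suc d)) \<sigma>"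
proof -
  define G where "G = length (D ! d)"
  define p where "p = int (conj_pos d)"
  \<comment> \<open>The data are read from memory at all indices, so that the premises of
    \<open>ip.Disjunct_spec\<close> hold by definition. Agreement with \<open>D\<close> and
    \<open>c\<close> is shown only for the indices in range.\<close>
  define A where "A = matrix_at \<sigma> \<tau> (p + 1)"
  define c' where "c' = price_at \<sigma> \<tau>"
  define b where "b r = \<sigma> IN (p + 1 + int (r * (\<tau> + 1) + \<tau>))" for r
  interpret ip: move_ip A c' \<tau> G L b total
    using tau L by unfold_locales auto
  have m: "\<sigma> IN (int n) = mem n" for n
    by (simp add: mem_def IN)
  have A: "A r j = fst (D ! d ! r) ! j" if "r < G" "j < \<tau>" for r j
    using mem_conj_entry[OF d, of r j] that m[of "conj_pos d + 1 + (r * (\<tau> + 1) + j)"]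
    by (simp add: A_def matrix_at_def p_def G_def algebra_simps)
  have b: "b r = snd (D ! d ! r)" if "r < G" for r
    using mem_conj_entry[OF d, of r \<tau>] that m[of "conj_pos d + 1 + (r * (\<tau> + 1) + \<tau>)"]
    by (simp add: b_def p_def G_def algebra_simps)
  have c': "c' j = c 0 j" if "j < \<tau>" for j
    using mem_cost[of 0 j] that tau m[of "1 + \<tau> + j"] by (simp add: c'_def price_at_def add.assoc)
  have cost: "ip.cost y = price y" for y
    by (simp add: ip.cost_def price_def c')
  have feas: "ip.feas y \<longleftrightarrow> sat (D ! d) y" for y
  proof -
    have "(\<forall>r<G. (\<Sum>j<\<tau>. A r j * y j) \<le> b r) \<longleftrightarrow> (\<forall>r<G. (\<Sum>j<\<tau>. fst (D ! d ! r) ! j * y j) \<le> snd (D ! d ! r))"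
      by (simp add: A b)
    also have "\<dots> \<longleftrightarrow> (\<forall>(a, b) \<in> set (D ! d). (\<Sum>j<\<tau>. a ! j * y j) \<le> b)"
      by (auto simp: G_def all_set_conv_all_nth case_prod_unfold)
    finally show ?thesis
      by (simp add: ip.feas_def sat_def)
  qed
  from cov obtain X where X: "is_best \<sigma> \<tau> X" "\<forall>(b, x) \<in> X. (\<exists>d'<d. sat (D ! d') x) \<and> b = price x"
      "\<forall>d'<d. \<forall>y. sat (D ! d') y \<longrightarrow> (\<exists>(b, x) \<in> X. b \<le> price y)"
    by (auto simp: covered_def)
  have A_bound: "\<bar>A r j\<bar> \<le> int \<alpha>" if "r < G" "j < \<tau>" for r j
    using D_bounds(3)[OF d, of "fst (D ! d ! r)" "snd (D ! d ! r)" j] that A by (simp add: G_def)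
  have time: "ip.disjunct_time \<le> unit_time L"
    unfolding unit_time_def bound_def
    by (rule ip.disjunct_time_bound[OF A_bound]) (use D_bounds(1)[OF d] in \<open>simp_all add: G_def\<close>)
  show ?thesis
  proof (rule wp_mono[OF ip.Disjunct_spec[of \<sigma> p X]], goal_cases)
    case (10 t \<rho>)
    then obtain X' where X': "is_best \<rho> \<tau> (X \<union> X')" "\<forall>(\<beta>, x) \<in> X'. sat (D ! d) x \<and> \<beta> = price x"
        "\<forall>y. sat (D ! d) y \<longrightarrow> (\<exists>(\<beta>, x) \<in> X'. \<beta> \<le> price y)"
      by (auto simp: feas cost)
    have "covered \<rho> (Suc d)"
      unfolding covered_def
    proof (intro exI[of _ "X \<union> X'"] conjI)
      show "is_best \<rho> \<tau> (X \<union> X')" by fact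
      show "\<forall>(b, x)\<in>X \<union> X'. (\<exists>d'<Suc d. sat (D ! d') x) \<and> b = price x"
        using X(2) X'(2) by (fastforce simp: less_Suc_eq)
      show "\<forall>d'<Suc d. \<forall>y. sat (D ! d') y \<longrightarrow> (\<exists>(b, x)\<in>X \<union> X'. b \<le> price y)"
        using X(3) X'(3) by (fastforce simp: less_Suc_eq)
    qed
    with 10 time show ?case
      by (auto simp: p_def conj_pos_def G_def)
  qed (use st m mem_conj_length[OF d] X(1) in \<open>simp_all add: p_def G_def A_def c'_def b_def\<close>)
qed

end

section \<open>The answer computed for an instance\<close>

context instance_data
begin

definition solver_time :: "nat \<Rightarrow> nat" where
  "solver_time e = 1000 + \<tau> * 210 + e * 40 + \<tau> * \<tau> * 80 + length D * (unit_time e + 12)"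

definition solvable :: bool where
  "solvable \<longleftrightarrow> potential \<tau> c \<and> (\<exists>d<length D. \<exists>y. sat (D ! d) y)"

definition optimal :: "(nat \<Rightarrow> int) \<Rightarrow> bool" where
  "optimal x \<longleftrightarrow> (\<exists>d<length D. sat (D ! d) x) \<and>
     (\<forall>d<length D. \<forall>y. sat (D ! d) y \<longrightarrow> price x \<le> price y)"

definition answered :: "state \<Rightarrow> bool" where
  "answered \<rho> \<longleftrightarrow> (if solvable then \<rho> OUT 0 = 1 \<and>
       (\<exists>x. optimal x \<and> (\<forall>z. \<rho> OUT (1 + int z) = (if 0 < z \<and> z < \<tau> then x z - s z else 0)))
     else \<rho> OUT 0 = 0)"

lemma Output_answers:
  assumes st: "\<sigma> TAU 0 = int \<tau>" and out: "\<And>z. \<sigma> OUT z = 0" and IN: "\<sigma> IN = input_state (encode_instance \<tau> s c D) IN"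
    and f: "if potential \<tau> c then covered \<sigma> (length D) else \<sigma> FOUND 0 = 0"
  shows "wp Output (\<lambda>t \<rho>. t \<le> \<tau> * 60 + 60 \<and> answered \<rho>) \<sigma>"
proof (cases "potential \<tau> c \<and> \<sigma> FOUND 0 = 1")
  case True
  then obtain X where X: "is_best \<sigma> \<tau> X" "\<forall>(b, x) \<in> X. (\<exists>d<length D. sat (D ! d) x) \<and> b = price x"
      "\<forall>d<length D. \<forall>y. sat (D ! d) y \<longrightarrow> (\<exists>(b, x) \<in> X. b \<le> price y)"
    using f by (auto simp: covered_def)
  from X(1) True obtain x where x: "(\<sigma> BEST 0, x) \<in> X" "\<forall>j<\<tau>. \<sigma> SOL (int j) = x j"
      "\<forall>(b, x) \<in> X. \<sigma> BEST 0 \<le> b"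
    by (auto simp: is_best_def split: if_splits)
  have opt: "optimal x"
    unfolding optimal_def using X(2,3) x(1,3) by fastforce
  then have solv: "solvable"
    using True by (auto simp: solvable_def optimal_def)
  have s: "\<sigma> IN (1 + int i) = s i" if "i < \<tau>" for i
    using mem_society[OF that] by (simp add: mem_def IN)
  show ?thesis
    by (rule wp_mono[OF Output_spec[of \<sigma> \<tau> s]])
      (use st True out s tau opt solv x(2) in \<open>auto simp: answered_def intro!: exI[of _ x]\<close>)
next
  case False
  have "\<sigma> FOUND 0 = 0 \<and> \<not> solvable"
  proof (cases "potential \<tau> c")
    case True
    then obtain X where X: "is_best \<sigma> \<tau> X" "\<forall>d<length D. \<forall>y. sat (D ! d) y \<longrightarrow> (\<exists>(b, x) \<in> X. b \<le> price y)"
      using f by (auto simp: covered_def)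
    \<comment> \<open>A nonempty set of candidates would have set the flag; with no candidate at
      all, no disjunct has a solution.\<close>
    then have "X = {}" using False True by (auto simp: is_best_def split: if_splits)
    with X show ?thesis by (auto simp: is_best_def solvable_def)
  qed (use f in \<open>auto simp: solvable_def\<close>)
  then show ?thesis
    using out by (auto simp: Output_def answered_def)
qed

lemma Solver_spec:
  assumes e: "total < 2 ^ e"
  shows "wp Solver (\<lambda>t \<rho>. t \<le> solver_time e \<and> answered \<rho>) (input_state (encode_instance \<tau> s c D))"
proof -
  define \<sigma> where "\<sigma> = (input_state (encode_instance \<tau> s c D))(TAU := (\<lambda>_. 0)(0 := int \<tau>))"
  have IN: "\<sigma> IN = input_state (encode_instance \<tau> s c D) IN"
    by (simp add: \<sigma>_def)
  have m: "\<sigma> IN (int n) = mem n" for n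
    by (simp add: mem_def IN)
  have tau0: "\<sigma> TAU 0 = int \<tau>" and out0: "\<sigma> OUT z = 0" "\<sigma> FOUND z = 0" for z
    by (simp_all add: \<sigma>_def input_state_def)
  have first: "wp (TAU ::= cell IN) (\<lambda>t \<rho>. t = 4 \<and> \<rho> = \<sigma>) (input_state (encode_instance \<tau> s c D))"
    using mem_tau by (auto simp: \<sigma>_def mem_def input_state_def fun_eq_iff)
  show ?thesis
    unfolding Solver_def wp_Seq[of "Assign _ _ _"]
  proof (rule wp_mono[OF first], elim conjE, hypsubst, goal_cases)
    case 1
    show ?case
      unfolding wp_Seq[of Levels]
    proof (rule wp_mono[OF Levels_spec[where \<tau> = \<tau> and s = s and e = e]], goal_cases)
      case (2 i)
      then show ?case using mem_society[of i] m[of "1 + i"] by simp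
    next
      case (4 t1 \<sigma>1)
      then obtain L where L: "L \<le> e" "\<sigma>1 LEV 0 = int L" "total < 2 ^ L" "t1 \<le> \<tau> * 30 + L * 40 + 60"
        and tot: "\<sigma>1 TOTAL 0 = total" and s1: "\<And>x. x \<notin> {TOTAL, vI, PW, LEV} \<Longrightarrow> \<sigma>1 x = \<sigma> x"
        unfolding total_def by blast
      have unit: "unit_time L \<le> unit_time e"
        unfolding unit_time_def using L(1) by (intro mult_le_mono) auto
      show ?case
        unfolding wp_Seq[of Check_Potential]
      proof (rule wp_mono[OF Check_Potential_spec[where \<tau> = \<tau> and m = c]], goal_cases)
        case (2 i j)
        then show ?case using mem_cost[of i j] m[of "1 + \<tau> + (i * \<tau> + j)"] s1 by (simp add: add.assoc)
      next
        case (3 t2 \<sigma>2)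
        then have t2: "t2 \<le> \<tau> * (\<tau> * 80 + 60) + 60" and ptr: "\<sigma>2 PTR 0 = int offset"
          and pot: "\<sigma>2 POT 0 = (if potential \<tau> c then 1 else 0)"
          and s2: "\<And>x. x \<notin> {PTR, POT, vI, vJ, TOTAL, PW, LEV} \<Longrightarrow> \<sigma>2 x = \<sigma> x"
          and s21: "\<And>x. x \<notin> {PTR, POT, vI, vJ} \<Longrightarrow> \<sigma>2 x = \<sigma>1 x"
          using s1 by (auto simp: offset_def)
        let ?loop = "com.If (Eq (cell POT) (N 1))
          (ND ::= V IN (cell PTR) ;; inc PTR (N 1) ;; FOUND ::= N 0 ;; For vD ND Disjunct) SKIP"
        have loop: "wp ?loop (\<lambda>t \<rho>. t \<le> 80 + length D * (unit_time e + 12) \<and> \<rho> TAU 0 = int \<tau> \<and> (\<forall>z. \<rho> OUT z = 0) \<and>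
            \<rho> IN = input_state (encode_instance \<tau> s c D) IN \<and>
            (if potential \<tau> c then covered \<rho> (length D) else \<rho> FOUND 0 = 0)) \<sigma>2"
        proof (cases "potential \<tau> c")
          case False
          then show ?thesis
            using pot s2 tau0 out0 IN by auto
        next
          case True
          then have bv: "bval (Eq (cell POT) (N 1)) \<sigma>2" using pot by simp
          have nd: "\<sigma>2 IN (\<sigma>2 PTR 0) = int (length D)"
            using ptr mem_length m[of offset] s2 by simp
          show ?thesis
            unfolding wp_If if_P[OF bv] wp_Seq[of "Assign _ _ _"] wp_Assign
          proof (rule wp_For[where n = "length D" and T = "unit_time e" and I = "\<lambda>k \<rho>.
              \<rho> PTR 0 = int (conj_pos k) \<and> covered \<rho> k"], goal_cases)
            case 1
            show ?case using nd by simp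
          next
            case 5
            have "covered (\<sigma>2(ND := f, PTR := f', FOUND := (\<sigma>2 FOUND)(0 := 0), vD := f'')) 0" for f f' f''
              unfolding covered_def by (rule exI[of _ "{}"]) (simp add: is_best_def)
            then show ?case
              using ptr by (simp add: conj_pos_def)
          next
            case (6 k \<rho>)
            have cov: "covered (\<rho>'(vD := f)) (Suc k) = covered \<rho>' (Suc k)" for \<rho>' f
              by (simp add: covered_def is_best_def)
            have \<rho>: "\<rho> TAU 0 = int \<tau>" "\<rho> LEV 0 = int L" "\<rho> TOTAL 0 = total" "\<rho> IN = input_state (encode_instance \<tau> s c D) IN"
              using 6(3) s2 s21 L(2) tot tau0 IN by simp_all
            show ?case
              by (rule wp_mono[OF Disjunct_instance[where d = k and L = L]])
                (use 6 \<rho> L unit cov in \<open>auto\<close>)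
          next
            case (7 t \<rho>)
            have "\<rho> IN = \<sigma> IN" "\<rho> TAU = \<sigma> TAU" "\<rho> OUT = \<sigma> OUT"
              using 7(2) s2 by simp_all
            then show ?case
              using 7 True tau0 out0 IN by simp
          qed simp_all
        qed
        show ?case
          unfolding wp_Seq[of "com.If _ _ _"]
        proof (rule wp_mono[OF loop], goal_cases)
          case (1 t3 \<sigma>3)
          show ?case
          proof (rule wp_mono[OF Output_answers], goal_cases)
            case (5 t4 \<rho>)
            have "L * 40 \<le> e * 40" using L(1) by simp
            then have "4 + (t1 + (t2 + (t3 + t4))) \<le> solver_time e"
              unfolding solver_time_def using L(4) t2 1 5 by (simp add: algebra_simps)
            with 5 show ?case by simp
          qed (use 1 in auto)
        qed
      qed (use s1 tau0 in auto)
    qed (use tau0 e in \<open>auto simp: total_def\<close>)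
  qed
qed

end

section \<open>From societies to moves\<close>

lemma holds_ineq: "holds (ineq_formula (a, b)) x \<longleftrightarrow> (\<Sum>i<length a. a ! i * x i) \<le> b"
proof -
  have "term_val (foldr (\<lambda>i u. Add (Scale (a ! i) (Var i)) u) is (Const 0)) x = (\<Sum>i\<leftarrow>is. a ! i * x i)" for "is"
    by (induction "is") auto
  then show ?thesis
    by (simp add: ineq_formula_def interv_sum_list_conv_sum_set_nat atLeast0LessThan)
qed

lemma holds_dnf: "holds (dnf_formula D) x \<longleftrightarrow> (\<exists>C\<in>set D. \<forall>ab\<in>set C. holds (ineq_formula ab) x)"
proof -
  have "holds (foldr (\<lambda>ab q. Conj (ineq_formula ab) q) C TT) x \<longleftrightarrow> (\<forall>ab\<in>set C. holds (ineq_formula ab) x)" for C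
    by (induction C) auto
  then show ?thesis
    unfolding dnf_formula_def by (induction D) auto
qed

lemma sum_change: "(\<Sum>i<\<tau>. change \<tau> m i) = 0"
  unfolding change_def sum_subtractf by (subst sum.swap) simp

definition unit_move :: "nat \<Rightarrow> nat \<Rightarrow> nat \<Rightarrow> nat \<Rightarrow> int" where
  "unit_move i j = (\<lambda>a b. if a = i \<and> b = j then 1 else 0)"

lemma change_unit_move:
  assumes "i < \<tau>" "j < \<tau>"
  shows "change \<tau> (unit_move i j) l = (if l = j then 1 else 0) - (if l = i then 1 else 0)"
proof -
  have "(\<Sum>k<\<tau>. unit_move i j k l) = (if l = j then 1 else 0)"
    using assms by (cases "l = j") (simp_all add: unit_move_def)
  moreover have "(\<Sum>k<\<tau>. unit_move i j l k) = (if l = i then 1 else 0)"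
    using assms by (cases "l = i") (simp_all add: unit_move_def)
  ultimately show ?thesis
    by (simp add: change_def sum_subtractf)
qed

lemma linear_objective_unit_move:
  assumes "i < \<tau>" "j < \<tau>"
  shows "linear_objective \<tau> c (unit_move i j) = c i j"
proof -
  have "(\<Sum>b<\<tau>. c a b * unit_move i j a b) = (if a = i then c i j else 0)" for a
    using assms by (cases "a = i") (simp_all add: unit_move_def if_distrib cong: if_cong)
  then show ?thesis
    using assms by (simp add: linear_objective_def)
qed

lemma change_add: "change \<tau> (\<lambda>i j. m i j + k * n i j) l = change \<tau> m l + k * change \<tau> n l"
  by (simp add: change_def sum_distrib_left algebra_simps flip: sum.distrib sum_subtractf)

lemma linear_objective_add:
  "linear_objective \<tau> c (\<lambda>i j. m i j + k * n i j) = linear_objective \<tau> c m + k * linear_objective \<tau> c n"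
  by (simp add: linear_objective_def sum_distrib_left algebra_simps flip: sum.distrib)

text \<open>The circulation \<open>i \<rightarrow> j\<close>, \<open>0 \<rightarrow> i\<close> and back from \<open>j\<close> to 0 leaves every society unchanged, so a
  minimum can only exist if it costs nothing.\<close>

lemma minimum_move_potential:
  assumes m: "minimum_move \<tau> (linear_objective \<tau> c) s \<Psi> m" and tau: "0 < \<tau>"
  shows "potential \<tau> c"
  unfolding potential_def
proof (intro allI impI)
  fix i j assume ij: "i < \<tau>" "j < \<tau>"
  define n where "n = (\<lambda>a b. (unit_move i j a b + 1 * unit_move 0 i a b) + (- 1) * unit_move 0 j a b)"
  have n: "change \<tau> n = (\<lambda>_. 0)" "linear_objective \<tau> c n = c i j + c 0 i - c 0 j"
    unfolding n_def using ij tau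
    by (simp_all only: change_add linear_objective_add fun_eq_iff) (simp_all add: change_unit_move linear_objective_unit_move)
  have "linear_objective \<tau> c m \<le> linear_objective \<tau> c m + k * linear_objective \<tau> c n" for k
  proof -
    have "admissible_move \<tau> s \<Psi> (\<lambda>a b. m a b + k * n a b)"
      using m unfolding minimum_move_def admissible_move_def feasible_def by (simp add: change_add n(1))
    then show ?thesis
      using m unfolding minimum_move_def linear_objective_add[symmetric] by blast
  qed
  \<comment> \<open>The circulation may be run backwards since moves can have negative entries, so
    its cost is neither negative nor positive.\<close>
  from this[of 1] this[of "-1"] show "c i j = c 0 j - c 0 i"
    unfolding n(2) by simp
qed

text \<open>Summation by parts: with \<open>c i j = p j - p i\<close> the coefficient of
  \<open>p j\<close> is the inflow of type \<open>j\<close> minus its outflow.\<close>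

lemma linear_objective_potential:
  assumes "potential \<tau> c"
  shows "linear_objective \<tau> c m = (\<Sum>j<\<tau>. c 0 j * change \<tau> m j)"
proof -
  have "linear_objective \<tau> c m = (\<Sum>i<\<tau>. \<Sum>j<\<tau>. c 0 j * m i j - c 0 i * m i j)"
    unfolding linear_objective_def
  proof (intro sum.cong refl)
    fix i j assume "i \<in> {..<\<tau>}" "j \<in> {..<\<tau>}"
    then have "c i j = c 0 j - c 0 i" using assms unfolding potential_def by blast
    then show "c i j * m i j = c 0 j * m i j - c 0 i * m i j" by (simp only: left_diff_distrib)
  qed
  also have "\<dots> = (\<Sum>j<\<tau>. \<Sum>i<\<tau>. c 0 j * m i j) - (\<Sum>i<\<tau>. \<Sum>j<\<tau>. c 0 i * m i j)"
    unfolding sum_subtractf by (subst sum.swap) simp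
  also have "\<dots> = (\<Sum>j<\<tau>. c 0 j * change \<tau> m j)"
    by (simp add: change_def sum_subtractf sum_distrib_left right_diff_distrib)
  finally show ?thesis .
qed

text \<open>A star with centre 0: types other than 0 trade only with type 0, and a loss of type
  \<open>j\<close> is a negative entry. A change with sum 0 is thereby realised, the balance at type
  0 being automatic.\<close>

definition transfer :: "(nat \<Rightarrow> int) \<Rightarrow> nat \<Rightarrow> nat \<Rightarrow> int" where
  "transfer d = (\<lambda>i j. if i = 0 \<and> 0 < j then d j else 0)"

lemma change_transfer:
  assumes d: "(\<Sum>j<\<tau>. d j) = 0" and i: "i < \<tau>"
  shows "change \<tau> (transfer d) i = d i"
proof (cases "i = 0")
  case True
  have "change \<tau> (transfer d) 0 = - (\<Sum>j<\<tau>. if 0 < j then d j else 0)"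
    by (simp add: change_def transfer_def sum_negf[symmetric] if_distrib cong: if_cong)
  also have "(\<Sum>j<\<tau>. if 0 < j then d j else 0) = (\<Sum>j<\<tau>. d j) - d 0"
  proof -
    have "(\<Sum>j<\<tau>. if 0 < j then d j else 0) = (\<Sum>j<\<tau>. d j - (if j = 0 then d 0 else 0))"
      by (intro sum.cong) auto
    then show ?thesis using i by (simp add: sum_subtractf)
  qed
  finally show ?thesis using d True by simp
next
  case False
  then have "change \<tau> (transfer d) i = (\<Sum>j<\<tau>. if j = 0 then d i else 0)"
    by (simp add: change_def transfer_def)
  then show ?thesis using i by simp
qed

context instance_data
begin

text \<open>A change has sum 0, so the society reached always has the original total; feasibility
  supplies the remaining condition of \<open>sat\<close>.\<close>

lemma admissible_iff:
  assumes \<Psi>: "pa_equiv \<Psi> (dnf_formula D)"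
  shows "admissible_move \<tau> s \<Psi> m \<longleftrightarrow> (\<exists>d<length D. sat (D ! d) (\<lambda>i. s i + change \<tau> m i))"
proof -
  let ?x = "\<lambda>i. s i + change \<tau> m i"
  have tot: "(\<Sum>i<\<tau>. ?x i) = total"
    by (simp add: sum.distrib sum_change total_def)
  have *: "(\<forall>ab\<in>set (D ! d). holds (ineq_formula ab) ?x) \<longleftrightarrow> sat (D ! d) ?x"
    if f: "feasible \<tau> s (change \<tau> m)" and d: "d < length D" for d
  proof -
    have "holds (ineq_formula ab) ?x = (case ab of (a, b) \<Rightarrow> (\<Sum>i<\<tau>. a ! i * ?x i) \<le> b)"
      if "ab \<in> set (D ! d)" for ab
    proof -
      have "length (fst ab) = \<tau>" using D_bounds(2)[OF d, of "fst ab" "snd ab"] that by simp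
      then show ?thesis by (cases ab) (simp only: holds_ineq fst_conv split_conv)
    qed
    then show ?thesis
      using f tot unfolding sat_def feasible_def by (simp cong: ball_cong)
  qed
  have "holds \<Psi> ?x \<longleftrightarrow> (\<exists>d<length D. \<forall>ab\<in>set (D ! d). holds (ineq_formula ab) ?x)"
    using \<Psi> unfolding pa_equiv_def holds_dnf Bex_def in_set_conv_nth by blast
  moreover have "feasible \<tau> s (change \<tau> m)" if "sat (D ! d) ?x" for d
    using that by (simp add: sat_def feasible_def)
  ultimately show ?thesis
    unfolding admissible_move_def using * by blast
qed

lemma sat_cong: "(\<And>j. j < \<tau> \<Longrightarrow> x j = y j) \<Longrightarrow> sat C x = sat C y"
  by (simp add: sat_def)

lemma price_cong: "(\<And>j. j < \<tau> \<Longrightarrow> x j = y j) \<Longrightarrow> price x = price y"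
  by (simp add: price_def)

lemma sat_transfer:
  assumes "sat C x"
  shows "j < \<tau> \<Longrightarrow> s j + change \<tau> (transfer (\<lambda>j. x j - s j)) j = x j"
  using assms by (subst change_transfer) (auto simp: sat_def total_def sum_subtractf)

text \<open>Under a potential the cost of a move is the price of the society reached minus that of
  \<open>s\<close>. Every society satisfying a disjunct is reached by a transfer, so optimising over
  moves is optimising over societies.\<close>

lemma minimum_move_iff:
  assumes \<Psi>: "pa_equiv \<Psi> (dnf_formula D)" and pot: "potential \<tau> c"
  shows "minimum_move \<tau> (linear_objective \<tau> c) s \<Psi> m \<longleftrightarrow> optimal (\<lambda>i. s i + change \<tau> m i)"
proof -
  let ?x = "\<lambda>m i. s i + change \<tau> m i"
  have obj: "linear_objective \<tau> c m = price (?x m) - price s" for m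
    using linear_objective_potential[OF pot] by (simp add: price_def algebra_simps sum.distrib)
  have real: "\<exists>m. admissible_move \<tau> s \<Psi> m \<and> price (?x m) = price y" if "d < length D" "sat (D ! d) y" for d y
  proof (intro exI conjI)
    let ?m = "transfer (\<lambda>j. y j - s j)"
    have eq: "\<And>j. j < \<tau> \<Longrightarrow> ?x ?m j = y j" using sat_transfer[OF that(2)] .
    show "admissible_move \<tau> s \<Psi> ?m"
      unfolding admissible_iff[OF \<Psi>] using that sat_cong[of "?x ?m" y, OF eq] by blast
    show "price (?x ?m) = price y" by (rule price_cong) (rule eq)
  qed
  have "(\<forall>m'. admissible_move \<tau> s \<Psi> m' \<longrightarrow> price (?x m) \<le> price (?x m')) \<longleftrightarrow>
      (\<forall>d<length D. \<forall>y. sat (D ! d) y \<longrightarrow> price (?x m) \<le> price y)"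
  proof (intro iffI allI impI)
    fix d y assume "\<forall>m'. admissible_move \<tau> s \<Psi> m' \<longrightarrow> price (?x m) \<le> price (?x m')"
      and "d < length D" "sat (D ! d) y"
    then show "price (?x m) \<le> price y" using real[of d y] by force
  next
    fix m' assume "\<forall>d<length D. \<forall>y. sat (D ! d) y \<longrightarrow> price (?x m) \<le> price y"
      and "admissible_move \<tau> s \<Psi> m'"
    then show "price (?x m) \<le> price (?x m')" unfolding admissible_iff[OF \<Psi>] by blast
  qed
  then show ?thesis
    unfolding minimum_move_def optimal_def obj by (simp add: admissible_iff[OF \<Psi>])
qed

lemma answered_correct:
  assumes \<Psi>: "pa_equiv \<Psi> (dnf_formula D)" and a: "answered \<rho>"
  shows "\<exists>ys. (\<forall>i<length ys. \<rho> OUT (int i) = ys ! i) \<and> correct_answer \<tau> (linear_objective \<tau> c) s \<Psi> ys"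
proof (cases solvable)
  case True
  then have pot: "potential \<tau> c" by (simp add: solvable_def)
  from a True obtain x where x: "optimal x" "\<rho> OUT 0 = 1"
      "\<And>z. \<rho> OUT (1 + int z) = (if 0 < z \<and> z < \<tau> then x z - s z else 0)"
    by (auto simp: answered_def)
  define m where "m = transfer (\<lambda>j. x j - s j)"
  from x(1) obtain d where "sat (D ! d) x" by (auto simp: optimal_def)
  then have eq: "\<And>j. j < \<tau> \<Longrightarrow> s j + change \<tau> m j = x j"
    unfolding m_def by (rule sat_transfer)
  have "optimal (\<lambda>i. s i + change \<tau> m i)"
    using x(1) sat_cong[of "\<lambda>i. s i + change \<tau> m i" x, OF eq] price_cong[of "\<lambda>i. s i + change \<tau> m i" x, OF eq]
    by (simp add: optimal_def)
  then have min: "minimum_move \<tau> (linear_objective \<tau> c) s \<Psi> m"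
    by (simp add: minimum_move_iff[OF \<Psi> pot])
  have "\<rho> OUT (int i) = (1 # row_major \<tau> m) ! i" if i: "i < length (1 # row_major \<tau> m)" for i
  proof (cases i)
    case 0
    then show ?thesis using x(2) by simp
  next
    case (Suc n)
    define p q where "p = n div \<tau>" and "q = n mod \<tau>"
    have n: "n < \<tau> * \<tau>" using i Suc by (simp add: length_row_major)
    then have pq: "p < \<tau>" "q < \<tau>" "n = p * \<tau> + q"
      using tau by (auto simp: p_def q_def less_mult_imp_div_less)
    have "row_major \<tau> m ! n = m p q" unfolding pq(3) using pq(1,2) by (rule row_major_nth)
    \<comment> \<open>In row-major order the indices below \<tau> are exactly row 0, the only row
      that a transfer uses.\<close>
    moreover have "0 < n \<and> n < \<tau> \<longleftrightarrow> p = 0 \<and> 0 < q"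
      using pq(2) unfolding pq(3) by (cases p) auto
    ultimately show ?thesis
      using x(3)[of n] Suc pq(3)[symmetric] by (auto simp: m_def transfer_def add.commute)
  qed
  then show ?thesis
    using min by (intro exI[of _ "1 # row_major \<tau> m"]) (auto simp: correct_answer_def)
next
  case False
  \<comment> \<open>Either no admissible move exists or the costs have no potential; both exclude a
    minimum, so the answer 0 is right.\<close>
  have "\<not> minimum_move \<tau> (linear_objective \<tau> c) s \<Psi> m" for m
  proof
    assume m: "minimum_move \<tau> (linear_objective \<tau> c) s \<Psi> m"
    then have "potential \<tau> c" using tau by (intro minimum_move_potential) auto
    moreover have "\<exists>d<length D. \<exists>y. sat (D ! d) y"
      using m unfolding minimum_move_def admissible_iff[OF \<Psi>] by blast
    ultimately show False using False by (simp add: solvable_def)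
  qed
  then show ?thesis
    using a False by (intro exI[of _ "[0]"]) (simp add: correct_answer_def answered_def)
qed

section \<open>The running time in terms of the encoding length\<close>

lemma total_encoding: "total < 2 ^ encoding_length \<tau> s"
proof -
  have "(\<Sum>i<n. s i) < 2 ^ (\<Sum>i<n. max 1 (floorlog 2 (nat (s i))))" if "n \<le> \<tau>" for n
    using that
  proof (induction n)
    case (Suc n)
    let ?l = "max 1 (floorlog 2 (nat (s n)))" and ?a = "\<Sum>i<n. max 1 (floorlog 2 (nat (s i)))"
    have "0 \<le> s n" using soc Suc.prems by (simp add: society_def)
    moreover have "nat (s n) < 2 ^ ?l" by (rule floorlog_leD) auto
    ultimately have "s n < 2 ^ ?l" by (simp add: nat_less_iff)
    moreover have "(\<Sum>i<n. s i) < 2 ^ ?a" using Suc by simp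
    \<comment> \<open>Expanded, this gives \<open>2 ^ a + 2 ^ l \<le> 2 ^ (a + l) + 1\<close> for
      the exponents \<open>a\<close> and \<open>l\<close> at hand, so the bounds of the two summands
      combine.\<close>
    moreover have "0 \<le> ((2::int) ^ ?a - 1) * (2 ^ ?l - 1)" by (intro mult_nonneg_nonneg) auto
    ultimately show ?case
      by (simp add: power_add algebra_simps)
  qed simp
  from this[OF order.refl] show ?thesis
    by (simp add: total_def encoding_length_def)
qed

text \<open>Even the entry 0 takes one digit. This allows one factor \<tau> to be charged to the
  encoding length.\<close>

lemma tau_le_encoding: "\<tau> \<le> encoding_length \<tau> s"
proof -
  have "(\<Sum>i<\<tau>. 1) \<le> encoding_length \<tau> s"
    unfolding encoding_length_def by (intro sum_mono) simp
  then show ?thesis by simp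
qed

text \<open>All summands are bounded by multiples of the same product \<open>Z\<close>. The exponent
  4 consists of one factor for the number of disjuncts and three from \<open>unit_time\<close>; the
  constants add up to 21342, which is below \<open>2 ^ 15\<close>.\<close>

lemma solver_time_bound:
  "solver_time (encoding_length \<tau> s) \<le>
     2 ^ 15 * (\<gamma> + 6) ^ 3 * (states_bound \<gamma> \<alpha> + 3)\<^sup>2 * (\<tau> + \<delta>) ^ 4 * encoding_length \<tau> s"
proof -
  define e where "e = encoding_length \<tau> s"
  define q where "q = (\<gamma> + 6) ^ 3 * (states_bound \<gamma> \<alpha> + 3)\<^sup>2"
  define Z where "Z = q * (\<tau> + \<delta>) ^ 4 * e"
  have e: "\<tau> \<le> e" "1 \<le> e" using tau_le_encoding tau by (auto simp: e_def)
  have D: "length D \<le> \<delta>" using bounds by (simp add: dnf_bounds_def)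
  have q: "1 \<le> q" by (simp add: q_def)
  have V: "1 \<le> \<tau> + \<delta>" using tau by simp
  have pos: "(\<tau> + \<delta>) ^ k * e \<le> Z" if "k \<le> 4" for k
  proof -
    have "1 * (\<tau> + \<delta>) ^ k * e \<le> q * (\<tau> + \<delta>) ^ 4 * e"
      using q V that by (intro mult_le_mono power_increasing) auto
    then show ?thesis by (simp add: Z_def)
  qed
  have eZ: "e \<le> Z" using pos[of 0] by simp
  have tt: "\<tau> * \<tau> \<le> Z"
  proof -
    have "\<tau> * \<tau> \<le> (\<tau> + \<delta>) ^ 1 * e" using e by (intro mult_le_mono) auto
    then show ?thesis using pos[of 1] by simp
  qed
  have dZ: "length D \<le> Z"
  proof -
    have "length D * 1 \<le> (\<tau> + \<delta>) ^ 1 * e" using e D by (intro mult_le_mono) auto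
    then show ?thesis using pos[of 1] by simp
  qed
  \<comment> \<open>Replacing the sum by a product separates \<gamma>, which goes into the
    computable factor, from \<open>\<tau> + \<delta>\<close>.\<close>
  have W: "\<tau> + \<gamma> + 5 \<le> (\<gamma> + 6) * (\<tau> + \<delta>)"
  proof -
    have "\<gamma> \<le> \<gamma> * \<tau>" using tau by simp
    then have "\<tau> + \<gamma> + 5 \<le> (\<gamma> + 6) * \<tau>" unfolding distrib_right using tau by linarith
    then show ?thesis by (simp add: algebra_simps)
  qed
  have "unit_time e \<le> 10000 * (e + e) * ((\<gamma> + 6) * (\<tau> + \<delta>)) ^ 3 * (states_bound \<gamma> \<alpha> + 3)\<^sup>2"
    unfolding unit_time_def bound_def using e W by (intro mult_le_mono power_mono) auto
  then have "length D * unit_time e \<le>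
      (\<tau> + \<delta>) * (10000 * (e + e) * ((\<gamma> + 6) * (\<tau> + \<delta>)) ^ 3 * (states_bound \<gamma> \<alpha> + 3)\<^sup>2)"
    using D by (intro mult_le_mono) auto
  also have "\<dots> = 20000 * Z"
    by (simp add: Z_def q_def power_mult_distrib power4_eq_xxxx power3_eq_cube)
  finally have u: "length D * unit_time e \<le> 20000 * Z" .
  have "solver_time e \<le> 1000 * Z + 210 * Z + 40 * Z + 80 * Z + (20000 * Z + 12 * Z)"
    unfolding solver_time_def using e eZ tt dZ u by (simp add: distrib_left)
  also have "\<dots> \<le> 2 ^ 15 * Z" by simp
  finally show ?thesis
    by (simp add: Z_def q_def e_def mult.assoc)
qed

end

section \<open>The computable factor\<close>

text \<open>\<open>states_bound\<close> is at most 2 to a cubic polynomial in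
  \<open>\<gamma> + \<alpha> + 3\<close>. Rounding the exponent up to a power of two makes the
  function easy to program without multiplication.\<close>

definition rate :: "nat \<Rightarrow> nat \<Rightarrow> nat" where
  "rate \<gamma> \<alpha> = 2 ^ 2 ^ (3 * (\<gamma> + \<alpha> + 3))"

lemma le_pow2: "n \<le> 2 ^ n" for n :: nat
  by (rule less_imp_le) (rule less_exp)

text \<open>Since \<open>h\<close> is at least \<open>\<gamma> + 2\<close> and
  \<open>\<alpha> + 2\<close>, every factor is at most a power of two and only exponents in
  \<open>h\<close> remain to be compared.\<close>

lemma states_bound_le:
  assumes h: "h = \<gamma> + \<alpha> + 3"
  shows "states_bound \<gamma> \<alpha> \<le> 2 ^ ((h * h + 4 * h) * h)"
proof -
  have "2 * \<alpha> + 1 \<le> 2 * 2 ^ \<alpha> * 2"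
  proof -
    have "1 \<le> (2::nat) ^ \<alpha>" by simp
    with le_pow2[of \<alpha>] show ?thesis by linarith
  qed
  also have "\<dots> = 2 ^ (\<alpha> + 2)"
    by simp
  also have "\<dots> \<le> 2 ^ h"
    using h by (intro power_increasing) auto
  finally have "(2 * \<alpha> + 1) ^ \<gamma> \<le> (2 ^ h) ^ \<gamma>"
    by (rule power_mono) simp
  also have "\<dots> \<le> 2 ^ (h * h)"
    unfolding power_mult[symmetric] using h by (intro power_increasing mult_le_mono) auto
  finally have 1: "(2 * \<alpha> + 1) ^ \<gamma> \<le> 2 ^ (h * h)" .
  have "2 + \<gamma> * \<alpha> \<le> h * h"
    using h by (simp add: algebra_simps)
  also have "\<dots> \<le> 2 ^ h * 2 ^ h"
    by (intro mult_le_mono le_pow2)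
  finally have "(2 * \<alpha> + 1) ^ \<gamma> * (2 + \<gamma> * \<alpha>) \<le> 2 ^ (h * h) * (2 ^ h * 2 ^ h)"
    using 1 by (intro mult_le_mono) auto
  then have x: "(2 * \<alpha> + 1) ^ \<gamma> * (2 + \<gamma> * \<alpha>) \<le> 2 ^ (h * h + 2 * h)"
    by (simp add: power_add mult_2)
  have "2 * (4 * ((2 * \<alpha> + 1) ^ \<gamma> * (2 + \<gamma> * \<alpha>)) + 1) \<le> 2 ^ 4 * 2 ^ (h * h + 2 * h)"
  proof -
    have "2 * (4 * X + 1) \<le> 2 ^ 4 * Y" if "X \<le> Y" "1 \<le> Y" for X Y :: nat
      using that by simp
    from this[OF x] show ?thesis by simp
  qed
  also have "\<dots> \<le> 2 ^ (h * h + 4 * h)"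
    unfolding power_add[symmetric] using h by (intro power_increasing) auto
  finally have "states_bound \<gamma> \<alpha> \<le> (2 ^ (h * h + 4 * h)) ^ (\<gamma> + 2)"
    unfolding states_bound_def by (rule power_mono) simp
  also have "\<dots> \<le> 2 ^ ((h * h + 4 * h) * h)"
    unfolding power_mult[symmetric] using h by (intro power_increasing mult_le_mono) auto
  finally show ?thesis .
qed

lemma rate_bound: "2 ^ 15 * (\<gamma> + 6) ^ 3 * (states_bound \<gamma> \<alpha> + 3)\<^sup>2 \<le> rate \<gamma> \<alpha>"
proof -
  define h where "h = \<gamma> + \<alpha> + 3"
  define E where "E = (h * h + 4 * h) * h"
  have e1: "(h + 1) * 3 = 3 * h + 3" and e2: "(E + 2) * 2 = 2 * E + 4"
    by simp_all
  have h3: "3 \<le> h" by (simp add: h_def)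
  have "\<gamma> + 6 \<le> 2 * h"
    by (simp add: h_def)
  also have "\<dots> \<le> 2 ^ (h + 1)"
    using le_pow2[of h] by simp
  finally have "(\<gamma> + 6) ^ 3 \<le> (2 ^ (h + 1)) ^ 3"
    by (rule power_mono) simp
  then have 1: "(\<gamma> + 6) ^ 3 \<le> 2 ^ (3 * h + 3)"
    by (simp only: power_mult[symmetric] e1)
  have "states_bound \<gamma> \<alpha> + 3 \<le> 2 ^ E + 3 * 2 ^ E"
    using states_bound_le[OF h_def] unfolding E_def by (intro add_mono) auto
  then have "states_bound \<gamma> \<alpha> + 3 \<le> 2 ^ (E + 2)"
    by (simp add: power_add)
  then have "(states_bound \<gamma> \<alpha> + 3)\<^sup>2 \<le> (2 ^ (E + 2))\<^sup>2"
    by (rule power_mono) simp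
  then have 2: "(states_bound \<gamma> \<alpha> + 3)\<^sup>2 \<le> 2 ^ (2 * E + 4)"
    by (simp only: power_mult[symmetric] e2)
  have "2 ^ 15 * (\<gamma> + 6) ^ 3 * (states_bound \<gamma> \<alpha> + 3)\<^sup>2 \<le> 2 ^ 15 * 2 ^ (3 * h + 3) * 2 ^ (2 * E + 4)"
    using 1 2 by (intro mult_le_mono) auto
  also have "\<dots> = 2 ^ (15 + (3 * h + 3) + (2 * E + 4))"
    by (simp only: power_add)
  also have "\<dots> \<le> 2 ^ 2 ^ (3 * h)"
  proof (rule power_increasing)
    have E: "E = h * h * h + 4 * (h * h)"
      by (simp add: E_def algebra_simps)
    \<comment> \<open>With \<open>y\<close> and \<open>z\<close> standing for the square and the
      cube of \<open>h\<close>, the estimate becomes linear; both premises follow from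
      \<open>3 \<le> h\<close>.\<close>
    have "15 + (3 * h + 3) + (2 * (z + 4 * y) + 4) \<le> 8 * z" if "3 * h \<le> y" "3 * y \<le> z" for y z
      using that h3 by simp
    from this[of "h * h" "h * h * h"] have "15 + (3 * h + 3) + (2 * E + 4) \<le> 8 * (h * h * h)"
      using h3 by (simp add: E)
    also have "\<dots> = (2 * h) ^ 3"
      by (simp add: power3_eq_cube)
    also have "\<dots> \<le> (2 ^ h) ^ 3"
    proof (rule power_mono)
      \<comment> \<open>The inequality \<open>2 * h \<le> 2 ^ h\<close> fails at
        \<open>h = 1\<close>; the shift by 2 starts the induction where it holds.\<close>
      have "2 * (k + 2) \<le> (2::nat) ^ (k + 2)" for k
        by (induction k) auto
      moreover have "h = h - 2 + 2" using h3 by simp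
      ultimately show "2 * h \<le> 2 ^ h" by metis
    qed simp
    finally show "15 + (3 * h + 3) + (2 * E + 4) \<le> 2 ^ (3 * h)"
      by (simp add: power_mult[symmetric] mult.commute)
  qed simp
  finally show ?thesis
    by (simp add: rate_def h_def)
qed

lemma double_loop:
  assumes "\<sigma> l 0 = int n" "l \<noteq> i" "l \<noteq> x" "i \<noteq> x"
  shows "wp (x ::= N 1 ;; For i l (inc x (cell x))) (\<lambda>t \<rho>. \<rho> x 0 = 2 ^ n \<and>
    (\<forall>y. y \<notin> {i, x} \<longrightarrow> \<rho> y = \<sigma> y)) \<sigma>"
  unfolding wp_Seq[of "Assign _ _ _"] wp_Assign
  by (rule wp_For[where n = n and T = 20 and I = "\<lambda>k \<rho>. \<rho> x 0 = 2 ^ k"]) (use assms in auto)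

text \<open>The power computed by the first loop is the number of rounds of the second. This is
  harmless, as \<open>computable\<close> asks for termination only.\<close>

definition Rate :: com where
  "Rate = Seq (2 ::= Plus (V 0 (N 0)) (Plus (V 0 (N 1)) (N 3)) ;; inc 2 (Plus (cell 2) (cell 2)))
     (Seq (3 ::= N 1 ;; For 4 2 (inc 3 (cell 3))) (1 ::= N 1 ;; For 4 3 (inc 1 (cell 1))))"

lemma computable_rate: "computable rate"
  unfolding computable_def
proof (rule exI[of _ Rate], intro allI)
  fix x y
  let ?\<sigma> = "input_state [int x, int y]"
  define n where "n = 3 * (x + y + 3)"
  have "wp (2 ::= Plus (V 0 (N 0)) (Plus (V 0 (N 1)) (N 3)) ;; inc 2 (Plus (cell 2) (cell 2)))
      (\<lambda>t \<rho>. \<rho> 2 0 = int n) ?\<sigma>"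
    by (simp add: input_state_def n_def)
  then have "wp Rate (\<lambda>t \<rho>. \<rho> 1 0 = int (2 ^ 2 ^ n)) ?\<sigma>"
    unfolding Rate_def wp_Seq[of "Seq (Assign 2 _ _) _"]
  proof (rule wp_mono, goal_cases)
    case (1 t \<rho>)
    show ?case
      unfolding wp_Seq[of "Seq (Assign 3 _ _) _"]
    proof (rule wp_mono[OF double_loop[where n = n]], goal_cases)
      case (5 t' \<rho>')
      then show ?case
        by (intro wp_mono[OF double_loop[where n = "2 ^ n"]]) auto
    qed (use 1 in auto)
  qed
  then obtain t \<rho> where "exec Rate ?\<sigma> t \<rho>" "\<rho> 1 0 = int (rate x y)"
    unfolding wp_def n_def rate_def by auto
  then show "\<exists>t. computes Rate [int x, int y] [int (rate x y)] t"
    by (auto simp: computes_def)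
qed

theorem theorem4:
  "\<exists>(g :: nat \<Rightarrow> nat \<Rightarrow> nat) (k :: nat) (A :: com). computable g \<and>
     (\<forall>(\<tau> :: nat) (\<delta> :: nat) (\<gamma> :: nat) (\<alpha> :: nat) (\<beta> :: nat)
        (s :: nat \<Rightarrow> int) (\<Psi> :: pa) (D :: dnf) (c :: nat \<Rightarrow> nat \<Rightarrow> int).
        1 \<le> \<tau> \<longrightarrow> society \<tau> s \<longrightarrow> \<Psi> \<in> P0 \<tau> \<delta> \<gamma> \<alpha> \<beta> \<longrightarrow>
        dnf_bounds \<tau> \<delta> \<gamma> \<alpha> \<beta> D \<longrightarrow> pa_equiv \<Psi> (dnf_formula D) \<longrightarrow>
        (\<exists>ys t. computes A (encode_instance \<tau> s c D) ys t \<and>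
                correct_answer \<tau> (linear_objective \<tau> c) s \<Psi> ys \<and>
                t \<le> g \<gamma> \<alpha> * (\<tau> + \<delta>) ^ k * encoding_length \<tau> s))"
proof (rule exI[of _ rate], rule exI[of _ 4], rule exI[of _ Solver], intro conjI allI impI)
  show "computable rate"
    by (rule computable_rate)
next
  fix \<tau> \<delta> \<gamma> \<alpha> \<beta> :: nat and s :: "nat \<Rightarrow> int" and \<Psi> :: pa and D :: dnf and c :: "nat \<Rightarrow> nat \<Rightarrow> int"
  assume a: "1 \<le> \<tau>" "society \<tau> s" "dnf_bounds \<tau> \<delta> \<gamma> \<alpha> \<beta> D" and \<Psi>: "pa_equiv \<Psi> (dnf_formula D)"
  interpret instance_data \<tau> \<delta> \<gamma> \<alpha> \<beta> s D c
    using a by unfold_locales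
  from Solver_spec[OF total_encoding] obtain t \<rho> where
    t: "exec Solver (input_state (encode_instance \<tau> s c D)) t \<rho>" "t \<le> solver_time (encoding_length \<tau> s)"
    and "answered \<rho>"
    by (auto simp: wp_def)
  then obtain ys where "\<forall>i<length ys. \<rho> OUT (int i) = ys ! i"
      "correct_answer \<tau> (linear_objective \<tau> c) s \<Psi> ys"
    using answered_correct[OF \<Psi>] by blast
  moreover have "t \<le> rate \<gamma> \<alpha> * (\<tau> + \<delta>) ^ 4 * encoding_length \<tau> s"
    using t(2) solver_time_bound rate_bound by (meson mult_le_mono1 order_trans)
  ultimately show "\<exists>ys t. computes Solver (encode_instance \<tau> s c D) ys t \<and>
                correct_answer \<tau> (linear_objective \<tau> c) s \<Psi> ys \<and>
                t \<le> rate \<gamma> \<alpha> * (\<tau> + \<delta>) ^ 4 * encoding_length \<tau> s"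
    using t(1) unfolding computes_def by blast
qed

end
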